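(* Let $(a_1,a_2,a_3,\dots)$ be a strictly increasing (finite or infinite) sequence of integers with $a_1\ge 2$, and let $k>1$ be an integer dividing every $a_i$. If the sequence is realized by a knot or link $K$ in $S^3$, then $K$ has at least $k$ components.
   Context: Knots and links are tame and considered up to ambient isotopy in $S^3$. A diagram is a regular projection to the 2-sphere $S^2$ (finitely many transverse double points, with over/under information). Forgetting over/under information, a diagram is regarded as a finite 4-valent graph (possibly with multiple edges) embedded in $S^2$, whose vertices are the crossings (at least one crossing is present). Its faces are the complementary regions in $S^2$; a face is an $n$-gon if its boundary has $n$ edges. All diagrams are assumed connected and reduced: the graph is connected and the removal of any single vertex does not separate it (topologically); in particular the two endpoints of an edge never occur at the same vertex. The sequence $(a_1,a_2,\dots)$ is realized by $K$ if $K$ has a diagram such that the number of edges of each face is some $a_i$ in the sequence (not every $a_i$ need occur). *)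

theory Defs
  imports "HOL-Analysis.Analysis"
begin

section \<open>Tame links in the 3-sphere\<close>

text \<open>
  The 3-sphere is the unit sphere of \<open>\<real>\<^sup>3 \<times> \<real>\<close>.  Removing the two poles \<open>(0, 1)\<close> and \<open>(0, -1)\<close>
  leaves a product \<open>S\<^sup>2 \<times> \<real>\<close>, whose projection to \<open>S\<^sup>2\<close> is \<open>(x, t) \<mapsto> x / |x|\<close>.
\<close>

definition S2 :: "(real^3) set" where
  "S2 = sphere 0 1"

definition S3 :: "((real^3) \<times> real) set" where
  "S3 = sphere 0 1"

definition link :: "((real^3) \<times> real) set \<Rightarrow> bool" where
  "link K \<longleftrightarrow> K \<noteq> {} \<and> K \<subseteq> S3 \<and> finite (components K) \<and>
     (\<forall>C \<in> components K. C homeomorphic sphere (0::complex) 1)"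

definition ambient_isotopic :: "((real^3) \<times> real) set \<Rightarrow> ((real^3) \<times> real) set \<Rightarrow> bool" where
  "ambient_isotopic K L \<longleftrightarrow>
     (\<exists>H :: real \<Rightarrow> (real^3) \<times> real \<Rightarrow> (real^3) \<times> real.
        continuous_on ({0..1} \<times> S3) (\<lambda>(t, x). H t x) \<and>
        (\<forall>t \<in> {0..1}. \<exists>G. homeomorphism S3 S3 (H t) G) \<and>
        (\<forall>x \<in> S3. H 0 x = x) \<and>
        H 1 ` K = L)"

text \<open>Polygonality in the 3-sphere: a finite union of great-circle segments, each obtained by
  radially projecting a straight segment of \<open>\<real>\<^sup>4\<close> that misses the origin.\<close>

definition polygonal :: "((real^3) \<times> real) set \<Rightarrow> bool" where
  "polygonal P \<longleftrightarrow>
     (\<exists>S. finite S \<and> (\<forall>(a, b) \<in> S. 0 \<notin> closed_segment a b) \<and>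
          P = (\<Union>(a, b) \<in> S. sgn ` closed_segment a b))"

definition tame_link :: "((real^3) \<times> real) set \<Rightarrow> bool" where
  "tame_link K \<longleftrightarrow> link K \<and> (\<exists>P. link P \<and> polygonal P \<and> ambient_isotopic K P)"


section \<open>Diagrams\<close>

definition proj :: "(real^3) \<times> real \<Rightarrow> real^3" where
  "proj z = sgn (fst z)"

definition crossings :: "((real^3) \<times> real) set \<Rightarrow> (real^3) set" where
  "crossings L = {p. \<exists>z \<in> L. \<exists>w \<in> L. z \<noteq> w \<and> proj z = p \<and> proj w = p}"

text \<open>
  Transversality in the topological (tame) category: near \<open>p\<close> the link consists of two
  disjoint strands \<open>A\<close> and \<open>B\<close>, and a chart of \<open>S\<^sup>2\<close> around \<open>p\<close> takes their projections
  injectively onto the two coordinate axes of the plane.  In particular \<open>p\<close> has exactly two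
  preimages, and two strands that merely touch at \<open>p\<close> are excluded.
\<close>

definition transverse_double_point :: "((real^3) \<times> real) set \<Rightarrow> real^3 \<Rightarrow> bool" where
  "transverse_double_point L p \<longleftrightarrow>
     (\<exists>(U :: (real^3) set) (h :: real^3 \<Rightarrow> real \<times> real) g A B.
        openin (top_of_set S2) U \<and> p \<in> U \<and>
        homeomorphism U UNIV h g \<and> h p = (0, 0) \<and>
        openin (top_of_set L) A \<and> openin (top_of_set L) B \<and>
        A \<inter> B = {} \<and> A \<union> B = {z \<in> L. proj z \<in> U} \<and>
        bij_betw (h \<circ> proj) A (UNIV \<times> {0}) \<and>
        bij_betw (h \<circ> proj) B ({0} \<times> UNIV))"

definition regular_projection :: "((real^3) \<times> real) set \<Rightarrow> bool" where
  "regular_projection L \<longleftrightarrow>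
     (\<forall>z \<in> L. fst z \<noteq> 0) \<and> finite (crossings L) \<and>
     (\<forall>p \<in> crossings L. transverse_double_point L p)"

text \<open>A diagram of \<open>K\<close> is given by a representative \<open>L\<close> of the ambient isotopy class of \<open>K\<close> with
  regular projection; the over/under information at a crossing is the order of the last
  coordinates of its two preimages.\<close>

definition is_diagram_of :: "((real^3) \<times> real) set \<Rightarrow> ((real^3) \<times> real) set \<Rightarrow> bool" where
  "is_diagram_of L K \<longleftrightarrow> ambient_isotopic K L \<and> regular_projection L"

definition shadow :: "((real^3) \<times> real) set \<Rightarrow> (real^3) set" where
  "shadow L = proj ` L"

definition connected_reduced :: "((real^3) \<times> real) set \<Rightarrow> bool" where
  "connected_reduced L \<longleftrightarrow> crossings L \<noteq> {} \<and> connected (shadow L) \<and>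
     (\<forall>v \<in> crossings L. connected (shadow L - {v}))"

text \<open>Edges are open edges of the graph, that is, without their end vertices.\<close>

definition edges :: "((real^3) \<times> real) set \<Rightarrow> (real^3) set set" where
  "edges L = components (shadow L - crossings L)"

definition faces :: "((real^3) \<times> real) set \<Rightarrow> (real^3) set set" where
  "faces L = components (S2 - shadow L)"

text \<open>No multiplicities are needed here: a 4-valent graph has no bridges, so every edge of the
  diagram has two different faces on its two sides.\<close>

definition boundary_edges :: "((real^3) \<times> real) set \<Rightarrow> (real^3) set \<Rightarrow> (real^3) set set" where
  "boundary_edges L F = {e \<in> edges L. e \<subseteq> (top_of_set S2) frontier_of F}"

text \<open>A finite or infinite sequence is a pair of a function \<open>a\<close> and a length \<open>N\<close>, possibly \<open>\<infinity>\<close>;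
  its terms are \<open>a i\<close> with \<open>i\<close> in the following index set.\<close>

definition seq_index :: "enat \<Rightarrow> nat set" where
  "seq_index N = {i. 1 \<le> i \<and> enat i \<le> N}"

definition realized_by :: "enat \<Rightarrow> (nat \<Rightarrow> int) \<Rightarrow> ((real^3) \<times> real) set \<Rightarrow> bool" where
  "realized_by N a K \<longleftrightarrow>
     (\<exists>L. is_diagram_of L K \<and> connected_reduced L \<and>
          (\<forall>F \<in> faces L. \<exists>i \<in> seq_index N. int (card (boundary_edges L F)) = a i))"

end

theory Submission
  imports Defs "HOL-Complex_Analysis.Winding_Numbers"
begin

text \<open>
  The faces of a link diagram can be coloured black and white so that every edge separates a black face
  from a white one.  Direct each edge so that its black face lies on the left.  Then the edges
  on the frontier of a black face form a cycle that follows the directions, and those of a white face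
  form a cycle against the directions.  The length of each of these cycles is a multiple of \<open>k\<close>, and they
  generate all cycles of the graph.  So along every closed walk the number of edges, counted with sign,
  is a multiple of \<open>k\<close>, and there is a function \<open>f\<close> from crossings to residues modulo \<open>k\<close> that increases by
  one along each edge (\<open>potential_exists\<close>).  Label an edge by the value of \<open>f\<close> at its tail.  As the
  colours alternate around a crossing, so do ingoing and outgoing edges; two opposite edges are
  both ingoing or both outgoing and therefore have the same label (\<open>strand_label\<close>).  Thus
  the label is constant along each component of the link.  On the other hand every crossing has an
  outgoing edge, so that an edge with label \<open>c\<close> is followed by one with label \<open>c + 1\<close>, and
  all \<open>k\<close> labels occur.  Hence there are at least \<open>k\<close> components.

  The topology behind this is expressed by winding numbers.  That a face lies on the left of an edge
  means that the winding number of the path along the edge jumps by one when an interior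
  point of the edge is approached from there and from the opposite face.  That an edge has
  exactly two faces follows from the Jordan curve theorem and Janiszewski's theorem (\<open>edge_two_faces\<close>).
  The colour of a face is the parity of the total winding number of the projected components around it
  (\<open>edge_faces\<close>).  Instead of walks along the frontiers of faces, an arbitrary closed integral chain
  of edges is considered.  Its winding number is an integer on every face and jumps across an edge by the
  coefficient of that edge; so the sum of all coefficients is a combination of winding numbers,
  in which the factor of each face is, up to sign, its number of edges
  (\<open>closed_chain_total_dvd\<close>).  The alternation at a crossing comes from the winding number of a small
  triangle in a chart (\<open>adjacent_half_edges\<close>).
\<close>

section \<open>Jumps of winding numbers across a curve\<close>

text \<open>As a limit rather than a difference of two values, the jump at \<open>x\<close> ignores whatever is continuous
  at \<open>x\<close>.  So for the winding number of a path only the piece through \<open>x\<close> matters, and the path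
  need not be closed.\<close>

definition jump :: "(complex \<Rightarrow> complex) \<Rightarrow> complex set \<Rightarrow> complex set \<Rightarrow> complex \<Rightarrow> complex \<Rightarrow> bool" where
  "jump f A B x c \<longleftrightarrow> ((\<lambda>(p, q). f p - f q) \<longlongrightarrow> c) ((at x within A) \<times>\<^sub>F (at x within B))"

lemma jump_continuous:
  assumes "isCont f x"
  shows "jump f A B x 0"
proof -
  have *: "(f \<longlongrightarrow> f x) (at x within S)" for S
    using assms by (meson continuous_at tendsto_within_subset UNIV_I subsetI)
  have "((\<lambda>z. f (fst z)) \<longlongrightarrow> f x) ((at x within A) \<times>\<^sub>F (at x within B))"
    by (rule filterlim_compose[OF * filterlim_fst])
  moreover have "((\<lambda>z. f (snd z)) \<longlongrightarrow> f x) ((at x within A) \<times>\<^sub>F (at x within B))"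
    by (rule filterlim_compose[OF * filterlim_snd])
  ultimately have "((\<lambda>z. f (fst z) - f (snd z)) \<longlongrightarrow> f x - f x) ((at x within A) \<times>\<^sub>F (at x within B))"
    by (rule tendsto_diff)
  then show ?thesis
    by (simp add: jump_def case_prod_unfold)
qed

lemma jump_cong_near:
  assumes "jump f A B x c" "open N" "x \<in> N" "\<And>p. p \<in> (A \<union> B) \<inter> N \<Longrightarrow> f p = g p"
  shows "jump g A B x c"
proof -
  have "\<forall>\<^sub>F z in (at x within A) \<times>\<^sub>F (at x within B).
          (\<lambda>(p, q). f p - f q) z = (\<lambda>(p, q). g p - g q) z"
    unfolding eventually_prod_filter
  proof (intro exI conjI allI impI)
    show "\<forall>\<^sub>F p in at x within A. p \<in> A \<inter> N" "\<forall>\<^sub>F q in at x within B. q \<in> B \<inter> N"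
      using assms(2,3) by (auto simp: eventually_at_topological)
  qed (use assms(4) in auto)
  with assms(1) show ?thesis
    unfolding jump_def by (simp add: filterlim_cong)
qed

lemma jump_cong:
  assumes "jump f A B x c" "\<And>p. p \<in> A \<union> B \<Longrightarrow> f p = g p"
  shows "jump g A B x c"
  using jump_cong_near[OF assms(1), of UNIV g] assms(2) by auto

lemma jump_add:
  assumes "jump f A B x c" "jump g A B x d"
  shows "jump (\<lambda>p. f p + g p) A B x (c + d)"
  using tendsto_add[OF assms[unfolded jump_def]]
  by (simp add: jump_def case_prod_unfold algebra_simps)

lemma jump_mult:
  assumes "jump f A B x c"
  shows "jump (\<lambda>p. a * f p) A B x (a * c)"
  using tendsto_mult_left[OF assms[unfolded jump_def], of a]
  by (simp add: jump_def case_prod_unfold algebra_simps)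

lemma jump_minus: "jump f A B x c \<Longrightarrow> jump (\<lambda>p. - f p) A B x (- c)"
  using jump_mult[of f A B x c "-1"] by simp

lemma jump_sum:
  assumes "\<And>i. i \<in> I \<Longrightarrow> jump (f i) A B x (c i)"
  shows "jump (\<lambda>p. \<Sum>i\<in>I. f i p) A B x (\<Sum>i\<in>I. c i)"
  using assms
proof (induction I rule: infinite_finite_induct)
  case (insert i I)
  then show ?case
    using jump_add[of "f i" A B x "c i" "\<lambda>p. \<Sum>i\<in>I. f i p" "\<Sum>i\<in>I. c i"] by simp
qed (auto intro: jump_continuous)

lemma jump_swap:
  assumes "jump f A B x c"
  shows "jump f B A x (- c)"
proof -
  have "((\<lambda>(p, q). f p - f q) \<longlongrightarrow> c)
          (filtermap prod.swap ((at x within B) \<times>\<^sub>F (at x within A)))"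
    using assms unfolding jump_def
    by (metis prod_filter_commute)
  then have "((\<lambda>(q, p). f p - f q) \<longlongrightarrow> c) ((at x within B) \<times>\<^sub>F (at x within A))"
    by (simp add: filterlim_filtermap case_prod_unfold)
  from tendsto_minus[OF this] show ?thesis
    by (simp add: jump_def case_prod_unfold)
qed

lemma jump_eventually_const:
  assumes "jump f A B x c" "x \<in> closure A - A" "x \<in> closure B - B"
    and "\<forall>\<^sub>F p in at x within A. f p = \<alpha>" "\<forall>\<^sub>F q in at x within B. f q = \<beta>"
  shows "c = \<alpha> - \<beta>"
proof -
  have nt: "at x within A \<noteq> bot" "at x within B \<noteq> bot"
    using assms by (auto simp: at_within_eq_bot_iff)
  have "\<forall>\<^sub>F z in (at x within A) \<times>\<^sub>F (at x within B). (\<lambda>(p, q). f p - f q) z = \<alpha> - \<beta>"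
    unfolding eventually_prod_filter using assms(4,5) by auto
  then have "((\<lambda>(p, q). f p - f q) \<longlongrightarrow> \<alpha> - \<beta>) ((at x within A) \<times>\<^sub>F (at x within B))"
    by (rule tendsto_eventually)
  then show ?thesis
    using assms(1) nt unfolding jump_def
    by (intro tendsto_unique) (auto simp: prod_filter_eq_bot)
qed

lemma jump_const:
  assumes "jump f A B x c" "x \<in> closure A - A" "x \<in> closure B - B"
    and "\<And>p. p \<in> A \<Longrightarrow> f p = \<alpha>" "\<And>q. q \<in> B \<Longrightarrow> f q = \<beta>"
  shows "c = \<alpha> - \<beta>"
  by (rule jump_eventually_const[OF assms(1-3)])
     (use assms(4,5) in \<open>auto simp: eventually_at_topological\<close>)

lemma jump_constI:
  assumes "\<And>p. p \<in> A \<Longrightarrow> f p = \<alpha>" "\<And>q. q \<in> B \<Longrightarrow> f q = \<beta>"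
  shows "jump f A B x (\<alpha> - \<beta>)"
proof -
  have "\<forall>\<^sub>F z in (at x within A) \<times>\<^sub>F (at x within B). (\<lambda>(p, q). f p - f q) z = \<alpha> - \<beta>"
    unfolding eventually_prod_filter
    by (rule exI[of _ "\<lambda>p. p \<in> A"], rule exI[of _ "\<lambda>q. q \<in> B"])
       (use assms in \<open>auto simp: eventually_at_topological\<close>)
  then show ?thesis
    unfolding jump_def by (rule tendsto_eventually)
qed

lemma jump_winding_number_off_path:
  assumes "path \<gamma>" "x \<notin> path_image \<gamma>"
  shows "jump (winding_number \<gamma>) A B x 0"
  using assms by (intro jump_continuous continuous_at_winding_number)

lemma jump_reversepath:
  assumes "jump (winding_number \<gamma>) A B x c" "path \<gamma>" "(A \<union> B) \<inter> path_image \<gamma> = {}"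
  shows "jump (winding_number (reversepath \<gamma>)) A B x (- c)"
  by (rule jump_cong[OF jump_minus[OF assms(1)]])
     (use assms in \<open>auto intro!: winding_number_reversepath[symmetric]\<close>)

text \<open>The pieces before and after the parameter interval miss \<open>x\<close>, so their winding numbers are
  continuous there.\<close>

lemma jump_subpath:
  assumes "path \<gamma>" "(A \<union> B) \<inter> path_image \<gamma> = {}" "0 \<le> u" "u \<le> v" "v \<le> 1"
    and "x \<notin> \<gamma> ` ({0..u} \<union> {v..1})"
  shows "jump (winding_number (subpath u v \<gamma>)) A B x c \<longleftrightarrow> jump (winding_number \<gamma>) A B x c"
proof -
  let ?w = "\<lambda>s t. winding_number (subpath s t \<gamma>)"
  have 0: "jump (?w 0 u) A B x 0" "jump (?w v 1) A B x 0"
    using assms by (auto intro!: jump_winding_number_off_path simp: path_image_subpath)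
  have split: "winding_number \<gamma> p = ?w 0 u p + ?w u v p + ?w v 1 p" if "p \<in> A \<union> B" for p
  proof -
    have "p \<notin> path_image \<gamma>" using that assms(2) by auto
    then show ?thesis
      using winding_number_subpath_combine[of \<gamma> p 0 u v] winding_number_subpath_combine[of \<gamma> p 0 v 1]
        assms by simp
  qed
  show ?thesis
  proof
    assume "jump (?w u v) A B x c"
    then have "jump (\<lambda>p. ?w 0 u p + ?w u v p + ?w v 1 p) A B x (0 + c + 0)"
      using 0 by (intro jump_add)
    then show "jump (winding_number \<gamma>) A B x c"
      using jump_cong split by fastforce
  next
    assume "jump (winding_number \<gamma>) A B x c"
    then have "jump (\<lambda>p. winding_number \<gamma> p + - ?w 0 u p + - ?w v 1 p) A B x (c + - 0 + - 0)"
      using 0 by (intro jump_add jump_minus)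
    then show "jump (?w u v) A B x c"
      using jump_cong[of "\<lambda>p. winding_number \<gamma> p + - ?w 0 u p + - ?w v 1 p" A B x c "?w u v"] split
      by fastforce
  qed
qed

section \<open>The two faces at an edge\<close>

lemma open_arc_image:
  assumes "arc \<gamma>"
  shows "path_image \<gamma> - {pathstart \<gamma>, pathfinish \<gamma>} = \<gamma> ` {0<..<1}"
proof -
  have "\<gamma> ` ({0..1} - {0, 1}) = \<gamma> ` {0..1} - \<gamma> ` {0, 1}"
    using assms by (intro inj_on_image_set_diff[where C = "{0..1}"]) (auto simp: arc_def)
  moreover have "{0..1} - {0, 1} = {0<..<1::real}" by auto
  ultimately show ?thesis
    by (simp add: path_image_def pathstart_def pathfinish_def)
qed

text \<open>The edge and an arc back through the rest of the graph form a Jordan curve \<open>J\<close>.  Let \<open>D\<close> be the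
  region around the edge that arises when the edge is erased.  A side \<open>S\<close> of \<open>J\<close> meets \<open>D\<close> in a
  single face: two points of \<open>D \<inter> S\<close> are separated neither by the graph without the edge nor by
  \<open>J\<close>, and these two sets meet in an arc, so by Janiszewski's theorem their union, the whole graph,
  does not separate the points either.  The jump of the edge is that of \<open>J\<close>, whose
  winding number is \<open>\<plusminus>1\<close> inside and \<open>0\<close> outside; naming the two faces in a suitable order makes
  it \<open>1\<close>.\<close>

lemma edge_two_faces:
  fixes G e :: "complex set" and \<gamma> \<delta> :: "real \<Rightarrow> complex"
  assumes G: "compact G" and \<gamma>: "arc \<gamma>" "path_image \<gamma> \<subseteq> G"
    and e: "e = path_image \<gamma> - {pathstart \<gamma>, pathfinish \<gamma>}" and cl: "closed (G - e)"
    and \<delta>: "path \<delta>" "pathstart \<delta> = pathfinish \<gamma>" "pathfinish \<delta> = pathstart \<gamma>" "path_image \<delta> \<subseteq> G - e"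
  obtains F1 F2 where "F1 \<in> components (- G)" "F2 \<in> components (- G)" "F1 \<noteq> F2"
    "e \<subseteq> frontier F1" "e \<subseteq> frontier F2"
    "\<And>F. F \<in> components (- G) \<Longrightarrow> F \<noteq> F1 \<Longrightarrow> F \<noteq> F2 \<Longrightarrow> closure F \<inter> e = {}"
    "\<And>x. x \<in> e \<Longrightarrow> jump (winding_number \<gamma>) F1 F2 x 1"
proof -
  have ne: "pathfinish \<gamma> \<noteq> pathstart \<gamma>"
    using \<gamma>(1) by (metis arc_distinct_ends)
  obtain c where c: "arc c" "path_image c \<subseteq> path_image \<delta>"
      "pathstart c = pathfinish \<gamma>" "pathfinish c = pathstart \<gamma>"
    using path_contains_arc[OF \<delta>(1-3) ne] by metis
  have cG: "path_image c \<subseteq> G - e"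
    using c(2) \<delta>(4) by blast
  define J where "J = \<gamma> +++ c"
  have pJ: "path_image J = path_image \<gamma> \<union> path_image c"
    unfolding J_def using c(3) by (simp add: path_image_join)
  have J: "simple_path J" "pathfinish J = pathstart J"
    unfolding J_def using \<gamma> c cG e by (auto intro!: simple_path_join_loop)
  have \<gamma>e: "path_image \<gamma> = e \<union> {pathstart \<gamma>, pathfinish \<gamma>}"
    using e by auto
  have ends: "pathstart \<gamma> \<in> path_image c" "pathfinish \<gamma> \<in> path_image c"
    using c(3,4) by (metis pathfinish_in_path_image, metis pathstart_in_path_image)
  have eG: "e \<subseteq> G" using e \<gamma>(2) by auto
  have JG: "path_image J \<union> (G - e) = G" "(G - e) \<inter> path_image J = path_image c"
    using pJ \<gamma>e ends cG eG \<gamma>(2) by auto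
  have e_eq: "e = \<gamma> ` {0<..<1}"
    using open_arc_image[OF \<gamma>(1)] e by simp
  have "connected e"
    unfolding e_eq using \<gamma>(1)
    by (intro connected_continuous_image)
       (auto simp: arc_def path_def elim: continuous_on_subset)
  have "e \<noteq> {}" unfolding e_eq by simp
  then obtain x0 where x0: "x0 \<in> e" by auto
  define D where "D = connected_component_set (- (G - e)) x0"
  have "open (- (G - e))" using cl by (rule open_Compl)
  then have "open D"
    unfolding D_def by (rule open_connected_component)
  moreover have "e \<subseteq> D"
    unfolding D_def using x0 \<open>connected e\<close> by (intro connected_component_maximal) auto
  moreover have "D \<subseteq> - (G - e)"
    unfolding D_def by (rule connected_component_subset)
  ultimately have D: "open D" "connected D" "e \<subseteq> D" "D \<inter> (G - e) = {}"
    unfolding D_def by auto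
  have jio: "open (inside (path_image J))" "connected (inside (path_image J))"
      "open (outside (path_image J))" "connected (outside (path_image J))"
      "inside (path_image J) \<inter> outside (path_image J) = {}"
      "inside (path_image J) \<union> outside (path_image J) = - path_image J"
      "frontier (inside (path_image J)) = path_image J"
      "frontier (outside (path_image J)) = path_image J"
    using Jordan_inside_outside[OF J] by auto
  \<comment> \<open>to be used for the inside and the outside of \<open>J\<close>\<close>
  have side: "D \<inter> S \<in> components (- G)" "D \<inter> S \<noteq> {}" "e \<subseteq> frontier (D \<inter> S)"
    if S: "open S" "connected S" "S \<inter> path_image J = {}" "frontier S = path_image J" for S
  proof -
    have fr: "x \<in> closure (D \<inter> S)" if "x \<in> e" for x
    proof -
      have "x \<in> closure S"
        using S(4) that pJ \<gamma>e by (auto simp: frontier_def)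
      moreover have "x \<in> D" using that D by auto
      ultimately show ?thesis
        using open_Int_closure_subset[OF D(1), of S] by auto
    qed
    then show "D \<inter> S \<noteq> {}" using x0 by force
    then obtain p where p: "p \<in> D" "p \<in> S" by auto
    have DSG: "D \<inter> S \<subseteq> - G"
      using D(4) S(3) pJ \<gamma>e by auto
    have "D \<inter> S = connected_component_set (- G) p"
    proof (intro equalityI subsetI)
      fix q assume q: "q \<in> D \<inter> S"
      \<comment> \<open>the union is \<open>G\<close>, and the two sets meet in the arc \<open>c\<close>\<close>
      have "connected_component (- ((G - e) \<union> path_image J)) p q"
      proof (rule Janiszewski)
        show "compact (G - e)"
          using G cl by (metis Diff_subset compact_Int_closed inf.absorb_iff2)
        show "closed (path_image J)"
          using J by (simp add: closed_simple_path_image)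
        show "connected ((G - e) \<inter> path_image J)"
          using c(1) JG by (simp add: connected_arc_image)
        show "connected_component (- (G - e)) p q"
          using D p q unfolding connected_component_def by blast
        show "connected_component (- path_image J) p q"
          using S p q unfolding connected_component_def by blast
      qed
      then show "q \<in> connected_component_set (- G) p"
        using JG(1) by (simp add: Un_commute)
    next
      fix q assume q: "q \<in> connected_component_set (- G) p"
      then have cc: "connected_component (- G) p q" by simp
      have "connected_component (- (G - e)) x0 p" using p D_def by simp
      moreover have "connected_component (- (G - e)) p q"
        by (rule connected_component_of_subset[OF cc]) auto
      ultimately have "q \<in> D"
        unfolding D_def by (auto intro: connected_component_trans)
      moreover have "q \<in> S"
      proof (rule ccontr)
        assume "q \<notin> S"
        obtain T where T: "connected T" "T \<subseteq> - G" "p \<in> T" "q \<in> T"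
          using cc unfolding connected_component_def by blast
        then have "T \<inter> frontier S \<noteq> {}"
          using p \<open>q \<notin> S\<close> by (intro connected_Int_frontier) auto
        then show False
          using S(4) T(2) pJ \<gamma>(2) cG by auto
      qed
      ultimately show "q \<in> D \<inter> S" by simp
    qed
    then show "D \<inter> S \<in> components (- G)"
      using p DSG by (auto intro: componentsI)
    show "e \<subseteq> frontier (D \<inter> S)"
    proof
      fix x assume x: "x \<in> e"
      then have "x \<notin> interior (D \<inter> S)"
        using S(3) pJ \<gamma>e interior_subset by fastforce
      with fr[OF x] show "x \<in> frontier (D \<inter> S)" by (simp add: frontier_def)
    qed
  qed
  let ?I = "D \<inter> inside (path_image J)" and ?O = "D \<inter> outside (path_image J)"
  have I: "?I \<in> components (- G)" "?I \<noteq> {}" "e \<subseteq> frontier ?I"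
    using jio by (intro side; auto)+
  have O: "?O \<in> components (- G)" "?O \<noteq> {}" "e \<subseteq> frontier ?O"
    using jio by (intro side; auto)+
  have IO: "?I \<noteq> ?O" using I(2) jio(5) by blast
  have other: "closure F \<inter> e = {}" if F: "F \<in> components (- G)" "F \<noteq> ?I" "F \<noteq> ?O" for F
  proof -
    have "F \<inter> ?I = {}" "F \<inter> ?O = {}"
      using components_nonoverlap F I(1) O(1) by blast+
    moreover have "F \<inter> G = {}" using in_components_subset[OF F(1)] by auto
    ultimately have "F \<inter> D = {}"
      using jio(6) JG(1) by blast
    then have "closure F \<inter> D = {}"
      using open_Int_closure_eq_empty[OF D(1), of F] by auto
    then show ?thesis using D(3) by auto
  qed
  have wn: "jump (winding_number \<gamma>) ?I ?O x s"
    if x: "x \<in> e" and s: "\<And>z. z \<in> inside (path_image J) \<Longrightarrow> winding_number J z = s" for x s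
  proof -
    have "jump (winding_number J) ?I ?O x (s - 0)"
      using s J simple_path_imp_path winding_number_zero_in_outside
      by (intro jump_constI) auto
    moreover have "jump (winding_number c) ?I ?O x 0"
      using x cG c(1) by (intro jump_winding_number_off_path arc_imp_path) auto
    ultimately have "jump (\<lambda>p. winding_number J p + - winding_number c p) ?I ?O x ((s - 0) + - 0)"
      by (intro jump_add jump_minus)
    moreover have "winding_number J p + - winding_number c p = winding_number \<gamma> p" if "p \<in> ?I \<union> ?O" for p
    proof -
      have "p \<notin> path_image J" using that jio(6) by blast
      then show ?thesis
        unfolding J_def using pJ c \<gamma>(1) by (simp add: J_def arc_imp_path winding_number_join)
    qed
    ultimately show ?thesis
      using jump_cong by fastforce
  qed
  from J(1) show thesis
  proof (rule simple_closed_path_winding_number_inside)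
    assume "\<And>z. z \<in> inside (path_image J) \<Longrightarrow> winding_number J z = 1"
    then show thesis
      using that[OF I(1) O(1) IO I(3) O(3) other] wn by blast
  next
    assume "\<And>z. z \<in> inside (path_image J) \<Longrightarrow> winding_number J z = - 1"
    then have "jump (winding_number \<gamma>) ?O ?I x 1" if "x \<in> e" for x
      using wn[OF that] jump_swap by fastforce
    then show thesis
      using that[OF O(1) I(1) _ O(3) I(3) other] IO by blast
  qed
qed

section \<open>Closed chains and the potential\<close>

text \<open>A plane graph \<open>G\<close> with vertices \<open>X\<close> whose open edges are parametrised so that the black face
  lies to their left: this is what the jump \<open>1\<close> from \<open>Fw e\<close> to \<open>Fb e\<close> expresses, without any
  reference to tangents or to an orientation of the plane.\<close>

locale alternating_graph =
  fixes G X :: "complex set" and E :: "complex set set"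
    and \<gamma> :: "complex set \<Rightarrow> real \<Rightarrow> complex"
    and Fb Fw :: "complex set \<Rightarrow> complex set" and black :: "complex set \<Rightarrow> bool"
  assumes finX: "finite X" and finE: "finite E" and E_eq: "E = components (G - X)"
    and edge_arc: "e \<in> E \<Longrightarrow> arc (\<gamma> e)"
    and edge_im: "e \<in> E \<Longrightarrow> path_image (\<gamma> e) \<subseteq> G"
    and edge_interior: "e \<in> E \<Longrightarrow> e = path_image (\<gamma> e) - {pathstart (\<gamma> e), pathfinish (\<gamma> e)}"
    and edge_ends: "e \<in> E \<Longrightarrow> pathstart (\<gamma> e) \<in> X" "e \<in> E \<Longrightarrow> pathfinish (\<gamma> e) \<in> X"
    and faces: "e \<in> E \<Longrightarrow> Fb e \<in> components (- G)" "e \<in> E \<Longrightarrow> Fw e \<in> components (- G)"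
    and colours: "e \<in> E \<Longrightarrow> black (Fb e)" "e \<in> E \<Longrightarrow> \<not> black (Fw e)"
    and frontiers: "e \<in> E \<Longrightarrow> e \<subseteq> frontier (Fb e)" "e \<in> E \<Longrightarrow> e \<subseteq> frontier (Fw e)"
    and two_sided: "e \<in> E \<Longrightarrow> F \<in> components (- G) \<Longrightarrow> F \<noteq> Fb e \<Longrightarrow> F \<noteq> Fw e \<Longrightarrow> closure F \<inter> e = {}"
    and jump_edge: "e \<in> E \<Longrightarrow> x \<in> e \<Longrightarrow> jump (winding_number (\<gamma> e)) (Fb e) (Fw e) x 1"
begin

lemma edge_ne: "e \<in> E \<Longrightarrow> e \<noteq> {}"
  using in_components_nonempty by (auto simp: E_eq)

lemma edge_disj: "e \<in> E \<Longrightarrow> e' \<in> E \<Longrightarrow> e \<noteq> e' \<Longrightarrow> e \<inter> e' = {}"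
  using components_nonoverlap by (auto simp: E_eq)

lemma edge_X: "e \<in> E \<Longrightarrow> e \<inter> X = {}"
  using in_components_subset by (fastforce simp: E_eq)

abbreviation "tail e \<equiv> pathstart (\<gamma> e)"
abbreviation "head e \<equiv> pathfinish (\<gamma> e)"

definition chain_boundary :: "(complex set \<Rightarrow> int) \<Rightarrow> complex \<Rightarrow> int" where
  "chain_boundary m v = (\<Sum>e | e \<in> E \<and> head e = v. m e) - (\<Sum>e | e \<in> E \<and> tail e = v. m e)"

definition chain_winding :: "(complex set \<Rightarrow> int) \<Rightarrow> complex \<Rightarrow> complex" where
  "chain_winding m p = (\<Sum>e\<in>E. of_int (m e) * winding_number (\<gamma> e) p)"

lemma edge_off_other:
  assumes "e \<in> E" "x \<in> e" "e' \<in> E" "e' \<noteq> e"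
  shows "x \<notin> path_image (\<gamma> e')"
  using assms edge_interior[OF assms(3)] edge_disj[of e e'] edge_X[of e] edge_ends[of e'] by auto

text \<open>Up to integers, the winding number of a path is \<open>1 / (2 \<pi> \<i>)\<close> times the difference of the
  logarithms of its two ends relative to \<open>p\<close>.  In a closed chain these logarithms cancel at every
  vertex.\<close>

lemma chain_winding_integer:
  assumes m: "\<And>v. v \<in> X \<Longrightarrow> chain_boundary m v = 0" and p: "p \<notin> G"
  shows "chain_winding m p \<in> \<int>"
proof -
  have nz: "v \<noteq> p" if "e \<in> E" "v = tail e \<or> v = head e" for e v
    using that p edge_im[OF that(1)] by auto
  define l where "l v = Ln (v - p)" for v
  have "\<exists>n::int. 2 * of_real pi * \<i> * winding_number (\<gamma> e) p = l (head e) - l (tail e) + of_int n * (2 * of_real pi * \<i>)"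
    if e: "e \<in> E" for e
  proof -
    have "head e - p = exp (2 * of_real pi * \<i> * winding_number (\<gamma> e) p) * (tail e - p)"
      using winding_number_exp_2pi[of "\<gamma> e" p] arc_imp_path[OF edge_arc[OF e]] edge_im[OF e] p by auto
    then have "exp (l (head e)) = exp (2 * of_real pi * \<i> * winding_number (\<gamma> e) p + l (tail e))"
      using nz[OF e] by (simp add: l_def exp_add)
    then obtain n :: int where "l (head e) = 2 * of_real pi * \<i> * winding_number (\<gamma> e) p + l (tail e) + (of_int (2 * n) * pi) * \<i>"
      using exp_eq by metis
    then have "2 * of_real pi * \<i> * winding_number (\<gamma> e) p = l (head e) - l (tail e) + of_int (-n) * (2 * of_real pi * \<i>)"
      by (simp add: algebra_simps)
    then show ?thesis by blast
  qed
  then obtain n :: "complex set \<Rightarrow> int" where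
    n: "\<And>e. e \<in> E \<Longrightarrow> 2 * of_real pi * \<i> * winding_number (\<gamma> e) p = l (head e) - l (tail e) + of_int (n e) * (2 * of_real pi * \<i>)"
    by metis
  have ends: "(\<Sum>e\<in>E. of_int (m e) * l (u e)) = (\<Sum>v\<in>X. l v * of_int (\<Sum>e | e \<in> E \<and> u e = v. m e))"
    if "\<And>e. e \<in> E \<Longrightarrow> u e \<in> X" for u
  proof -
    have "(\<Sum>e\<in>E. of_int (m e) * l (u e)) = (\<Sum>v\<in>X. \<Sum>e | e \<in> E \<and> u e = v. of_int (m e) * l (u e))"
      using that finX finE by (intro sum.group[symmetric]) auto
    also have "\<dots> = (\<Sum>v\<in>X. l v * of_int (\<Sum>e | e \<in> E \<and> u e = v. m e))"
      by (intro sum.cong refl) (simp add: sum_distrib_left mult.commute)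
    finally show ?thesis .
  qed
  have "2 * of_real pi * \<i> * chain_winding m p = (\<Sum>e\<in>E. of_int (m e) * (2 * of_real pi * \<i> * winding_number (\<gamma> e) p))"
    by (simp add: chain_winding_def sum_distrib_left mult_ac)
  also have "\<dots> = (\<Sum>e\<in>E. of_int (m e) * l (head e)) - (\<Sum>e\<in>E. of_int (m e) * l (tail e))
                   + (\<Sum>e\<in>E. of_int (m e * n e) * (2 * of_real pi * \<i>))"
    unfolding sum_subtractf[symmetric] sum.distrib[symmetric]
    by (intro sum.cong refl) (simp only: n, simp add: ring_distribs)
  also have "(\<Sum>e\<in>E. of_int (m e) * l (head e)) - (\<Sum>e\<in>E. of_int (m e) * l (tail e)) = (\<Sum>v\<in>X. l v * of_int (chain_boundary m v))"
    by (simp add: ends[of head] ends[of tail] edge_ends chain_boundary_def sum_subtractf[symmetric] algebra_simps)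
  also have "\<dots> = 0" using m by simp
  also have "(\<Sum>e\<in>E. of_int (m e * n e) * (2 * of_real pi * \<i>)) = (2 * of_real pi * \<i>) * of_int (\<Sum>e\<in>E. m e * n e)"
    by (simp add: sum_distrib_left mult_ac)
  finally have "chain_winding m p = of_int (\<Sum>e\<in>E. m e * n e)" by simp
  then show ?thesis by (metis Ints_of_int)
qed

lemma chain_winding_constant:
  assumes m: "\<And>v. v \<in> X \<Longrightarrow> chain_boundary m v = 0" and F: "F \<in> components (- G)"
  shows "\<exists>n::int. \<forall>p\<in>F. chain_winding m p = of_int n"
proof -
  have FG: "F \<inter> G = {}" using in_components_subset[OF F] by auto
  have "continuous_on F (chain_winding m)"
    unfolding chain_winding_def
  proof (intro continuous_intros)
    fix e assume e: "e \<in> E"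
    show "continuous_on F (winding_number (\<gamma> e))"
      using continuous_on_winding_number[OF arc_imp_path[OF edge_arc[OF e]]] edge_im[OF e] FG
      by (elim continuous_on_subset) auto
  qed
  moreover have int: "chain_winding m p \<in> \<int>" if "p \<in> F" for p
    using chain_winding_integer[OF m] that FG by auto
  ultimately have "chain_winding m constant_on F"
    using in_components_connected[OF F]
  proof (intro continuous_discrete_range_constant)
    fix p assume "p \<in> F"
    show "\<exists>e>0. \<forall>q. q \<in> F \<and> chain_winding m q \<noteq> chain_winding m p \<longrightarrow> e \<le> cmod (chain_winding m q - chain_winding m p)"
    proof (intro exI[of _ 1] conjI allI impI)
      fix q assume "q \<in> F \<and> chain_winding m q \<noteq> chain_winding m p"
      then have "chain_winding m q - chain_winding m p \<in> \<int>" and ne: "chain_winding m q - chain_winding m p \<noteq> 0"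
        using int \<open>p \<in> F\<close> by (auto intro: Ints_diff)
      then obtain i where "chain_winding m q - chain_winding m p = of_int i" by (auto elim: Ints_cases)
      with ne show "1 \<le> cmod (chain_winding m q - chain_winding m p)" by auto
    qed auto
  qed auto
  then obtain c where "\<And>p. p \<in> F \<Longrightarrow> chain_winding m p = c" unfolding constant_on_def by blast
  moreover obtain p where "p \<in> F" using in_components_nonempty[OF F] by blast
  ultimately show ?thesis using int Ints_cases by metis
qed

text \<open>At an interior point of \<open>e\<close> only the path of \<open>e\<close> itself jumps, and its coefficient is \<open>m e\<close>.\<close>

lemma chain_winding_jump:
  assumes e: "e \<in> E" and b: "\<And>p. p \<in> Fb e \<Longrightarrow> chain_winding m p = of_int B"
    and w: "\<And>p. p \<in> Fw e \<Longrightarrow> chain_winding m p = of_int W"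
  shows "m e = B - W"
proof -
  obtain x where x: "x \<in> e" using edge_ne[OF e] by auto
  have "x \<in> G" using x edge_interior[OF e] edge_im[OF e] by auto
  have "jump (\<lambda>p. of_int (m e') * winding_number (\<gamma> e') p) (Fb e) (Fw e) x (if e' = e then of_int (m e) else 0)"
    if "e' \<in> E" for e'
  proof (cases "e' = e")
    case True
    then show ?thesis
      using jump_mult[OF jump_edge[OF e x], where a = "of_int (m e)"] by simp
  next
    case False
    then show ?thesis
      using jump_mult[OF jump_winding_number_off_path[OF arc_imp_path[OF edge_arc[OF that]] edge_off_other[OF e x that]], where A = "Fb e" and B = "Fw e" and a = "of_int (m e')"]
      by simp
  qed
  then have "jump (chain_winding m) (Fb e) (Fw e) x (\<Sum>e'\<in>E. if e' = e then of_int (m e) else 0)"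
    unfolding chain_winding_def by (rule jump_sum)
  then have "jump (chain_winding m) (Fb e) (Fw e) x (of_int (m e))"
    using e finE by simp
  moreover have "x \<in> closure (Fb e) - Fb e" "x \<in> closure (Fw e) - Fw e"
    using frontiers[OF e] x \<open>x \<in> G\<close> in_components_subset[OF faces(1)[OF e]] in_components_subset[OF faces(2)[OF e]]
    by (auto simp: frontier_def)
  ultimately have "complex_of_int (m e) = of_int B - of_int W"
    by (rule jump_const[OF _ _ _ b w])
  then show ?thesis by (metis of_int_diff of_int_eq_iff)
qed

text \<open>Let \<open>n F\<close> be the winding number of the closed chain around the face \<open>F\<close>.  Then \<open>m e\<close> is
  \<open>n (Fb e) - n (Fw e)\<close>, and in the sum over all edges each face \<open>F\<close> occurs once for every edge
  on its frontier, with positive sign if it is black and with negative sign if it is white.  Each such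
  number of edges is a multiple of \<open>k\<close>.\<close>

lemma closed_chain_total_dvd:
  assumes m: "\<And>v. v \<in> X \<Longrightarrow> chain_boundary m v = 0"
    and k: "\<And>F. F \<in> components (- G) \<Longrightarrow> k dvd int (card {e \<in> E. e \<subseteq> frontier F})"
  shows "k dvd (\<Sum>e\<in>E. m e)"
proof -
  obtain n :: "complex set \<Rightarrow> int" where n: "\<And>F p. F \<in> components (- G) \<Longrightarrow> p \<in> F \<Longrightarrow> chain_winding m p = of_int (n F)"
    using chain_winding_constant[OF m] by metis
  have dvd: "k dvd (\<Sum>e\<in>E. n (S e))"
    if S: "\<And>e. e \<in> E \<Longrightarrow> S e \<in> components (- G)" "\<And>e. e \<in> E \<Longrightarrow> e \<subseteq> frontier (S e)"
      "\<And>e e'. e \<in> E \<Longrightarrow> e' \<in> E \<Longrightarrow> e \<subseteq> frontier (S e') \<Longrightarrow> S e = S e'" for S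
  proof -
    have "(\<Sum>e\<in>E. n (S e)) = (\<Sum>F\<in>S ` E. \<Sum>e | e \<in> E \<and> S e = F. n (S e))"
      using finE by (intro sum.group[symmetric]) auto
    also have "\<dots> = (\<Sum>F\<in>S ` E. int (card {e \<in> E. e \<subseteq> frontier F}) * n F)"
    proof (intro sum.cong refl)
      fix F assume "F \<in> S ` E"
      then obtain e' where e': "e' \<in> E" "F = S e'" by blast
      have "{e. e \<in> E \<and> S e = F} = {e \<in> E. e \<subseteq> frontier F}"
        using S(2) S(3)[OF _ e'(1)] e'(2) by blast
      moreover have "(\<Sum>e | e \<in> E \<and> S e = F. n (S e)) = (\<Sum>e | e \<in> E \<and> S e = F. n F)"
        by (intro sum.cong) auto
      ultimately show "(\<Sum>e | e \<in> E \<and> S e = F. n (S e)) = int (card {e \<in> E. e \<subseteq> frontier F}) * n F"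
        by simp
    qed
    also have "k dvd \<dots>"
      using k S(1) by (intro dvd_sum) auto
    finally show ?thesis .
  qed
  have side: "F = Fb e \<or> F = Fw e" if "e \<in> E" "F \<in> components (- G)" "e \<subseteq> frontier F" for e F
    using two_sided[of e F] that edge_ne[of e] by (auto simp: frontier_def)
  have "k dvd (\<Sum>e\<in>E. n (Fb e))"
  proof (rule dvd)
    show "Fb e = Fb e'" if "e \<in> E" "e' \<in> E" "e \<subseteq> frontier (Fb e')" for e e'
      using side[OF that(1) faces(1)[OF that(2)] that(3)] colours(1)[OF that(1)] colours(2)[OF that(1)]
        colours(1)[OF that(2)] colours(2)[OF that(2)] by metis
  qed (use faces frontiers in auto)
  moreover have "k dvd (\<Sum>e\<in>E. n (Fw e))"
  proof (rule dvd)
    show "Fw e = Fw e'" if "e \<in> E" "e' \<in> E" "e \<subseteq> frontier (Fw e')" for e e'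
      using side[OF that(1) faces(2)[OF that(2)] that(3)] colours(1)[OF that(1)] colours(2)[OF that(1)]
        colours(1)[OF that(2)] colours(2)[OF that(2)] by metis
  qed (use faces frontiers in auto)
  moreover have "(\<Sum>e\<in>E. m e) = (\<Sum>e\<in>E. n (Fb e)) - (\<Sum>e\<in>E. n (Fw e))"
    unfolding sum_subtractf[symmetric]
    using n faces by (intro sum.cong refl chain_winding_jump) auto
  ultimately show ?thesis by simp
qed

lemma chain_boundary_add: "chain_boundary (\<lambda>e. m e + n e) v = chain_boundary m v + chain_boundary n v"
  and chain_boundary_diff: "chain_boundary (\<lambda>e. m e - n e) v = chain_boundary m v - chain_boundary n v"
  by (simp_all add: chain_boundary_def sum.distrib sum_subtractf)

lemma chain_boundary_single:
  assumes "e \<in> E"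
  shows "chain_boundary (\<lambda>e'. of_bool (e' = e)) v = of_bool (v = head e) - of_bool (v = tail e)"
proof -
  have "(\<Sum>e' | e' \<in> E \<and> u e' = v. of_bool (e' = e)) = (of_bool (v = u e) :: int)" for u
  proof -
    have "(\<Sum>e' | e' \<in> E \<and> u e' = v. of_bool (e' = e)) = (\<Sum>e' | e' \<in> E \<and> u e' = v. if e' = e then 1 else 0 :: int)"
      by (intro sum.cong) auto
    also have "\<dots> = of_bool (v = u e)"
      using finE assms by (subst sum.delta) auto
    finally show ?thesis .
  qed
  then show ?thesis by (simp add: chain_boundary_def)
qed

text \<open>The potential of \<open>v\<close> is the total of a chain that leads from a root to \<open>v\<close>.  Two such
  chains differ by a closed chain, whose total is a multiple of \<open>k\<close>; appending the edge \<open>e\<close> to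
  a chain that ends in its tail adds one.\<close>

lemma potential_exists:
  assumes k: "\<And>F. F \<in> components (- G) \<Longrightarrow> k dvd int (card {e \<in> E. e \<subseteq> frontier F})"
  obtains f :: "complex \<Rightarrow> int" where "\<And>e. e \<in> E \<Longrightarrow> k dvd f (head e) - f (tail e) - 1"
proof -
  define conn where "conn u v m \<longleftrightarrow> (\<forall>w\<in>X. chain_boundary m w = of_bool (w = v) - of_bool (w = u))" for u v m
  \<comment> \<open>one root for each class of vertices that are joined by chains\<close>
  define root where "root v = (SOME u. \<exists>m. conn u v m)" for v
  define f where "f v = (\<Sum>e\<in>E. (SOME m. conn (root v) v m) e)" for v
  have "conn v v (\<lambda>_. 0)" for v
    by (simp add: conn_def chain_boundary_def)
  then have root: "\<exists>m. conn (root v) v m" for v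
    unfolding root_def by (intro someI_ex[of "\<lambda>u. \<exists>m. conn u v m"]) blast
  have f: "\<exists>m. conn (root v) v m \<and> f v = (\<Sum>e\<in>E. m e)" for v
    unfolding f_def using root[of v] by (metis someI_ex)
  have "k dvd f (head e) - f (tail e) - 1" if e: "e \<in> E" for e
  proof -
    let ?d = "\<lambda>e'. of_bool (e' = e) :: int"
    have "conn u (head e) (\<lambda>e'. m e' + ?d e')" if "conn u (tail e) m" for u m
      using that chain_boundary_single[OF e] by (simp add: conn_def chain_boundary_add)
    moreover have "conn u (tail e) (\<lambda>e'. m e' - ?d e')" if "conn u (head e) m" for u m
      using that chain_boundary_single[OF e] by (simp add: conn_def chain_boundary_diff)
    ultimately have "(\<exists>m. conn u (head e) m) \<longleftrightarrow> (\<exists>m. conn u (tail e) m)" for u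
      by blast
    then have r: "root (head e) = root (tail e)"
      by (simp add: root_def)
    obtain m where m: "conn (root (head e)) (head e) m" "f (head e) = (\<Sum>e\<in>E. m e)"
      using f by blast
    obtain m' where m': "conn (root (head e)) (tail e) m'" "f (tail e) = (\<Sum>e\<in>E. m' e)"
      using f r by metis
    have "chain_boundary (\<lambda>e'. m e' - m' e' - ?d e') v = 0" if "v \<in> X" for v
      using m(1) m'(1) that chain_boundary_single[OF e] by (simp add: conn_def chain_boundary_diff)
    from closed_chain_total_dvd[OF this k] have "k dvd (\<Sum>e'\<in>E. m e' - m' e' - ?d e')" by simp
    also have "(\<Sum>e'\<in>E. m e' - m' e' - ?d e') = f (head e) - f (tail e) - 1"
    proof -
      have "(\<Sum>e'\<in>E. ?d e') = (\<Sum>e'\<in>E. if e' = e then 1 else 0)" by (intro sum.cong) auto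
      also have "\<dots> = 1" using e finE by simp
      finally show ?thesis by (simp add: m m' sum_subtractf)
    qed
    finally show ?thesis .
  qed
  then show thesis by (rule that)
qed

end

section \<open>Charts at a crossing\<close>

text \<open>Seen in the parameter of \<open>\<alpha>\<close>, the arc \<open>\<sigma>\<close> increases strictly from the start, so up to
  reparametrisation it is an initial piece of \<open>\<alpha>\<close>.\<close>

lemma jump_initial_piece:
  assumes \<alpha>: "arc \<alpha>" and \<sigma>: "arc \<sigma>" and sub: "path_image \<sigma> \<subseteq> path_image \<alpha>"
    and start: "pathstart \<sigma> = pathstart \<alpha>" and s: "0 < s" "s < 1" "x = \<sigma> s"
    and AB: "(A \<union> B) \<inter> path_image \<alpha> = {}" and j: "jump (winding_number \<alpha>) A B x c"
  shows "jump (winding_number \<sigma>) A B x c"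
proof -
  obtain \<beta> where \<beta>: "homeomorphism {0..1} (path_image \<alpha>) \<alpha> \<beta>"
    using homeomorphism_arc[OF \<alpha>] by blast
  define f where "f = \<beta> \<circ> \<sigma>"
  have \<sigma>in: "\<sigma> t \<in> path_image \<alpha>" if "t \<in> {0..1}" for t
    using sub that by (auto simp: path_image_def)
  have contf: "continuous_on {0..1} f"
    unfolding f_def using \<sigma> \<beta> sub
    by (intro continuous_on_compose)
       (auto simp: arc_def path_def homeomorphism_def path_image_def elim!: continuous_on_subset)
  have f01: "f t \<in> {0..1}" and \<alpha>f: "\<alpha> (f t) = \<sigma> t" if "t \<in> {0..1}" for t
    using \<sigma>in[OF that] \<beta> by (auto simp: f_def homeomorphism_def)
  have injf: "inj_on f {0..1}"
    using \<alpha>f \<sigma> unfolding inj_on_def arc_def by metis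
  have f0: "f 0 = 0"
    using homeomorphism_apply1[OF \<beta>, of 0] start by (simp add: f_def pathstart_def)
  have mono: "0 < f t \<and> f t < f 1" if "0 < t" "t < 1" for t
    using continuous_inj_imp_mono[OF that contf injf] f0 f01[of 1] by auto
  have f1: "0 < f 1" "f 1 \<le> 1"
    using mono[of "1/2"] f01[of 1] by auto
  have "jump (winding_number (subpath 0 (f 1) \<alpha>)) A B x c"
  proof (subst jump_subpath)
    show "x \<notin> \<alpha> ` ({0..0} \<union> {f 1..1})"
    proof
      assume "x \<in> \<alpha> ` ({0..0} \<union> {f 1..1})"
      then obtain u where "u \<in> {0..0} \<union> {f 1..1}" and x: "x = \<alpha> u" by blast
      then have u: "u = 0 \<or> f 1 \<le> u \<and> u \<le> 1" by auto
      have "\<alpha> (f s) = \<alpha> u" "u \<in> {0..1}" "f s \<in> {0..1}" using \<alpha>f[of s] s f01[of s] f1 u x by auto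
      then have "f s = u" using \<alpha> by (meson arc_def inj_onD)
      then show False using u mono[OF s(1,2)] by auto
    qed
  qed (use \<alpha> AB j f1 in \<open>auto simp: arc_imp_path\<close>)
  moreover have "winding_number (subpath 0 (f 1) \<alpha>) p = winding_number \<sigma> p" if "p \<in> A \<union> B" for p
  proof (rule winding_number_homotopic_paths, rule homotopic_paths_reparametrize[where f = "\<lambda>t. f t / f 1"])
    show "path (subpath 0 (f 1) \<alpha>)" using \<alpha> f1 by (auto simp: arc_imp_path)
    have "path_image (subpath 0 (f 1) \<alpha>) \<subseteq> path_image \<alpha>"
      using f1 by (intro path_image_subpath_subset) auto
    then show "path_image (subpath 0 (f 1) \<alpha>) \<subseteq> - {p}" using that AB by auto
    show "continuous_on {0..1} (\<lambda>t. f t / f 1)"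
      using contf f1 by (intro continuous_intros) auto
    show "(\<lambda>t. f t / f 1) \<in> {0..1} \<rightarrow> {0..1}"
    proof
      fix t :: real assume "t \<in> {0..1}"
      then have "f t \<le> f 1" using mono[of t] f0 f1 by (cases "t = 0"; cases "t = 1") auto
      then show "f t / f 1 \<in> {0..1}" using f01[OF \<open>t \<in> {0..1}\<close>] f1 by auto
    qed
    show "\<sigma> t = subpath 0 (f 1) \<alpha> (f t / f 1)" if "t \<in> {0..1}" for t
      using \<alpha>f[OF that] f1 by (simp add: subpath_def)
  qed (use f0 f1 in auto)
  ultimately show ?thesis
    by (rule jump_cong)
qed

text \<open>The chart has a disc as its range, not the plane, so that it can be shrunk to avoid the point from
  which the sphere is projected to the plane.\<close>

definition crossing_chart :: "complex set \<Rightarrow> complex set \<Rightarrow> complex \<Rightarrow> complex set \<Rightarrow> real \<Rightarrow>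
    (complex \<Rightarrow> real \<times> real) \<Rightarrow> (real \<times> real \<Rightarrow> complex) \<Rightarrow> bool" where
  "crossing_chart G X v V r h \<theta> \<longleftrightarrow> open V \<and> 0 < r \<and> homeomorphism V (ball 0 r) h \<theta> \<and> \<theta> (0, 0) = v \<and>
     (\<forall>z\<in>ball 0 r. \<theta> z \<in> G \<longleftrightarrow> fst z = 0 \<or> snd z = 0) \<and> X \<inter> V = {v}"

text \<open>Symmetries of the pair of coordinate axes carry the first quadrant to any other, so that it suffices
  to study the two half-edges that bound the first quadrant.\<close>

lemma crossing_chart_transform:
  assumes ch: "crossing_chart G X v V r h \<theta>" and contT: "continuous_on UNIV T" and TT: "\<And>z. T (T z) = z"
    and norm: "\<And>z. norm (T z) = norm z"
    and axes: "\<And>z. fst (T z) = 0 \<or> snd (T z) = 0 \<longleftrightarrow> fst z = 0 \<or> snd z = 0"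
  shows "crossing_chart G X v V r (T \<circ> h) (\<theta> \<circ> T)"
proof -
  have Tb: "T z \<in> ball 0 r \<longleftrightarrow> z \<in> ball 0 r" for z
    by (simp only: mem_ball_0 norm)
  have T: "homeomorphism (ball 0 r) (ball 0 r) T T"
  proof (rule homeomorphismI)
    show "continuous_on (ball 0 r) T" using contT continuous_on_subset by blast
    then show "continuous_on (ball 0 r) T" .
  qed (use TT Tb in blast)+
  have T0: "T (0, 0) = (0, 0)"
    using norm[of "(0, 0)"] by (simp add: zero_prod_def[symmetric])
  have "homeomorphism V (ball 0 r) (T \<circ> h) (\<theta> \<circ> T)"
    using ch T unfolding crossing_chart_def by (blast intro: homeomorphism_compose)
  then show ?thesis
    using ch T0 axes norm unfolding crossing_chart_def by auto
qed

lemma axis_in_edge: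
  assumes ch: "crossing_chart G X v V r h \<theta>"
    and P: "connected P" "P \<subseteq> ball 0 r - {(0, 0)}" "\<And>z. z \<in> P \<Longrightarrow> fst z = 0 \<or> snd z = 0"
    and e: "e \<in> components (G - X)" "zc \<in> P" "\<theta> zc \<in> e"
  shows "\<theta> ` P \<subseteq> e"
proof -
  have hom: "homeomorphism V (ball 0 r) h \<theta>" and "0 < r"
    using ch by (auto simp: crossing_chart_def)
  have "connected (\<theta> ` P)"
    using P hom by (intro connected_continuous_image) (auto simp: homeomorphism_def elim!: continuous_on_subset)
  moreover have "\<theta> ` P \<subseteq> G - X"
  proof
    fix p assume "p \<in> \<theta> ` P"
    then obtain z where z: "z \<in> P" "p = \<theta> z" by auto
    then have zb: "z \<in> ball 0 r" "z \<noteq> (0, 0)" using P by auto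
    then have "\<theta> z \<noteq> \<theta> (0, 0)"
      using hom \<open>0 < r\<close> by (metis homeomorphism_apply2 centre_in_ball zero_prod_def)
    moreover have "\<theta> z \<in> V" using hom zb by (auto simp: homeomorphism_def)
    ultimately show "p \<in> G - X"
      using ch z zb P(3) unfolding crossing_chart_def by blast
  qed
  ultimately show ?thesis
    using e components_maximal[of e "G - X" "\<theta> ` P"] by auto
qed

context alternating_graph
begin

text \<open>Near \<open>x\<close> the complement of the graph consists of two sides \<open>P\<close> and \<open>Q\<close>, which must lie in the two
  different faces at \<open>e\<close>; the colour of \<open>f1\<close> tells which of the two is the black one.\<close>

lemma jump_at_two_sided_point:
  assumes e: "e \<in> E" "x \<in> e" and N: "open N" "x \<in> N" "N - G \<subseteq> P \<union> Q"
    and f: "f1 \<in> components (- G)" "f2 \<in> components (- G)" "P \<subseteq> f1" "Q \<subseteq> f2"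
    and w: "\<And>p. p \<in> P \<Longrightarrow> w p = \<alpha>" "\<And>q. q \<in> Q \<Longrightarrow> w q = \<beta>"
    and j: "jump w (Fb e) (Fw e) x s"
  shows "s = (if black f1 then \<alpha> - \<beta> else \<beta> - \<alpha>)"
proof -
  have "x \<in> G" using e edge_interior[OF e(1)] edge_im[OF e(1)] by auto
  have near: "F = f1 \<or> F = f2" if "F = Fb e \<or> F = Fw e" for F
  proof -
    have F: "F \<in> components (- G)" using that faces[OF e(1)] by auto
    have "x \<in> closure F" using that frontiers[OF e(1)] e(2) by (auto simp: frontier_def)
    then obtain p where p: "p \<in> F" "p \<in> N"
      using N(1,2) by (metis disjoint_iff open_Int_closure_eq_empty)
    moreover have "p \<notin> G" using p in_components_subset[OF F] by auto
    ultimately have "p \<in> f1 \<or> p \<in> f2" using N f by auto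
    then show ?thesis
      using components_eq[OF F] f(1,2) p(1) by blast
  qed
  have ne: "Fb e \<noteq> Fw e" using colours[OF e(1)] by auto
  have cl: "x \<in> closure (Fb e) - Fb e" "x \<in> closure (Fw e) - Fw e"
    using frontiers[OF e(1)] e(2) \<open>x \<in> G\<close> in_components_subset[OF faces(1)[OF e(1)]]
      in_components_subset[OF faces(2)[OF e(1)]]
    by (auto simp: frontier_def)
  have dis: "f1 \<inter> f2 = {}" if "f1 \<noteq> f2"
    using components_nonoverlap[OF f(1,2)] that by blast
  have ev1: "\<forall>\<^sub>F p in at x within f1. w p = \<alpha>" if "f1 \<noteq> f2"
    unfolding eventually_at_topological using N w f dis[OF that] in_components_subset[OF f(1)]
    by (intro exI[of _ N]) blast
  have ev2: "\<forall>\<^sub>F p in at x within f2. w p = \<beta>" if "f1 \<noteq> f2"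
    unfolding eventually_at_topological using N w f dis[OF that] in_components_subset[OF f(2)]
    by (intro exI[of _ N]) blast
  consider "Fb e = f1" "Fw e = f2" | "Fb e = f2" "Fw e = f1"
    using near ne by blast
  then show ?thesis
  proof cases
    case 1
    then have "f1 \<noteq> f2" "black f1" using ne colours[OF e(1)] by auto
    then show ?thesis
      using jump_eventually_const[OF j cl] ev1 ev2 1 by simp
  next
    case 2
    then have "f1 \<noteq> f2" "\<not> black f1" using ne colours[OF e(1)] by auto
    then show ?thesis
      using jump_eventually_const[OF j cl] ev1 ev2 2 by simp
  qed
qed

end

section \<open>Adjacent half-edges at a crossing\<close>

context alternating_graph
begin

text \<open>Two half-edges next to each other at a crossing cannot both point outwards (\<open>s = 1\<close>) nor both
  inwards (\<open>s = - 1\<close>, with the reversed paths).  The closed path \<open>T\<close> runs around a small triangle in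
  the first quadrant of the chart: out along the half-edge \<open>\<sigma>\<close> on the horizontal axis, across the
  quadrant along \<open>q\<close>, and back along the half-edge \<open>\<sigma>'\<close> on the vertical axis.  Its winding number
  takes one value inside the triangle and one value outside, also at points across either axis.
  So it jumps by the same amount on both legs when they are crossed into the first quadrant.  This is a
  crossing from white to black either on both legs or on neither, so the jumps from white to
  black agree as well.  But \<open>T\<close> traverses \<open>\<sigma>\<close> forwards and \<open>\<sigma>'\<close> backwards, so the two jumps are
  \<open>s\<close> and \<open>- s\<close>.\<close>

lemma adjacent_half_edges:
  assumes ch: "crossing_chart G X v V r h \<theta>"
    and e: "e \<in> E" "\<theta> (r / 2, 0) \<in> e" and e': "e' \<in> E" "\<theta> (0, r / 2) \<in> e'"
    and \<alpha>: "arc \<alpha>" "path_image \<alpha> = path_image (\<gamma> e)" "pathstart \<alpha> = v"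
      "\<And>x. x \<in> e \<Longrightarrow> jump (winding_number \<alpha>) (Fb e) (Fw e) x s"
    and \<alpha>': "arc \<alpha>'" "path_image \<alpha>' = path_image (\<gamma> e')" "pathstart \<alpha>' = v"
      "\<And>x. x \<in> e' \<Longrightarrow> jump (winding_number \<alpha>') (Fb e') (Fw e') x s"
  shows "s = 0"
proof -
  define \<rho> where "\<rho> = r / 2"
  have r: "0 < r" "0 < \<rho>" "\<rho> < r"
    using ch by (auto simp: crossing_chart_def \<rho>_def)
  have hom: "homeomorphism V (ball 0 r) h \<theta>" and V: "open V" and v: "\<theta> (0, 0) = v"
    and axes: "\<And>z. z \<in> ball 0 r \<Longrightarrow> \<theta> z \<in> G \<longleftrightarrow> fst z = 0 \<or> snd z = 0"
    using ch by (auto simp: crossing_chart_def)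
  have cont: "continuous_on S \<theta>" if "S \<subseteq> ball 0 r" for S
    using homeomorphism_cont2[OF hom] that by (rule continuous_on_subset)
  have inj: "inj_on \<theta> S" if "S \<subseteq> ball 0 r" for S
    using homeomorphism_apply2[OF hom] that by (intro inj_on_inverseI[of _ h]) auto
  have conn: "connected (\<theta> ` S)" if "connected S" "S \<subseteq> ball 0 r" for S
    using cont that by (intro connected_continuous_image)
  have opn: "open (\<theta> ` S)" if "open S" "S \<subseteq> ball 0 r" for S
    using homeomorphism_imp_open_map[OF homeomorphism_symD[OF hom], of S] that V
    by (simp add: openin_open_eq)
  have half: "convex {z :: real \<times> real. 0 < fst z}" "convex {z :: real \<times> real. fst z < 0}"
      "convex {z :: real \<times> real. 0 < snd z}" "convex {z :: real \<times> real. snd z < 0}"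
      "convex {z :: real \<times> real. fst z + snd z < \<rho>}"
    using convex_linear_vimage[of "fst :: real \<times> real \<Rightarrow> real" "{0<..}"]
      convex_linear_vimage[of "fst :: real \<times> real \<Rightarrow> real" "{..<0}"]
      convex_linear_vimage[of "snd :: real \<times> real \<Rightarrow> real" "{0<..}"]
      convex_linear_vimage[of "snd :: real \<times> real \<Rightarrow> real" "{..<0}"]
      convex_linear_vimage[of "\<lambda>z :: real \<times> real. fst z + snd z" "{..<\<rho>}"]
    by (simp_all add: vimage_def bounded_linear.linear[OF bounded_linear_fst]
          bounded_linear.linear[OF bounded_linear_snd] linear_compose_add)
  define Q1 where "Q1 = ball 0 r \<inter> ({z :: real \<times> real. 0 < fst z} \<inter> {z. 0 < snd z})"
  define Q2 where "Q2 = ball 0 r \<inter> ({z :: real \<times> real. fst z < 0} \<inter> {z. 0 < snd z})"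
  define Q4 where "Q4 = ball 0 r \<inter> ({z :: real \<times> real. 0 < fst z} \<inter> {z. snd z < 0})"
  define \<Delta> where "\<Delta> = Q1 \<inter> {z. fst z + snd z < \<rho>}"
  define out where "out = (ball 0 r \<inter> {z :: real \<times> real. fst z < 0}) \<union> (ball 0 r \<inter> {z. snd z < 0})"
  have conQ: "connected Q1" "connected Q2" "connected Q4" "connected \<Delta>"
    unfolding Q1_def Q2_def Q4_def \<Delta>_def
    by (intro convex_connected convex_Int half convex_ball)+
  have "norm (- \<rho> / 2, - \<rho> / 2) < r"
    using norm_Pair_le[of "- \<rho> / 2" "- \<rho> / 2"] r by simp
  then have conout: "connected out"
    unfolding out_def using r
    by (intro connected_Un convex_connected convex_Int half convex_ball) auto
  have quadrant: "\<exists>f\<in>components (- G). \<theta> ` Q \<subseteq> f"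
    if "connected Q" "Q \<subseteq> ball 0 r" "\<And>z. z \<in> Q \<Longrightarrow> fst z \<noteq> 0 \<and> snd z \<noteq> 0" "Q \<noteq> {}" for Q
    using exists_component_superset[of "\<theta> ` Q" "- G"] conn[of Q] that axes by blast
  have small: "norm z < r" if "\<bar>fst z\<bar> + \<bar>snd z\<bar> < r" for z :: "real \<times> real"
    using norm_Pair_le[of "fst z" "snd z"] that by simp
  have "(\<rho> / 4, \<rho> / 4) \<in> Q1" "(- \<rho> / 4, \<rho> / 4) \<in> Q2" "(\<rho> / 4, - \<rho> / 4) \<in> Q4"
    unfolding Q1_def Q2_def Q4_def using r by (auto intro!: small)
  then have Qne: "Q1 \<noteq> {}" "Q2 \<noteq> {}" "Q4 \<noteq> {}" by blast+
  have Qb: "Q1 \<subseteq> ball 0 r" "Q2 \<subseteq> ball 0 r" "Q4 \<subseteq> ball 0 r"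
    unfolding Q1_def Q2_def Q4_def by blast+
  have "\<exists>f\<in>components (- G). \<theta> ` Q1 \<subseteq> f"
    by (rule quadrant[OF conQ(1) Qb(1) _ Qne(1)]) (auto simp: Q1_def)
  then obtain f1 where f1: "f1 \<in> components (- G)" "\<theta> ` Q1 \<subseteq> f1" by blast
  have "\<exists>f\<in>components (- G). \<theta> ` Q2 \<subseteq> f"
    by (rule quadrant[OF conQ(2) Qb(2) _ Qne(2)]) (auto simp: Q2_def)
  then obtain f2 where f2: "f2 \<in> components (- G)" "\<theta> ` Q2 \<subseteq> f2" by blast
  have "\<exists>f\<in>components (- G). \<theta> ` Q4 \<subseteq> f"
    by (rule quadrant[OF conQ(3) Qb(3) _ Qne(3)]) (auto simp: Q4_def)
  then obtain f4 where f4: "f4 \<in> components (- G)" "\<theta> ` Q4 \<subseteq> f4" by blast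
  note f = f1(1) f2(1) f4(1) f1(2) f2(2) f4(2)

  define \<sigma> where "\<sigma> = \<theta> \<circ> linepath (0, 0) (\<rho>, 0)"
  define \<sigma>' where "\<sigma>' = \<theta> \<circ> linepath (0, 0) (0, \<rho>)"
  define q where "q = \<theta> \<circ> linepath (\<rho>, 0) (0, \<rho>)"
  define S where "S = {z :: real \<times> real. 0 \<le> fst z \<and> 0 \<le> snd z \<and> fst z + snd z \<le> \<rho>}"
  have Sb: "S \<subseteq> ball 0 r"
    unfolding S_def using r by (auto intro!: small)
  have seg: "closed_segment (0, 0) (\<rho>, 0) \<subseteq> {z \<in> S. snd z = 0}"
      "closed_segment (0, 0) (0, \<rho>) \<subseteq> {z \<in> S. fst z = 0}"
    using r by (auto simp: in_segment S_def mult_left_le_one_le)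
  have seg3: "closed_segment (\<rho>, 0) (0, \<rho>) \<subseteq> {z \<in> S. fst z + snd z = \<rho>}"
  proof
    fix z assume "z \<in> closed_segment (\<rho>, 0) (0, \<rho>)"
    then obtain u where u: "0 \<le> u" "u \<le> 1" "z = ((1 - u) * \<rho>, u * \<rho>)" by (auto simp: in_segment)
    moreover have "0 \<le> (1 - u) * \<rho>" using u r by simp
    moreover have "(1 - u) * \<rho> + u * \<rho> = \<rho>" by (simp add: algebra_simps)
    ultimately show "z \<in> {z \<in> S. fst z + snd z = \<rho>}" using r by (simp add: S_def)
  qed
  have arc_chart: "arc (\<theta> \<circ> g)" if "arc g" "path_image g \<subseteq> ball 0 r" for g
    using that path_continuous_image[of g \<theta>] cont[OF that(2)] comp_inj_on[of g "{0..1}" \<theta>] inj[OF that(2)]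
    by (simp add: arc_def path_image_def)
  have "closed_segment (0, 0) (\<rho>, 0 :: real) \<subseteq> ball 0 r" "closed_segment (0, 0) (0 :: real, \<rho>) \<subseteq> ball 0 r"
      "closed_segment (\<rho>, 0) (0, \<rho>) \<subseteq> ball 0 r"
    using seg(1) seg(2) seg3 Sb by blast+
  then have arcs: "arc \<sigma>" "arc \<sigma>'" "arc q"
    unfolding \<sigma>_def \<sigma>'_def q_def using r(2)
    by (simp_all add: arc_chart)
  have ims: "path_image \<sigma> = \<theta> ` closed_segment (0, 0) (\<rho>, 0)" "path_image \<sigma>' = \<theta> ` closed_segment (0, 0) (0, \<rho>)"
      "path_image q = \<theta> ` closed_segment (\<rho>, 0) (0, \<rho>)"
    by (simp_all add: \<sigma>_def \<sigma>'_def q_def path_image_compose)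
  have avoid: "\<theta> z \<notin> path_image \<sigma>" if "z \<in> ball 0 r" "snd z \<noteq> 0 \<or> z \<notin> S" for z
    using that seg(1) Sb inj_onD[OF inj[OF order_refl], of z] unfolding ims by blast
  have avoid': "\<theta> z \<notin> path_image \<sigma>'" if "z \<in> ball 0 r" "fst z \<noteq> 0 \<or> z \<notin> S" for z
    using that seg(2) Sb inj_onD[OF inj[OF order_refl], of z] unfolding ims by blast
  have avoidq: "\<theta> z \<notin> path_image q" if "z \<in> ball 0 r" "fst z + snd z \<noteq> \<rho> \<or> z \<notin> S" for z
    using that seg3 Sb inj_onD[OF inj[OF order_refl], of z] unfolding ims by blast

  define T where "T = \<sigma> +++ (q +++ reversepath \<sigma>')"
  have ends: "pathstart \<sigma> = v" "pathfinish \<sigma> = \<theta> (\<rho>, 0)" "pathstart q = \<theta> (\<rho>, 0)" "pathfinish q = \<theta> (0, \<rho>)"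
      "pathstart \<sigma>' = v" "pathfinish \<sigma>' = \<theta> (0, \<rho>)"
    by (simp_all add: \<sigma>_def \<sigma>'_def q_def v[symmetric] pathstart_compose pathfinish_compose)
  have T: "path T" "pathfinish T = pathstart T" "path_image T = path_image \<sigma> \<union> path_image q \<union> path_image \<sigma>'"
    unfolding T_def using arcs ends by (auto simp: arc_imp_path path_image_join)
  have const: "\<exists>c. \<forall>p\<in>\<theta> ` P. winding_number T p = c"
    if "connected P" "P \<subseteq> ball 0 r" "\<And>z. z \<in> P \<Longrightarrow> z \<notin> S \<or> fst z \<noteq> 0 \<and> snd z \<noteq> 0 \<and> fst z + snd z \<noteq> \<rho>" for P
  proof -
    have "\<theta> ` P \<inter> path_image T = {}"
      unfolding T(3) using avoid avoid' avoidq that(2,3) by blast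
    then show ?thesis
      using winding_number_constant[OF T(1,2) conn[OF that(1,2)]] unfolding constant_on_def by blast
  qed
  obtain \<alpha>in where win: "\<And>p. p \<in> \<theta> ` \<Delta> \<Longrightarrow> winding_number T p = \<alpha>in"
    using const[of \<Delta>] conQ(4) unfolding \<Delta>_def Q1_def by auto
  have outb: "out \<subseteq> ball 0 r" "\<And>z. z \<in> out \<Longrightarrow> z \<notin> S"
    unfolding out_def S_def by auto
  have "\<exists>c. \<forall>p\<in>\<theta> ` out. winding_number T p = c"
    by (rule const[OF conout outb(1)]) (use outb(2) in simp)
  then obtain \<beta> where wout: "\<And>p. p \<in> \<theta> ` out \<Longrightarrow> winding_number T p = \<beta>" by blast

  have wnT: "winding_number T p = winding_number \<sigma> p + (winding_number q p + - winding_number \<sigma>' p)"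
    if "p \<notin> path_image T" for p
    using that arcs ends unfolding T(3) T_def
    by (simp add: arc_imp_path winding_number_join winding_number_reversepath path_image_join)

  define H where "H = (\<lambda>t. (t, 0 :: real)) ` {0<..<r}"
  define H' where "H' = (\<lambda>t. (0 :: real, t)) ` {0<..<r}"
  have conH: "connected H" "connected H'" unfolding H_def H'_def
    by (intro connected_continuous_image continuous_intros connected_Ioo)+
  have Hb: "H \<subseteq> ball 0 r - {(0, 0)}" "H' \<subseteq> ball 0 r - {(0, 0)}"
    by (auto simp: H_def H'_def norm_Pair)
  have rH: "(r / 2, 0) \<in> H" "(0, r / 2) \<in> H'" using r by (auto simp: H_def H'_def)
  have He: "\<theta> ` H \<subseteq> e"
    using e by (intro axis_in_edge[OF ch conH(1) Hb(1) _ _ rH(1)]) (auto simp: H_def E_eq)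
  have He': "\<theta> ` H' \<subseteq> e'"
    using e' by (intro axis_in_edge[OF ch conH(2) Hb(2) _ _ rH(2)]) (auto simp: H'_def E_eq)
  have sub: "path_image \<sigma> \<subseteq> path_image \<alpha>" "path_image \<sigma>' \<subseteq> path_image \<alpha>'"
  proof -
    have "closed_segment (0, 0) (\<rho>, 0) \<subseteq> insert (0, 0) H"
    proof
      fix z :: "real \<times> real" assume "z \<in> closed_segment (0, 0) (\<rho>, 0)"
      then obtain u where "0 \<le> u" "u \<le> 1" "z = (u * \<rho>, 0)" by (auto simp: in_segment)
      moreover from this have "u * \<rho> < r" using r mult_left_le_one_le[of \<rho> u] by linarith
      ultimately show "z \<in> insert (0, 0) H"
        using r by (cases "u = 0") (auto simp: H_def image_iff)
    qed
    then have "path_image \<sigma> \<subseteq> insert v e"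
      unfolding ims using He v by auto
    then show "path_image \<sigma> \<subseteq> path_image \<alpha>"
      using edge_interior[OF e(1)] \<alpha>(2,3) pathstart_in_path_image[of \<alpha>] by auto
    have "closed_segment (0, 0) (0, \<rho>) \<subseteq> insert (0, 0) H'"
    proof
      fix z :: "real \<times> real" assume "z \<in> closed_segment (0, 0) (0, \<rho>)"
      then obtain u where "0 \<le> u" "u \<le> 1" "z = (0, u * \<rho>)" by (auto simp: in_segment)
      moreover from this have "u * \<rho> < r" using r mult_left_le_one_le[of \<rho> u] by linarith
      ultimately show "z \<in> insert (0, 0) H'"
        using r by (cases "u = 0") (auto simp: H'_def image_iff)
    qed
    then have "path_image \<sigma>' \<subseteq> insert v e'"
      unfolding ims using He' v by auto
    then show "path_image \<sigma>' \<subseteq> path_image \<alpha>'"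
      using edge_interior[OF e'(1)] \<alpha>'(2,3) pathstart_in_path_image[of \<alpha>'] by auto
  qed

  \<comment> \<open>the argument for one leg: \<open>zc\<close> is its midpoint and \<open>Q\<close> the quadrant on its other side\<close>
  have main: "s' = (if black f1 then \<alpha>in - \<beta> else \<beta> - \<alpha>in)"
    if a: "a \<in> E" "\<theta> zc \<in> a" and zc: "zc \<in> ball 0 r"
      and N: "\<And>z. dist z zc < \<rho> / 8 \<Longrightarrow> norm z < r"
      and NQ: "\<And>z. dist z zc < \<rho> / 8 \<Longrightarrow> fst z \<noteq> 0 \<Longrightarrow> snd z \<noteq> 0 \<Longrightarrow> z \<in> \<Delta> \<union> Q"
      and Q: "\<theta> ` Q \<subseteq> f" "f \<in> components (- G)" "Q \<subseteq> out"
      and j: "jump (\<lambda>p. winding_number \<sigma> p + (winding_number q p + - winding_number \<sigma>' p)) (Fb a) (Fw a) (\<theta> zc) s'"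
      and zq: "\<theta> zc \<notin> path_image q"
    for a zc Q f s'
  proof -
    have jT: "jump (winding_number T) (Fb a) (Fw a) (\<theta> zc) s'"
    proof (rule jump_cong_near[OF j])
      show "open (- path_image q)" using arcs(3) by (simp add: closed_arc_image open_Compl)
      show "\<theta> zc \<in> - path_image q" using zq by simp
      fix p assume p: "p \<in> (Fb a \<union> Fw a) \<inter> - path_image q"
      have "path_image \<sigma> \<subseteq> G" "path_image \<sigma>' \<subseteq> G"
        using sub \<alpha>(2) \<alpha>'(2) edge_im[OF e(1)] edge_im[OF e'(1)] by auto
      then have "p \<notin> path_image T"
        unfolding T(3) using p in_components_subset[OF faces(1)[OF a(1)]] in_components_subset[OF faces(2)[OF a(1)]]
        by auto
      then show "winding_number \<sigma> p + (winding_number q p + - winding_number \<sigma>' p) = winding_number T p"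
        using wnT by simp
    qed
    show ?thesis
    proof (rule jump_at_two_sided_point[OF a, where N = "\<theta> ` ball zc (\<rho> / 8)" and P = "\<theta> ` \<Delta>" and Q = "\<theta> ` Q" and ?f2.0 = f])
      show "open (\<theta> ` ball zc (\<rho> / 8))"
        using N by (intro opn) (auto simp: dist_commute)
      show "\<theta> zc \<in> \<theta> ` ball zc (\<rho> / 8)" using r by auto
      show "\<theta> ` ball zc (\<rho> / 8) - G \<subseteq> \<theta> ` \<Delta> \<union> \<theta> ` Q"
      proof
        fix p assume p: "p \<in> \<theta> ` ball zc (\<rho> / 8) - G"
        then obtain z where z: "dist z zc < \<rho> / 8" "p = \<theta> z" by (auto simp: dist_commute)
        then show "p \<in> \<theta> ` \<Delta> \<union> \<theta> ` Q"
          using axes[of z] N[OF z(1)] NQ[OF z(1)] p by auto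
      qed
      show "\<theta> ` \<Delta> \<subseteq> f1" using f(4) by (auto simp: \<Delta>_def)
      show "winding_number T p = \<beta>" if "p \<in> \<theta> ` Q" for p
        using that Q(3) wout by auto
    qed (use Q f win jT in auto)
  qed
  have half_in: "(\<rho> / 2, 0) \<in> H" "(0, \<rho> / 2) \<in> H'"
    using r by (auto simp: H_def H'_def)
  have seg_mid: "linepath (0, 0) (\<rho>, 0) (1 / 2) = (\<rho> / 2, 0 :: real)" "linepath (0, 0) (0, \<rho>) (1 / 2) = (0 :: real, \<rho> / 2)"
    by (simp_all add: linepath_def)
  have dz: "\<bar>fst z - a\<bar> < d" "\<bar>snd z - b\<bar> < d" if "dist z (a, b) < d" for z :: "real \<times> real" and a b d
    using that dist_fst_le[of z "(a, b)"] dist_snd_le[of z "(a, b)"] by (auto simp: dist_real_def)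
  have "s = (if black f1 then \<alpha>in - \<beta> else \<beta> - \<alpha>in)"
  proof (rule main[where zc = "(\<rho> / 2, 0)" and Q = Q4 and f = f4])
    show x: "\<theta> (\<rho> / 2, 0) \<in> e" using He half_in by blast
    show "norm z < r" if "dist z (\<rho> / 2, 0) < \<rho> / 8" for z :: "real \<times> real"
      using dz[OF that] r by (intro small) linarith
    show "z \<in> \<Delta> \<union> Q4" if "dist z (\<rho> / 2, 0) < \<rho> / 8" "fst z \<noteq> 0" "snd z \<noteq> 0" for z
    proof -
      have "norm z < r" using dz[OF that(1)] r by (intro small) linarith
      moreover have "0 < fst z" "fst z + snd z < \<rho>" using dz[OF that(1)] r by linarith+
      ultimately show ?thesis using that(3) unfolding \<Delta>_def Q1_def Q4_def by auto
    qed
    show "Q4 \<subseteq> out" by (auto simp: Q4_def out_def)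
    have zb: "(\<rho> / 2, 0 :: real) \<in> ball 0 r" using r by (simp add: norm_Pair)
    then show "(\<rho> / 2, 0 :: real) \<in> ball 0 r" .
    show zq: "\<theta> (\<rho> / 2, 0) \<notin> path_image q"
      using r by (intro avoidq zb) auto
    have "jump (winding_number \<sigma>) (Fb e) (Fw e) (\<theta> (\<rho> / 2, 0)) s"
    proof (rule jump_initial_piece[OF \<alpha>(1) arcs(1) sub(1), where s = "1 / 2"])
      show "(Fb e \<union> Fw e) \<inter> path_image \<alpha> = {}"
        using \<alpha>(2) edge_im[OF e(1)] in_components_subset[OF faces(1)[OF e(1)]] in_components_subset[OF faces(2)[OF e(1)]]
        by auto
    qed (use ends \<alpha> x seg_mid in \<open>auto simp: \<sigma>_def\<close>)
    moreover have "\<theta> (\<rho> / 2, 0) \<notin> path_image \<sigma>'"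
      using r by (intro avoid' zb) auto
    ultimately have "jump (\<lambda>p. winding_number \<sigma> p + (winding_number q p + - winding_number \<sigma>' p)) (Fb e) (Fw e) (\<theta> (\<rho> / 2, 0)) (s + (0 + - 0))"
      using zq arcs by (intro jump_add jump_minus jump_winding_number_off_path arc_imp_path)
    then show "jump (\<lambda>p. winding_number \<sigma> p + (winding_number q p + - winding_number \<sigma>' p)) (Fb e) (Fw e) (\<theta> (\<rho> / 2, 0)) s"
      by simp
  qed (use e f in auto)
  moreover have "- s = (if black f1 then \<alpha>in - \<beta> else \<beta> - \<alpha>in)"
  proof (rule main[where zc = "(0, \<rho> / 2)" and Q = Q2 and f = f2])
    show x: "\<theta> (0, \<rho> / 2) \<in> e'" using He' half_in by blast
    show "norm z < r" if "dist z (0, \<rho> / 2) < \<rho> / 8" for z :: "real \<times> real"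
      using dz[OF that] r by (intro small) linarith
    show "z \<in> \<Delta> \<union> Q2" if "dist z (0, \<rho> / 2) < \<rho> / 8" "fst z \<noteq> 0" "snd z \<noteq> 0" for z
    proof -
      have "norm z < r" using dz[OF that(1)] r by (intro small) linarith
      moreover have "0 < snd z" "fst z + snd z < \<rho>" using dz[OF that(1)] r by linarith+
      ultimately show ?thesis using that(2) unfolding \<Delta>_def Q1_def Q2_def by auto
    qed
    show "Q2 \<subseteq> out" by (auto simp: Q2_def out_def)
    have zb: "(0 :: real, \<rho> / 2) \<in> ball 0 r" using r by (simp add: norm_Pair)
    then show "(0 :: real, \<rho> / 2) \<in> ball 0 r" .
    show zq: "\<theta> (0, \<rho> / 2) \<notin> path_image q"
      using r by (intro avoidq zb) auto
    have "jump (winding_number \<sigma>') (Fb e') (Fw e') (\<theta> (0, \<rho> / 2)) s"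
    proof (rule jump_initial_piece[OF \<alpha>'(1) arcs(2) sub(2), where s = "1 / 2"])
      show "(Fb e' \<union> Fw e') \<inter> path_image \<alpha>' = {}"
        using \<alpha>'(2) edge_im[OF e'(1)] in_components_subset[OF faces(1)[OF e'(1)]] in_components_subset[OF faces(2)[OF e'(1)]]
        by auto
    qed (use ends \<alpha>' x seg_mid in \<open>auto simp: \<sigma>'_def\<close>)
    moreover have "\<theta> (0, \<rho> / 2) \<notin> path_image \<sigma>"
      using r by (intro avoid zb) auto
    ultimately have "jump (\<lambda>p. winding_number \<sigma> p + (winding_number q p + - winding_number \<sigma>' p)) (Fb e') (Fw e') (\<theta> (0, \<rho> / 2)) (0 + (0 + - s))"
      using zq arcs by (intro jump_add jump_minus jump_winding_number_off_path arc_imp_path)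
    then show "jump (\<lambda>p. winding_number \<sigma> p + (winding_number q p + - winding_number \<sigma>' p)) (Fb e') (Fw e') (\<theta> (0, \<rho> / 2)) (- s)"
      by simp
  qed (use e' f in auto)
  ultimately have "s = - s" by simp
  then show "s = 0" by simp
qed

end

section \<open>Link projections to the plane\<close>

definition double_points :: "('a \<Rightarrow> 'b) \<Rightarrow> 'a set \<Rightarrow> 'b set" where
  "double_points \<pi> L = {p. \<exists>z\<in>L. \<exists>w\<in>L. z \<noteq> w \<and> \<pi> z = p \<and> \<pi> w = p}"

text \<open>A link \<open>L\<close> with a projection \<open>\<pi>\<close> to the plane that has the properties of a connected reduced
  diagram.  At a double point \<open>v\<close> the two strands \<open>A\<close> and \<open>B\<close> of the link project to the two axes of
  a chart.\<close>

locale planar_link =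
  fixes L :: "'a::euclidean_space set" and \<pi> :: "'a \<Rightarrow> complex"
  assumes compL: "compact L" and finC: "finite (components L)"
    and circle: "C \<in> components L \<Longrightarrow> C homeomorphic sphere (0::complex) 1"
    and cont: "continuous_on L \<pi>"
    and finX: "finite (double_points \<pi> L)" and X_ne: "double_points \<pi> L \<noteq> {}"
    and conn: "connected (\<pi> ` L)"
    and reduced: "v \<in> double_points \<pi> L \<Longrightarrow> connected (\<pi> ` L - {v})"
    and transverse: "v \<in> double_points \<pi> L \<Longrightarrow>
      \<exists>V r h \<theta> A B. open V \<and> v \<in> V \<and> 0 < r \<and> homeomorphism V (ball 0 r) h \<theta> \<and> h v = (0::real, 0::real) \<and>
        openin (top_of_set L) A \<and> openin (top_of_set L) B \<and> A \<inter> B = {} \<and> A \<union> B = {z \<in> L. \<pi> z \<in> V} \<and>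
        bij_betw (h \<circ> \<pi>) A ((UNIV \<times> {0}) \<inter> ball 0 r) \<and> bij_betw (h \<circ> \<pi>) B (({0} \<times> UNIV) \<inter> ball 0 r)"
begin

definition X where "X = double_points \<pi> L"
definition G where "G = \<pi> ` L"
abbreviation "E \<equiv> components (G - X)"

lemma X_sub: "X \<subseteq> G"
  by (auto simp: X_def G_def double_points_def)

lemma inj_off_X: "z \<in> L \<Longrightarrow> w \<in> L \<Longrightarrow> \<pi> z = \<pi> w \<Longrightarrow> \<pi> z \<notin> X \<Longrightarrow> z = w"
  by (auto simp: X_def double_points_def)

lemma compG: "compact G"
  unfolding G_def by (rule compact_continuous_image[OF cont compL])

lemma chart:
  assumes v: "v \<in> X"
  obtains V r h \<theta> A B where "crossing_chart G X v V r h \<theta>"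
    "openin (top_of_set L) A" "openin (top_of_set L) B" "A \<union> B = {z \<in> L. \<pi> z \<in> V}"
    "inj_on (h \<circ> \<pi>) A" "inj_on (h \<circ> \<pi>) B" "\<And>z. z \<in> A \<Longrightarrow> snd (h (\<pi> z)) = 0" "\<And>z. z \<in> B \<Longrightarrow> fst (h (\<pi> z)) = 0"
    "h v = (0, 0)"
proof -
  obtain V r A B and h :: "complex \<Rightarrow> real \<times> real" and \<theta> where V: "open V" "v \<in> V" "0 < r" "homeomorphism V (ball 0 r) h \<theta>" "h v = (0, 0)"
    and AB: "openin (top_of_set L) A" "openin (top_of_set L) B" "A \<inter> B = {}" "A \<union> B = {z \<in> L. \<pi> z \<in> V}"
    and bij: "bij_betw (h \<circ> \<pi>) A ((UNIV \<times> {0}) \<inter> ball 0 r)" "bij_betw (h \<circ> \<pi>) B (({0} \<times> UNIV) \<inter> ball 0 r)"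
    using transverse[OF v[unfolded X_def]] by (elim exE conjE) (rule that; assumption)
  have inj: "inj_on (h \<circ> \<pi>) A" "inj_on (h \<circ> \<pi>) B"
    using bij by (auto simp: bij_betw_def)
  have imA: "h (\<pi> z) \<in> (UNIV \<times> {0}) \<inter> ball 0 r" if "z \<in> A" for z
    using bij_betwE[OF bij(1)] that by fastforce
  have imB: "h (\<pi> z) \<in> ({0} \<times> UNIV) \<inter> ball 0 r" if "z \<in> B" for z
    using bij_betwE[OF bij(2)] that by fastforce
  have A: "snd (h (\<pi> z)) = 0" if "z \<in> A" for z
    using imA[OF that] by (cases "h (\<pi> z)") auto
  have B: "fst (h (\<pi> z)) = 0" if "z \<in> B" for z
    using imB[OF that] by (cases "h (\<pi> z)") auto
  have "\<theta> (0, 0) = v" using homeomorphism_apply1[OF V(4,2)] V(5) by simp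
  moreover have "\<theta> z \<in> G \<longleftrightarrow> fst z = 0 \<or> snd z = 0" if z: "z \<in> ball 0 r" for z
  proof
    assume "\<theta> z \<in> G"
    then obtain w where w: "w \<in> L" "\<theta> z = \<pi> w" by (auto simp: G_def)
    moreover have "\<theta> z \<in> V" "h (\<theta> z) = z"
      using homeomorphism_image2[OF V(4)] homeomorphism_apply2[OF V(4)] z by auto
    ultimately have "w \<in> A \<union> B" "h (\<pi> w) = z" unfolding AB(4) by auto
    then show "fst z = 0 \<or> snd z = 0" using A B by blast
  next
    assume "fst z = 0 \<or> snd z = 0"
    then have "z \<in> (UNIV \<times> {0}) \<inter> ball 0 r \<or> z \<in> ({0} \<times> UNIV) \<inter> ball 0 r"
      using z by (cases z) auto
    then have "z \<in> (h \<circ> \<pi>) ` A \<or> z \<in> (h \<circ> \<pi>) ` B"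
      using bij_betw_imp_surj_on[OF bij(1)] bij_betw_imp_surj_on[OF bij(2)] by simp
    then obtain w where w: "w \<in> A \<union> B" "z = h (\<pi> w)" by auto
    then have "w \<in> L" "\<pi> w \<in> V" unfolding AB(4) by auto
    then show "\<theta> z \<in> G" using w homeomorphism_apply1[OF V(4)] by (simp add: G_def)
  qed
  moreover have "X \<inter> V = {v}"
  proof -
    have "p = v" if p: "p \<in> X" "p \<in> V" for p
    proof -
      obtain z w where zw: "z \<in> L" "w \<in> L" "z \<noteq> w" "\<pi> z = p" "\<pi> w = p"
        using p(1) by (auto simp: X_def double_points_def)
      then have in_AB: "z \<in> A \<union> B" "w \<in> A \<union> B" unfolding AB(4) using p by auto
      moreover have "\<not> (z \<in> A \<and> w \<in> A)" "\<not> (z \<in> B \<and> w \<in> B)"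
        using zw inj by (auto simp: inj_on_def)
      ultimately have "z \<in> A \<and> w \<in> B \<or> z \<in> B \<and> w \<in> A" by blast
      then have "fst (h p) = 0 \<and> snd (h p) = 0"
        using A[of z] A[of w] B[of z] B[of w] zw(4,5) by auto
      then have "h p = h v" using V(5) by (simp add: prod_eq_iff)
      then show "p = v" using homeomorphism_apply1[OF V(4)] p(2) V(2) by metis
    qed
    then show ?thesis using v V(2) by blast
  qed
  ultimately have "crossing_chart G X v V r h \<theta>"
    using V by (simp add: crossing_chart_def)
  then show thesis using that AB(1,2,4) inj A B V(5) by blast
qed

lemma finite_fibre:
  assumes "v \<in> X"
  shows "finite {z \<in> L. \<pi> z = v}"
proof -
  obtain V r h \<theta> A B where c: "crossing_chart G X v V r h \<theta>" "A \<union> B = {z \<in> L. \<pi> z \<in> V}"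
    "inj_on (h \<circ> \<pi>) A" "inj_on (h \<circ> \<pi>) B"
    by (rule chart[OF assms]) (rule that; assumption)
  have "v \<in> V" using c(1) unfolding crossing_chart_def by blast
  then have "{z \<in> L. \<pi> z = v} \<subseteq> {z \<in> A. \<pi> z = v} \<union> {z \<in> B. \<pi> z = v}" using c(2) by blast
  moreover have "finite {z \<in> S. \<pi> z = v}" if "inj_on (h \<circ> \<pi>) S" for S
  proof (rule finite_vimage_IntI[of "{v}" \<pi> S, THEN finite_subset[rotated]])
    show "inj_on \<pi> S" using that by (rule inj_on_imageI2)
  qed auto
  ultimately show ?thesis using c(3,4) by (meson finite_UnI finite_subset)
qed

lemma component_facts:
  assumes "C \<in> components L"
  shows "compact C" "C \<subseteq> L" "connected C" "infinite C"
proof -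
  show "compact C" using compact_components[OF compL assms] .
  show "C \<subseteq> L" "connected C" using assms in_components_subset in_components_connected by auto
  show "infinite C"
  proof
    assume "finite C"
    then have "finite (sphere (0::complex) 1)"
      using circle[OF assms] homeomorphic_sym homeomorphic_finite by blast
    moreover have "connected (sphere (0::complex) 1)"
      by (rule connected_sphere) simp
    ultimately have "sphere (0::complex) 1 = {} \<or> (\<exists>a. sphere (0::complex) 1 = {a})"
      using connected_finite_iff_sing[of "sphere (0::complex) 1"] by simp
    moreover have "1 \<in> sphere (0::complex) 1" "- 1 \<in> sphere (0::complex) 1" by simp_all
    ultimately have "1 = (- 1 :: complex)" by (metis empty_iff singletonD)
    then show False by simp
  qed
qed

lemma cont_component: "C \<in> components L \<Longrightarrow> continuous_on C \<pi>"
  using cont component_facts(2) continuous_on_subset by blast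

lemma others_closed: "closed (\<Union>C'\<in>components L - {C}. \<pi> ` C')"
  using finC component_facts(1) cont_component
  by (intro closed_UN ballI compact_imp_closed compact_continuous_image) auto

lemma G_split:
  assumes "C \<in> components L"
  shows "G = \<pi> ` C \<union> (\<Union>C'\<in>components L - {C}. \<pi> ` C')"
proof -
  have "\<pi> ` \<Union>(insert C (components L - {C})) = \<pi> ` C \<union> (\<Union>C'\<in>components L - {C}. \<pi> ` C')"
    by (simp only: Union_insert image_Un image_Union)
  moreover have "insert C (components L - {C}) = components L"
    using assms by auto
  ultimately show ?thesis unfolding G_def by (simp only: Union_components)
qed

text \<open>The projection of a component without crossings would be open and closed in the connected set \<open>G\<close>,
  hence all of it, and then there would be no crossing at all.\<close>

lemma component_meets_crossing:
  assumes C: "C \<in> components L"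
  shows "\<exists>z\<in>C. \<pi> z \<in> X"
proof (rule ccontr)
  assume none: "\<not> (\<exists>z\<in>C. \<pi> z \<in> X)"
  let ?R = "\<Union>C'\<in>components L - {C}. \<pi> ` C'"
  note G = G_split[OF C]
  have disj: "\<pi> ` C \<inter> ?R = {}"
  proof (rule ccontr)
    assume "\<pi> ` C \<inter> ?R \<noteq> {}"
    then obtain z C' w where zw: "z \<in> C" "C' \<in> components L" "C' \<noteq> C" "w \<in> C'" "\<pi> z = \<pi> w" by auto
    then have "z \<noteq> w" using components_nonoverlap[OF C zw(2)] by auto
    then show False using none inj_off_X[of z w] zw component_facts(2) C by blast
  qed
  have "closed (\<pi> ` C)"
    using component_facts(1)[OF C] cont_component[OF C]
    by (intro compact_imp_closed compact_continuous_image)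
  then have "\<pi> ` C \<inter> G = {} \<or> ?R \<inter> G = {}"
    using connected_closedD[OF conn[folded G_def] _ _ _ others_closed[of C], of "\<pi> ` C"] disj G by auto
  then have "?R = {}" using G in_components_nonempty[OF C] by blast
  obtain v where "v \<in> X" using X_ne by (auto simp: X_def)
  then have "v \<in> G" using X_sub by auto
  then have "v \<in> \<pi> ` C" using G \<open>?R = {}\<close> by auto
  then show False using none \<open>v \<in> X\<close> by auto
qed

lemma loop_exists:
  assumes C: "C \<in> components L"
  shows "\<exists>g. simple_path g \<and> pathfinish g = pathstart g \<and> path_image g = C \<and> \<pi> (g 0) \<in> X"
proof -
  obtain f f' where f: "homeomorphism (sphere (0::complex) 1) C f f'"
    using circle[OF C] homeomorphic_sym unfolding homeomorphic_def by blast
  define g where "g = f \<circ> circlepath 0 1"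
  have im: "path_image (circlepath 0 1) = sphere (0::complex) 1" by simp
  have inj: "inj_on f (path_image (circlepath 0 1))"
    unfolding im using homeomorphism_apply1[OF f] by (intro inj_on_inverseI[of _ f']) auto
  have cf: "continuous_on (path_image (circlepath 0 1)) f"
    unfolding im by (rule homeomorphism_cont1[OF f])
  have g: "simple_path g"
    unfolding g_def by (rule simple_path_continuous_image[OF _ cf inj]) (simp add: simple_path_circlepath)
  have g': "pathfinish g = pathstart g" "path_image g = C"
    unfolding g_def using im homeomorphism_image1[OF f]
    by (simp_all add: path_image_compose pathfinish_compose pathstart_compose)
  obtain z where z: "z \<in> C" "\<pi> z \<in> X" using component_meets_crossing[OF C] by blast
  then obtain a where a: "a \<in> {0..1}" "g a = z" using g' by (auto simp: path_image_def)
  have "shiftpath a g 0 = z"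
    using pathstart_shiftpath[of a g] a by (simp add: pathstart_def)
  then have "simple_path (shiftpath a g)" "pathfinish (shiftpath a g) = pathstart (shiftpath a g)"
      "path_image (shiftpath a g) = C" "\<pi> (shiftpath a g 0) \<in> X"
    using a g g' z by (simp_all add: simple_path_shiftpath path_image_shiftpath pathfinish_shiftpath pathstart_shiftpath)
  then show ?thesis by blast
qed

text \<open>Every component is traversed from a crossing to itself, so that no edge runs through the base point
  and each edge is the image of an interval.\<close>

definition loop where
  "loop C = (SOME g. simple_path g \<and> pathfinish g = pathstart g \<and> path_image g = C \<and> \<pi> (g 0) \<in> X)"

definition \<kappa> where "\<kappa> C = \<pi> \<circ> loop C"

lemma loop:
  assumes "C \<in> components L"
  shows "simple_path (loop C)" "pathfinish (loop C) = pathstart (loop C)" "path_image (loop C) = C" "\<pi> (loop C 0) \<in> X"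
  using someI_ex[OF loop_exists[OF assms]] unfolding loop_def by blast+

lemma \<kappa>:
  assumes "C \<in> components L"
  shows "path (\<kappa> C)" "pathfinish (\<kappa> C) = pathstart (\<kappa> C)" "path_image (\<kappa> C) = \<pi> ` C" "\<kappa> C 0 \<in> X" "\<kappa> C 1 \<in> X"
proof -
  show "path (\<kappa> C)"
    unfolding \<kappa>_def using loop[OF assms] cont_component[OF assms]
    by (intro path_continuous_image simple_path_imp_path) auto
  show "pathfinish (\<kappa> C) = pathstart (\<kappa> C)" "path_image (\<kappa> C) = \<pi> ` C"
    using loop[OF assms] unfolding \<kappa>_def
    by (auto simp: pathfinish_compose pathstart_compose path_image_compose)
  then show "\<kappa> C 0 \<in> X" "\<kappa> C 1 \<in> X"
    using loop(4)[OF assms] by (auto simp: \<kappa>_def pathstart_def pathfinish_def)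
qed

lemma \<kappa>_inj:
  assumes C: "C \<in> components L" and st: "s \<in> {0..1}" "t \<in> {0..1}" "\<kappa> C s = \<kappa> C t" "\<kappa> C s \<notin> X"
  shows "s = t"
proof -
  have "loop C s \<in> C" "loop C t \<in> C" using st loop(3)[OF C] by (auto simp: path_image_def)
  then have "loop C s = loop C t"
    using inj_off_X[of "loop C s" "loop C t"] st component_facts(2)[OF C] by (auto simp: \<kappa>_def)
  moreover have "s \<noteq> 0" "s \<noteq> 1" using st \<kappa>[OF C] by auto
  ultimately show "s = t"
    using loop(1)[OF C] st unfolding simple_path_def loop_free_def by blast
qed

lemma \<kappa>_other:
  assumes "C \<in> components L" "C' \<in> components L" "C \<noteq> C'" "p \<in> \<pi> ` C" "p \<in> \<pi> ` C'"
  shows "p \<in> X"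
proof (rule ccontr)
  assume p: "p \<notin> X"
  obtain z w where zw: "z \<in> C" "w \<in> C'" "p = \<pi> z" "p = \<pi> w" using assms by blast
  moreover have "z \<in> L" "w \<in> L" using zw component_facts(2) assms(1,2) by blast+
  ultimately have "z = w" using inj_off_X p by metis
  then show False using zw components_nonoverlap[OF assms(1,2)] assms(3) by blast
qed

text \<open>From a point of the edge, follow its component in both directions up to the first crossings, at
  parameters \<open>a\<close> and \<open>b\<close>.  The part \<open>I\<close> in between is disjoint from the closed rest \<open>R\<close> of the
  projection, because off the crossings \<open>\<pi>\<close> is injective.  So \<open>I\<close> is open and closed in the graph without
  its crossings, which makes it an entire edge.\<close>

lemma edge_parameter:
  assumes e: "e \<in> E"
  obtains C a b where "C \<in> components L" "0 \<le> a" "a < b" "b \<le> 1" "e = \<kappa> C ` {a<..<b}"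
    "\<kappa> C a \<in> X" "\<kappa> C b \<in> X"
    "closed (G - e)" "G - e = \<kappa> C ` ({0..a} \<union> {b..1}) \<union> (\<Union>C'\<in>components L - {C}. \<pi> ` C')"
proof -
  obtain y where y: "y \<in> e" using in_components_nonempty[OF e] by blast
  then have yG: "y \<in> G" "y \<notin> X" using in_components_subset[OF e] by auto
  then obtain z where z: "z \<in> L" "y = \<pi> z" by (auto simp: G_def)
  then obtain C where C: "C \<in> components L" "z \<in> C" using Union_components[of L] by blast
  have "y \<in> path_image (\<kappa> C)" using C z \<kappa>(3)[OF C(1)] by auto
  then obtain t where t: "t \<in> {0..1}" "y = \<kappa> C t" by (auto simp: path_image_def)
  have con\<kappa>: "continuous_on {0..1} (\<kappa> C)" using \<kappa>(1)[OF C(1)] by (simp add: path_def)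
  define T where "T = {0..1} \<inter> \<kappa> C -` X"
  have "closed X" using finX by (simp add: X_def finite_imp_closed)
  then have "closed T"
    unfolding T_def using con\<kappa> by (intro continuous_closed_preimage) auto
  then have "compact (T \<inter> {0..t})" "compact (T \<inter> {t..1})"
    by (auto intro: closed_Int_compact)
  moreover have "0 \<in> T \<inter> {0..t}" "1 \<in> T \<inter> {t..1}"
    using \<kappa>(4,5)[OF C(1)] t by (auto simp: T_def)
  ultimately obtain a b where a: "a \<in> T \<inter> {0..t}" "\<And>s. s \<in> T \<inter> {0..t} \<Longrightarrow> s \<le> a"
      and b: "b \<in> T \<inter> {t..1}" "\<And>s. s \<in> T \<inter> {t..1} \<Longrightarrow> b \<le> s"
    using compact_attains_sup[of "T \<inter> {0..t}"] compact_attains_inf[of "T \<inter> {t..1}"] by blast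
  have "t \<notin> T" using t yG by (simp add: T_def)
  then have ab: "0 \<le> a" "a < t" "t < b" "b \<le> 1" "\<kappa> C a \<in> X" "\<kappa> C b \<in> X"
    using a(1) b(1) by (auto simp: T_def less_le)
  have gap: "\<kappa> C s \<notin> X" if "a < s" "s < b" for s
  proof
    assume "\<kappa> C s \<in> X"
    then have "s \<in> T" using that ab by (auto simp: T_def)
    then show False using a(2)[of s] b(2)[of s] that ab by (cases "s \<le> t") auto
  qed
  define I where "I = \<kappa> C ` {a<..<b}"
  define R where "R = \<kappa> C ` ({0..a} \<union> {b..1}) \<union> (\<Union>C'\<in>components L - {C}. \<pi> ` C')"
  have pC: "\<pi> ` C = \<kappa> C ` {0..1}" using \<kappa>(3)[OF C(1)] by (simp add: path_image_def)
  have IC: "I \<subseteq> \<pi> ` C" unfolding I_def pC using ab by (intro image_mono) auto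
  have I01: "{0..1} = {a<..<b} \<union> ({0..a} \<union> {b..1})" using ab by auto
  have GIR: "G = I \<union> R"
  proof -
    have "G = \<pi> ` C \<union> (\<Union>C'\<in>components L - {C}. \<pi> ` C')"
      by (rule G_split[OF C(1)])
    also have "\<pi> ` C = I \<union> \<kappa> C ` ({0..a} \<union> {b..1})"
      unfolding pC I_def I01 by (rule image_Un)
    finally show ?thesis by (simp add: R_def Un_assoc)
  qed
  have IX: "I \<inter> X = {}" using gap by (auto simp: I_def)
  have IR: "I \<inter> R = {}"
  proof -
    have "\<kappa> C s \<noteq> \<kappa> C u" if "s \<in> {a<..<b}" "u \<in> {0..a} \<union> {b..1}" for s u
      using \<kappa>_inj[OF C(1), of s u] gap[of s] that ab by auto
    then have "I \<inter> \<kappa> C ` ({0..a} \<union> {b..1}) = {}" unfolding I_def by blast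
    moreover have "I \<inter> \<pi> ` C' = {}" if "C' \<in> components L - {C}" for C'
      using \<kappa>_other[OF C(1), of C'] that IC IX by blast
    ultimately show ?thesis unfolding R_def by blast
  qed
  have "closed (\<kappa> C ` ({0..a} \<union> {b..1}))" "closed (\<kappa> C ` {a..b})"
    using ab con\<kappa> by (intro compact_imp_closed compact_continuous_image; auto elim: continuous_on_subset)+
  then have cl: "closed R" "closed (\<kappa> C ` {a..b})"
    unfolding R_def using others_closed by auto
  have abI: "\<kappa> C ` {a..b} = I \<union> {\<kappa> C a, \<kappa> C b}"
  proof -
    have "{a..b} = {a<..<b} \<union> {a, b}" using ab by auto
    then show ?thesis by (simp add: I_def image_Un)
  qed
  have eGX: "e \<subseteq> G" "e \<inter> X = {}" using in_components_subset[OF e] by auto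
  have "y \<in> I" using t ab by (auto simp: I_def)
  have "I \<subseteq> e"
  proof (rule components_maximal[OF e])
    show "connected I"
      unfolding I_def using con\<kappa> ab
      by (intro connected_continuous_image) (auto elim: continuous_on_subset)
    show "I \<subseteq> G - X" using GIR IX by auto
    show "e \<inter> I \<noteq> {}" using y \<open>y \<in> I\<close> by auto
  qed
  moreover have "e \<inter> R = {}"
  proof -
    define M where "M = \<kappa> C ` {a..b}"
    have M: "M \<subseteq> I \<union> X" "I \<subseteq> M" "closed M"
      using ab(5,6) cl(2) by (auto simp: M_def abI)
    have "M \<inter> R \<inter> e = {}" using M(1) IR eGX(2) by blast
    moreover have "e \<subseteq> M \<union> R" using eGX(1) GIR M(2) by blast
    moreover have "y \<in> M \<inter> e" using y \<open>y \<in> I\<close> M(2) by blast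
    ultimately show ?thesis
      using connected_closedD[OF in_components_connected[OF e] _ _ M(3) cl(1)] by blast
  qed
  ultimately have "e = I" using GIR eGX(1) by blast
  moreover from this have "G - e = R" using GIR IR by blast
  moreover from this have "closed (G - e)" using cl(1) by simp
  moreover have "a < b" using ab by simp
  ultimately show thesis
    using that[OF C(1) ab(1) _ ab(4) _ ab(5,6)] unfolding I_def R_def by simp
qed

end

section \<open>The checkerboard colouring\<close>

definition axis_dirs :: "(real \<times> real) set" where
  "axis_dirs = {(1, 0), (- 1, 0), (0, 1), (0, - 1)}"

definition half_axis :: "real \<Rightarrow> real \<times> real \<Rightarrow> (real \<times> real) set" where
  "half_axis r d = (\<lambda>t. t *\<^sub>R d) ` {0<..<r}"

lemma half_axis_props:
  assumes "d \<in> axis_dirs"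
  shows "connected (half_axis r d)" "half_axis r d \<subseteq> ball 0 r - {(0, 0)}"
    "\<And>z. z \<in> half_axis r d \<Longrightarrow> fst z = 0 \<or> snd z = 0"
proof -
  show "connected (half_axis r d)"
    unfolding half_axis_def by (intro connected_continuous_image continuous_intros connected_Ioo)
  show "half_axis r d \<subseteq> ball 0 r - {(0, 0)}" "\<And>z. z \<in> half_axis r d \<Longrightarrow> fst z = 0 \<or> snd z = 0"
    using assms by (auto simp: half_axis_def axis_dirs_def norm_Pair)
qed

lemma on_half_axis:
  assumes "norm z < r" "fst z = 0 \<or> snd z = 0" "z \<noteq> (0, 0)"
  shows "\<exists>d\<in>axis_dirs. z \<in> half_axis r d \<and> (snd z = 0 \<longrightarrow> snd d = 0) \<and> (fst z = 0 \<longrightarrow> fst d = 0)"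
proof -
  obtain x y where z: "z = (x, y)" by (cases z)
  have r: "\<bar>x\<bar> < r" "\<bar>y\<bar> < r"
    using assms(1) norm_fst_le[of x y] norm_snd_le[of y x] by (auto simp: z)
  consider "y = 0" "0 < x" | "y = 0" "x < 0" | "x = 0" "0 < y" | "x = 0" "y < 0"
    using assms(2,3) z by force
  then show ?thesis
  proof cases
    case 1
    then have "z = x *\<^sub>R (1, 0)" "x \<in> {0<..<r}" using z r by auto
    then show ?thesis
      unfolding half_axis_def axis_dirs_def using 1 z by (intro bexI[of _ "(1, 0)"]) auto
  next
    case 2
    then have "z = (- x) *\<^sub>R (- 1, 0)" "- x \<in> {0<..<r}" using z r by auto
    then show ?thesis
      unfolding half_axis_def axis_dirs_def using 2 z by (intro bexI[of _ "(- 1, 0)"] conjI image_eqI[of _ _ "- x"]) auto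
  next
    case 3
    then have "z = y *\<^sub>R (0, 1)" "y \<in> {0<..<r}" using z r by auto
    then show ?thesis
      unfolding half_axis_def axis_dirs_def using 3 z by (intro bexI[of _ "(0, 1)"]) auto
  next
    case 4
    then have "z = (- y) *\<^sub>R (0, - 1)" "- y \<in> {0<..<r}" using z r by auto
    then show ?thesis
      unfolding half_axis_def axis_dirs_def using 4 z by (intro bexI[of _ "(0, - 1)"] conjI image_eqI[of _ _ "- y"]) auto
  qed
qed

lemma chart_point_on_half_axis:
  assumes ch: "crossing_chart G X v V r h \<theta>" and e: "e \<in> components (G - X)" and p: "p \<in> e" "p \<in> V"
  shows "\<exists>d\<in>axis_dirs. \<theta> ` half_axis r d \<subseteq> e \<and> (snd (h p) = 0 \<longrightarrow> snd d = 0) \<and> (fst (h p) = 0 \<longrightarrow> fst d = 0)"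
proof -
  have hom: "homeomorphism V (ball 0 r) h \<theta>" and v: "\<theta> (0, 0) = v" "v \<in> X"
    and axes: "\<And>z. z \<in> ball 0 r \<Longrightarrow> \<theta> z \<in> G \<longleftrightarrow> fst z = 0 \<or> snd z = 0"
    using ch by (auto simp: crossing_chart_def)
  have hp: "h p \<in> ball 0 r" "\<theta> (h p) = p"
    using homeomorphism_image1[OF hom] homeomorphism_apply1[OF hom] p(2) by auto
  have "p \<in> G" "p \<notin> X" using in_components_subset[OF e] p by auto
  then have ax: "fst (h p) = 0 \<or> snd (h p) = 0" and nz: "h p \<noteq> (0, 0)"
    using axes[OF hp(1)] hp(2) v by auto
  have "norm (h p) < r" using hp(1) by (simp only: mem_ball_0)
  then obtain d where d: "d \<in> axis_dirs" "h p \<in> half_axis r d"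
      "snd (h p) = 0 \<longrightarrow> snd d = 0" "fst (h p) = 0 \<longrightarrow> fst d = 0"
    using on_half_axis[OF _ ax nz] by blast
  have "\<theta> ` half_axis r d \<subseteq> e"
    using axis_in_edge[OF ch half_axis_props(1,2)[OF d(1)] half_axis_props(3)[OF d(1)] e d(2)] hp(2) p(1) by simp
  then show ?thesis using d by blast
qed

lemma midpoint_half_axis: "0 < r \<Longrightarrow> (r / 2) *\<^sub>R d \<in> half_axis r d"
  by (auto simp: half_axis_def)

context planar_link
begin

text \<open>An edge has an end at some crossing, and there it contains one of the four half-axes of the chart.\<close>

lemma finite_E: "finite E"
proof -
  have "\<exists>S. finite S \<and> (\<forall>e\<in>E. v \<in> closure e \<longrightarrow> e \<inter> S \<noteq> {})" if v: "v \<in> X" for v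
  proof (rule chart[OF v])
    fix V r and h :: "complex \<Rightarrow> real \<times> real" and \<theta> A B
    assume ch: "crossing_chart G X v V r h \<theta>"
    let ?S = "(\<lambda>d. \<theta> ((r / 2) *\<^sub>R d)) ` axis_dirs"
    have V: "open V" "v \<in> V" "0 < r" using ch unfolding crossing_chart_def by blast+
    have "e \<inter> ?S \<noteq> {}" if e: "e \<in> E" "v \<in> closure e" for e
    proof -
      obtain p where "p \<in> e" "p \<in> V"
        using e(2) V(1,2) by (metis disjoint_iff open_Int_closure_eq_empty)
      then obtain d where d: "d \<in> axis_dirs" "\<theta> ` half_axis r d \<subseteq> e"
        using chart_point_on_half_axis[OF ch e(1)] by blast
      then have "\<theta> ((r / 2) *\<^sub>R d) \<in> e" using midpoint_half_axis[OF V(3)] by blast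
      then show ?thesis using d(1) by blast
    qed
    moreover have "finite ?S" by (simp add: axis_dirs_def)
    ultimately show ?thesis by blast
  qed
  then obtain S where S: "\<And>v. v \<in> X \<Longrightarrow> finite (S v)" "\<And>v e. v \<in> X \<Longrightarrow> e \<in> E \<Longrightarrow> v \<in> closure e \<Longrightarrow> e \<inter> S v \<noteq> {}"
    by metis
  have "E \<subseteq> connected_component_set (G - X) ` (\<Union>v\<in>X. S v)"
  proof
    fix e assume e: "e \<in> E"
    obtain C a b where C: "C \<in> components L" "0 \<le> a" "a < b" "b \<le> 1" "e = \<kappa> C ` {a<..<b}" "\<kappa> C a \<in> X"
      by (rule edge_parameter[OF e]) (rule that; assumption)
    have "continuous_on {a..b} (\<kappa> C)"
      using \<kappa>(1)[OF C(1)] C(2-4) unfolding path_def by (elim continuous_on_subset) auto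
    then have "\<kappa> C ` {a..b} \<subseteq> closure e"
      using image_closure_subset[of "{a<..<b}" "\<kappa> C" "closure e"] C(3,5) closure_subset[of e]
      by simp
    then have "\<kappa> C a \<in> closure e" using C(3) by auto
    then obtain s where s: "s \<in> e" "s \<in> S (\<kappa> C a)" using S(2)[OF C(6) e] by blast
    have "e = connected_component_set (G - X) s"
      using e s(1) by (metis (lifting) componentsE connected_component_eq)
    then show "e \<in> connected_component_set (G - X) ` (\<Union>v\<in>X. S v)"
      using s(2) C(6) by blast
  qed
  moreover have "finite (\<Union>v\<in>X. S v)" using S(1) finX by (simp add: X_def)
  ultimately show ?thesis by (meson finite_imageI finite_subset)
qed

text \<open>An edge with both ends at \<open>v\<close> would be open and closed in \<open>G - {v}\<close>, which is connected, so the
  graph would consist of \<open>v\<close> and this edge.  Then the link has one component only, which passes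
  through \<open>v\<close> once, whereas \<open>v\<close> is a double point.\<close>

lemma no_loop_edges:
  assumes e: "e \<in> E" and C: "C \<in> components L" and ab: "0 \<le> a" "a < b" "b \<le> 1"
    and ek: "e = \<kappa> C ` {a<..<b}" and X: "\<kappa> C a \<in> X" "\<kappa> C b \<in> X" and cl: "closed (G - e)"
    and rest: "G - e = \<kappa> C ` ({0..a} \<union> {b..1}) \<union> (\<Union>C'\<in>components L - {C}. \<pi> ` C')"
  shows "\<kappa> C a \<noteq> \<kappa> C b"
proof
  assume eq: "\<kappa> C a = \<kappa> C b"
  define v where "v = \<kappa> C a"
  have eGX: "e \<subseteq> G - X" using in_components_subset[OF e] .
  have "{a..b} = {a<..<b} \<union> {a, b}" using ab by auto
  then have "\<kappa> C ` {a..b} = insert v e" using eq by (simp add: ek v_def image_Un)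
  moreover have "closed (\<kappa> C ` {a..b})"
    using \<kappa>(1)[OF C] ab unfolding path_def
    by (intro compact_imp_closed compact_continuous_image) (auto elim: continuous_on_subset)
  ultimately have cle: "closed (insert v e)" by simp
  have "connected (G - {v})"
    using reduced[of v] X(1) by (simp add: G_def X_def v_def)
  then have "insert v e \<inter> (G - {v}) = {} \<or> (G - e) \<inter> (G - {v}) = {}"
    by (rule connected_closedD[OF _ _ _ cle cl]) auto
  moreover have "e \<inter> (G - {v}) \<noteq> {}"
    using in_components_nonempty[OF e] eGX X(1) v_def by blast
  ultimately have sub: "G - e \<subseteq> {v}" by blast
  have fin: "finite {z \<in> L. \<pi> z = v}" using finite_fibre X(1) by (simp add: v_def)
  have single: "C' = C" if C': "C' \<in> components L" for C'
  proof (rule ccontr)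
    assume "C' \<noteq> C"
    then have "\<pi> ` C' \<subseteq> {v}" using C' sub rest by blast
    then have "C' \<subseteq> {z \<in> L. \<pi> z = v}" using component_facts(2)[OF C'] by blast
    then show False using component_facts(4)[OF C'] fin finite_subset by blast
  qed
  have LC: "L = C" using Union_components[of L] single C by blast
  have lab: "loop C ` ({0..a} \<union> {b..1}) \<subseteq> {z \<in> L. \<pi> z = v}"
  proof
    fix z assume "z \<in> loop C ` ({0..a} \<union> {b..1})"
    then obtain s where s: "s \<in> {0..a} \<union> {b..1}" "z = loop C s" by blast
    then have "\<kappa> C s \<in> G - e" using rest by blast
    then have "\<pi> z = v" using sub s(2) by (auto simp: \<kappa>_def)
    moreover have "s \<in> {0..1}" using s(1) ab by auto
    then have "z \<in> L" using loop(3)[OF C] LC s(2) by (auto simp: path_image_def)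
    ultimately show "z \<in> {z \<in> L. \<pi> z = v}" by simp
  qed
  have inj: "s = t" if "s \<in> {0..1}" "t \<in> {0..1}" "loop C s = loop C t" "\<not> (s = 0 \<and> t = 1)" "\<not> (s = 1 \<and> t = 0)" for s t
    using loop(1)[OF C] that unfolding simple_path_def loop_free_def by blast
  have "inj_on (loop C) {0..a}" "inj_on (loop C) {b..1}"
    using ab by (auto intro!: inj_onI inj)
  moreover have "finite (loop C ` {0..a})" "finite (loop C ` {b..1})"
    using finite_subset[OF lab fin] by (simp_all add: image_Un)
  ultimately have fin01: "finite {0..a}" "finite {b..1}" using finite_imageD by blast+
  have a0: "a = 0" using fin01(1) ab(1) infinite_Icc[of 0 a] by force
  have b1: "b = 1" using fin01(2) ab(3) infinite_Icc[of b 1] by force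
  have "v \<in> double_points \<pi> L" using X(1) by (simp add: X_def v_def)
  then obtain z w where "z \<in> L" "w \<in> L" "z \<noteq> w" "\<pi> z = v" "\<pi> w = v"
    unfolding double_points_def by blast
  then have zw: "z \<in> C" "w \<in> C" "z \<noteq> w" "\<pi> z = v" "\<pi> w = v" using LC by blast+
  have ends: "z = loop C 0" if zC: "z \<in> C" and zv: "\<pi> z = v" for z
  proof -
    have "z \<in> loop C ` {0..1}" using zC loop(3)[OF C] by (simp add: path_image_def)
    then obtain s where s: "s \<in> {0..1}" "z = loop C s" by blast
    have "\<kappa> C s \<in> X" using zv s(2) X(1) by (simp add: \<kappa>_def v_def)
    then have "s \<notin> {a<..<b}" using eGX ek by blast
    then have "\<not> (0 < s \<and> s < 1)" using a0 b1 by simp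
    then have "s = 0 \<or> s = 1" using s(1) by auto
    then show ?thesis using s(2) loop(2)[OF C] by (auto simp: pathstart_def pathfinish_def)
  qed
  show False using ends[OF zw(1,4)] ends[OF zw(2,5)] zw(3) by simp
qed

definition total_winding :: "complex \<Rightarrow> complex" where
  "total_winding p = (\<Sum>C\<in>components L. winding_number (\<kappa> C) p)"

text \<open>The total winding number of the projected components changes by one across every edge, so its parity
  is a checkerboard colouring.\<close>

definition dark :: "complex set \<Rightarrow> bool" where
  "dark F \<longleftrightarrow> (\<exists>n::int. odd n \<and> (\<forall>p\<in>F. total_winding p = of_int n))"

lemma total_winding_constant:
  assumes F: "F \<in> components (- G)"
  shows "\<exists>n::int. \<forall>p\<in>F. total_winding p = of_int n"
proof -
  have off: "F \<inter> path_image (\<kappa> C) = {}" if "C \<in> components L" for C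
    using in_components_subset[OF F] \<kappa>(3)[OF that] component_facts(2)[OF that] by (auto simp: G_def)
  obtain q where q: "q \<in> F" using in_components_nonempty[OF F] by blast
  have "winding_number (\<kappa> C) p = winding_number (\<kappa> C) q" if "C \<in> components L" "p \<in> F" for C p
    using winding_number_constant[OF \<kappa>(1,2)[OF that(1)] in_components_connected[OF F] off[OF that(1)]] q that(2)
    unfolding constant_on_def by metis
  then have "total_winding p = total_winding q" if "p \<in> F" for p
    using that unfolding total_winding_def by (intro sum.cong) auto
  moreover have "total_winding q \<in> \<int>"
    unfolding total_winding_def using integer_winding_number \<kappa> off q by (intro Ints_sum) blast
  then obtain n where "total_winding q = of_int n" by (rule Ints_cases)
  ultimately show ?thesis by metis
qed

text \<open>The edge belongs to one component \<open>C\<close>, the remainder of which leads back from its end to its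
  start, so that there are exactly two faces at the edge.  As the other components keep away
  from the edge, the total winding number jumps by one just as the path of the edge does, so exactly one of the
  faces is dark.  If this is not the face on the left, the path is reversed.\<close>

lemma edge_faces:
  assumes e: "e \<in> E"
  shows "\<exists>\<gamma> Fb Fw. arc \<gamma> \<and> path_image \<gamma> \<subseteq> G \<and> e = path_image \<gamma> - {pathstart \<gamma>, pathfinish \<gamma>} \<and>
    pathstart \<gamma> \<in> X \<and> pathfinish \<gamma> \<in> X \<and> Fb \<in> components (- G) \<and> Fw \<in> components (- G) \<and>
    dark Fb \<and> \<not> dark Fw \<and> e \<subseteq> frontier Fb \<and> e \<subseteq> frontier Fw \<and>
    (\<forall>F\<in>components (- G). F \<noteq> Fb \<longrightarrow> F \<noteq> Fw \<longrightarrow> closure F \<inter> e = {}) \<and>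
    (\<forall>x\<in>e. jump (winding_number \<gamma>) Fb Fw x 1)"
proof -
  obtain C a b where C: "C \<in> components L" and ab: "0 \<le> a" "a < b" "b \<le> 1" and ek: "e = \<kappa> C ` {a<..<b}"
    and X: "\<kappa> C a \<in> X" "\<kappa> C b \<in> X" and cl: "closed (G - e)"
    and rest: "G - e = \<kappa> C ` ({0..a} \<union> {b..1}) \<union> (\<Union>C'\<in>components L - {C}. \<pi> ` C')"
    by (rule edge_parameter[OF e]) (rule that; assumption)
  have ne: "\<kappa> C a \<noteq> \<kappa> C b"
    by (rule no_loop_edges[OF e C ab ek X cl rest])
  define \<gamma> where "\<gamma> = subpath a b (\<kappa> C)"
  have eGX: "e \<subseteq> G - X" using in_components_subset[OF e] .
  have "inj_on (\<kappa> C) {a..b}"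
  proof (rule inj_onI)
    fix s t assume st: "s \<in> {a..b}" "t \<in> {a..b}" "\<kappa> C s = \<kappa> C t"
    then have st01: "s \<in> {0..1}" "t \<in> {0..1}" using ab by auto
    show "s = t"
    proof (cases "\<kappa> C s \<in> X")
      case False
      then show ?thesis using \<kappa>_inj[OF C st01 st(3)] by blast
    next
      case True
      have nX: "\<kappa> C u \<notin> X" if "u \<in> {a<..<b}" for u using eGX ek that by blast
      have "s \<notin> {a<..<b}" using nX[of s] True by blast
      moreover have "t \<notin> {a<..<b}" using nX[of t] True st(3) by metis
      ultimately have "s = a \<or> s = b" "t = a \<or> t = b" using st(1,2) by auto
      then show ?thesis using st(3) ne by auto
    qed
  qed
  then have \<gamma>: "arc \<gamma>"
    unfolding \<gamma>_def arc_subpath_eq using ab \<kappa>(1)[OF C] by (simp add: closed_segment_eq_real_ivl)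
  have ends: "pathstart \<gamma> = \<kappa> C a" "pathfinish \<gamma> = \<kappa> C b" by (simp_all add: \<gamma>_def)
  have im: "path_image \<gamma> = \<kappa> C ` {a..b}" using ab by (simp add: \<gamma>_def path_image_subpath)
  have "{a..b} = {a<..<b} \<union> {a, b}" using ab by auto
  then have im': "path_image \<gamma> = e \<union> {\<kappa> C a, \<kappa> C b}" by (simp add: im ek image_Un)
  have e\<gamma>: "e = path_image \<gamma> - {pathstart \<gamma>, pathfinish \<gamma>}"
    unfolding im' ends using eGX X by blast
  have \<gamma>G: "path_image \<gamma> \<subseteq> G" unfolding im' using eGX X X_sub by blast
  define \<delta> where "\<delta> = subpath b 1 (\<kappa> C) +++ subpath 0 a (\<kappa> C)"
  have loopC: "\<kappa> C 1 = \<kappa> C 0" using \<kappa>(2)[OF C] by (simp add: pathstart_def pathfinish_def)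
  have \<delta>: "path \<delta>" "pathstart \<delta> = pathfinish \<gamma>" "pathfinish \<delta> = pathstart \<gamma>"
    unfolding \<delta>_def ends using ab \<kappa>(1)[OF C] loopC by auto
  have "path_image \<delta> \<subseteq> \<kappa> C ` ({0..a} \<union> {b..1})"
    unfolding \<delta>_def using ab path_image_join_subset[of "subpath b 1 (\<kappa> C)" "subpath 0 a (\<kappa> C)"]
    by (auto simp: path_image_subpath)
  then have \<delta>G: "path_image \<delta> \<subseteq> G - e" using rest by blast
  obtain F1 F2 where F: "F1 \<in> components (- G)" "F2 \<in> components (- G)" "F1 \<noteq> F2"
    "e \<subseteq> frontier F1" "e \<subseteq> frontier F2"
    "\<And>F. F \<in> components (- G) \<Longrightarrow> F \<noteq> F1 \<Longrightarrow> F \<noteq> F2 \<Longrightarrow> closure F \<inter> e = {}"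
    and j: "\<And>x. x \<in> e \<Longrightarrow> jump (winding_number \<gamma>) F1 F2 x 1"
    by (rule edge_two_faces[OF compG \<gamma> \<gamma>G e\<gamma> cl \<delta> \<delta>G]) (rule that; assumption)
  have offG: "(F1 \<union> F2) \<inter> G = {}"
    using in_components_subset[OF F(1)] in_components_subset[OF F(2)] by blast
  obtain n1 n2 :: int where n: "\<And>p. p \<in> F1 \<Longrightarrow> total_winding p = of_int n1" "\<And>p. p \<in> F2 \<Longrightarrow> total_winding p = of_int n2"
    using total_winding_constant[OF F(1)] total_winding_constant[OF F(2)] by blast
  obtain x where x: "x \<in> e" using in_components_nonempty[OF e] by blast
  have "jump (winding_number (\<kappa> D)) F1 F2 x (if D = C then 1 else 0)" if D: "D \<in> components L" for D
  proof (cases "D = C")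
    case True
    have "x \<notin> \<kappa> C ` ({0..a} \<union> {b..1})" using x rest by blast
    moreover have "(F1 \<union> F2) \<inter> path_image (\<kappa> C) = {}"
      using offG \<kappa>(3)[OF C] component_facts(2)[OF C] by (auto simp: G_def)
    ultimately have "jump (winding_number (\<kappa> C)) F1 F2 x 1"
      using jump_subpath[OF \<kappa>(1)[OF C], of F1 F2 a b x 1] ab j[OF x] by (simp add: \<gamma>_def)
    then show ?thesis using True by simp
  next
    case False
    then have "x \<notin> path_image (\<kappa> D)" using D x rest \<kappa>(3)[OF D] by blast
    then show ?thesis using False jump_winding_number_off_path[OF \<kappa>(1)[OF D]] by simp
  qed
  then have "jump total_winding F1 F2 x (\<Sum>D\<in>components L. if D = C then 1 else 0)"
    unfolding total_winding_def by (rule jump_sum)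
  then have "jump total_winding F1 F2 x 1" using finC C by simp
  moreover have "x \<in> closure F1 - F1" "x \<in> closure F2 - F2"
    using F(4,5) x offG eGX unfolding frontier_def by blast+
  ultimately have "1 = complex_of_int n1 - of_int n2"
    by (rule jump_const[OF _ _ _ n])
  then have "of_int (n1 - n2) = complex_of_int 1" by simp
  then have n12: "n1 - n2 = 1" by (simp only: of_int_eq_iff)
  have dark: "dark F \<longleftrightarrow> odd n" if F: "F \<in> components (- G)" and wF: "\<And>p. p \<in> F \<Longrightarrow> total_winding p = of_int n" for F n
  proof -
    obtain p where p: "p \<in> F" using in_components_nonempty[OF F] by blast
    have "m = n" if "\<forall>p\<in>F. total_winding p = of_int m" for m
      using wF[OF p] that p by simp
    then show ?thesis unfolding dark_def using wF by blast
  qed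
  have d1: "dark F1 \<longleftrightarrow> odd n1" by (rule dark[OF F(1) n(1)])
  have d2: "dark F2 \<longleftrightarrow> odd n2" by (rule dark[OF F(2) n(2)])
  have Xends: "pathstart \<gamma> \<in> X" "pathfinish \<gamma> \<in> X" using X by (simp_all add: ends)
  show ?thesis
  proof (cases "odd n1")
    case True
    then have dk: "dark F1" "\<not> dark F2" using d1 d2 n12 by presburger+
    show ?thesis
      by (intro exI[of _ \<gamma>] exI[of _ F1] exI[of _ F2] conjI ballI impI;
          (rule \<gamma> \<gamma>G e\<gamma> Xends F(1,2,4,5,6) dk j | assumption)+)
  next
    case False
    then have dk: "dark F2" "\<not> dark F1" using d1 d2 n12 by presburger+
    have off: "(F1 \<union> F2) \<inter> path_image \<gamma> = {}" using offG \<gamma>G by blast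
    have j': "jump (winding_number (reversepath \<gamma>)) F2 F1 x 1" if "x \<in> e" for x
      using jump_swap[OF jump_reversepath[OF j[OF that] arc_imp_path[OF \<gamma>] off]] by simp
    have r: "arc (reversepath \<gamma>)" "path_image (reversepath \<gamma>) \<subseteq> G"
        "pathstart (reversepath \<gamma>) \<in> X" "pathfinish (reversepath \<gamma>) \<in> X"
        "e = path_image (reversepath \<gamma>) - {pathstart (reversepath \<gamma>), pathfinish (reversepath \<gamma>)}"
      using \<gamma> \<gamma>G Xends by (simp_all add: arc_reversepath) (use e\<gamma> in blast)
    show ?thesis
      by (intro exI[of _ "reversepath \<gamma>"] exI[of _ F2] exI[of _ F1] conjI ballI impI;
          (rule r F(1,2,4,5,6) dk j' | assumption)+)
  qed
qed

end

section \<open>Labels of link components\<close>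

context alternating_graph
begin

lemma half_axis_edge_exists:
  assumes ch: "crossing_chart G X v V r h \<theta>" and d: "d \<in> axis_dirs"
  shows "\<exists>e\<in>E. \<theta> ` half_axis r d \<subseteq> e"
proof -
  have hom: "homeomorphism V (ball 0 r) h \<theta>" and v: "\<theta> (0, 0) = v" "X \<inter> V = {v}" and r: "0 < r"
    and axes: "\<And>z. z \<in> ball 0 r \<Longrightarrow> \<theta> z \<in> G \<longleftrightarrow> fst z = 0 \<or> snd z = 0"
    using ch by (auto simp: crossing_chart_def)
  define z where "z = (r / 2) *\<^sub>R d"
  have z: "z \<in> half_axis r d" unfolding z_def by (rule midpoint_half_axis[OF r])
  then have zb: "z \<in> ball 0 r" "z \<noteq> (0, 0)" "fst z = 0 \<or> snd z = 0"
    using half_axis_props(2)[OF d, of r] half_axis_props(3)[OF d z] by blast+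
  have "\<theta> z \<in> V" using homeomorphism_image2[OF hom] zb(1) by blast
  moreover have "\<theta> z \<noteq> v"
  proof
    assume "\<theta> z = v"
    then have "h (\<theta> z) = h (\<theta> (0, 0))" using v(1) by simp
    moreover have "(0, 0) \<in> ball 0 r" using r by (simp add: zero_prod_def[symmetric])
    ultimately show False using homeomorphism_apply2[OF hom] zb(1,2) by metis
  qed
  ultimately have "\<theta> z \<in> G - X" using axes[OF zb(1)] zb(3) v(2) by blast
  then obtain e where e: "e \<in> E" "\<theta> z \<in> e" using Union_components[of "G - X"] unfolding E_eq by blast
  have "\<theta> ` half_axis r d \<subseteq> e"
    by (rule axis_in_edge[OF ch half_axis_props(1,2)[OF d] half_axis_props(3)[OF d] _ z e(2)])
       (use e(1) E_eq in auto)
  then show ?thesis using e(1) by blast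
qed

lemma half_axis_end:
  assumes ch: "crossing_chart G X v V r h \<theta>" and d: "d \<in> axis_dirs" and e: "e \<in> E" "\<theta> ` half_axis r d \<subseteq> e"
  shows "v = tail e \<or> v = head e"
proof -
  have hom: "homeomorphism V (ball 0 r) h \<theta>" and v: "\<theta> (0, 0) = v" "v \<in> X" and r: "0 < r"
    using ch by (auto simp: crossing_chart_def)
  have "norm d = 1" using d by (auto simp: axis_dirs_def norm_Pair)
  then have "(\<lambda>t. t *\<^sub>R d) ` {0..r / 2} \<subseteq> ball 0 r" using r by auto
  then have "continuous_on {0..r / 2} (\<theta> \<circ> (\<lambda>t. t *\<^sub>R d))"
    by (intro continuous_on_compose continuous_intros continuous_on_subset[OF homeomorphism_cont2[OF hom]])
  then have cont: "continuous_on (closure {0<..<r / 2}) (\<theta> \<circ> (\<lambda>t. t *\<^sub>R d))"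
    using r by simp
  have "(\<theta> \<circ> (\<lambda>t. t *\<^sub>R d)) ` {0<..<r / 2} \<subseteq> \<theta> ` half_axis r d"
    using r unfolding half_axis_def image_comp by (intro image_mono) auto
  also have "\<dots> \<subseteq> path_image (\<gamma> e)" using e edge_interior[OF e(1)] by blast
  finally have "(\<theta> \<circ> (\<lambda>t. t *\<^sub>R d)) ` closure {0<..<r / 2} \<subseteq> path_image (\<gamma> e)"
    using image_closure_subset[OF cont closed_arc_image[OF edge_arc[OF e(1)]]] by blast
  moreover have "0 \<in> closure {0<..<r / 2}" using r by simp
  ultimately have "\<theta> (0 *\<^sub>R d) \<in> path_image (\<gamma> e)" by (metis comp_apply image_subset_iff)
  then have "v \<in> path_image (\<gamma> e)" using v(1) by (simp add: zero_prod_def)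
  then show ?thesis using edge_interior[OF e(1)] edge_X[OF e(1)] v(2) by blast
qed

text \<open>A reflection of the chart turns the half-axes into those that bound the first quadrant.  With \<open>s = 1\<close> the
  two edges cannot both start at \<open>v\<close>, and with reversed paths and \<open>s = - 1\<close> they cannot both end there.\<close>

lemma half_edges_alternate:
  assumes ch: "crossing_chart G X v V r h \<theta>" and ab: "a \<in> {1, - 1}" "b \<in> {1, - 1}"
    and e: "e \<in> E" "\<theta> ` half_axis r (a, 0) \<subseteq> e" and e': "e' \<in> E" "\<theta> ` half_axis r (0, b) \<subseteq> e'"
  shows "tail e = v \<longleftrightarrow> head e' = v"
proof -
  have r: "0 < r" using ch by (simp add: crossing_chart_def)
  define T where "T = (\<lambda>z :: real \<times> real. (a * fst z, b * snd z))"
  have ch': "crossing_chart G X v V r (T \<circ> h) (\<theta> \<circ> T)"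
  proof (rule crossing_chart_transform[OF ch])
    show "continuous_on UNIV T" unfolding T_def by (intro continuous_intros)
    show "T (T z) = z" for z using ab by (auto simp: T_def)
    show "norm (T z) = norm z" for z using ab by (cases z) (auto simp: T_def norm_Pair)
    show "fst (T z) = 0 \<or> snd (T z) = 0 \<longleftrightarrow> fst z = 0 \<or> snd z = 0" for z using ab by (auto simp: T_def)
  qed
  have "(\<theta> \<circ> T) (r / 2, 0) = \<theta> ((r / 2) *\<^sub>R (a, 0))" "(\<theta> \<circ> T) (0, r / 2) = \<theta> ((r / 2) *\<^sub>R (0, b))"
    by (simp_all add: T_def mult.commute)
  then have mid: "(\<theta> \<circ> T) (r / 2, 0) \<in> e" "(\<theta> \<circ> T) (0, r / 2) \<in> e'"
    using e(2) e'(2) midpoint_half_axis[OF r] by (metis image_subset_iff)+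
  have off: "(Fb a \<union> Fw a) \<inter> path_image (\<gamma> a) = {}" if "a \<in> E" for a
    using edge_im[OF that] in_components_subset[OF faces(1)[OF that]] in_components_subset[OF faces(2)[OF that]]
    by blast
  have not_tails: "\<not> (tail e = v \<and> tail e' = v)"
    using adjacent_half_edges[OF ch' e(1) mid(1) e'(1) mid(2) edge_arc[OF e(1)] refl _ _ edge_arc[OF e'(1)] refl, of 1]
      jump_edge[OF e(1)] jump_edge[OF e'(1)] by auto
  have rev: "jump (winding_number (reversepath (\<gamma> c))) (Fb c) (Fw c) x (- 1)" if "c \<in> E" "x \<in> c" for c x
    using jump_reversepath[OF jump_edge[OF that] arc_imp_path[OF edge_arc[OF that(1)]] off[OF that(1)]] .
  have not_heads: "\<not> (head e = v \<and> head e' = v)"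
    using adjacent_half_edges[OF ch' e(1) mid(1) e'(1) mid(2) arc_reversepath[OF edge_arc[OF e(1)]] path_image_reversepath _ _
        arc_reversepath[OF edge_arc[OF e'(1)]] path_image_reversepath, of "- 1"]
      rev[OF e(1)] rev[OF e'(1)] by auto
  have "(a, 0) \<in> axis_dirs" "(0, b) \<in> axis_dirs" using ab by (auto simp: axis_dirs_def)
  then have "v = tail e \<or> v = head e" "v = tail e' \<or> v = head e'"
    using half_axis_end[OF ch _ e] half_axis_end[OF ch _ e'] by blast+
  then show ?thesis using not_tails not_heads by metis
qed

lemma out_edge_exists:
  assumes ch: "crossing_chart G X v V r h \<theta>"
  shows "\<exists>e\<in>E. tail e = v"
proof -
  have d: "(1, 0) \<in> axis_dirs" "(0, 1) \<in> axis_dirs" by (simp_all add: axis_dirs_def)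
  obtain e e' where e: "e \<in> E" "\<theta> ` half_axis r (1, 0) \<subseteq> e" and e': "e' \<in> E" "\<theta> ` half_axis r (0, 1) \<subseteq> e'"
    using half_axis_edge_exists[OF ch d(1)] half_axis_edge_exists[OF ch d(2)] by blast
  have "tail e = v \<longleftrightarrow> head e' = v"
    by (rule half_edges_alternate[OF ch _ _ e e']) auto
  then show ?thesis using half_axis_end[OF ch d(2) e'] e(1) e'(1) by blast
qed

text \<open>Opposite half-edges both alternate with a half-edge on the other axis, so both start at \<open>v\<close>
  or both end there.  The label of an edge, the potential of its tail, is then \<open>f v\<close> in the first case
  and \<open>f v - 1\<close> in the second, up to multiples of \<open>k\<close>.\<close>

lemma strand_label:
  assumes ch: "crossing_chart G X v V r h \<theta>" and d: "d1 \<in> axis_dirs" "d2 \<in> axis_dirs"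
    and same: "fst d1 = 0 \<and> fst d2 = 0 \<or> snd d1 = 0 \<and> snd d2 = 0"
    and e1: "e1 \<in> E" "\<theta> ` half_axis r d1 \<subseteq> e1" and e2: "e2 \<in> E" "\<theta> ` half_axis r d2 \<subseteq> e2"
    and f: "\<And>e. e \<in> E \<Longrightarrow> k dvd f (head e) - f (tail e) - (1::int)"
  shows "k dvd f (tail e1) - f (tail e2)"
proof -
  have iff: "tail e1 = v \<longleftrightarrow> tail e2 = v"
    using same
  proof
    assume "snd d1 = 0 \<and> snd d2 = 0"
    then obtain a1 a2 where a: "d1 = (a1, 0)" "d2 = (a2, 0)" "a1 \<in> {1, - 1}" "a2 \<in> {1, - 1}"
      using d by (auto simp: axis_dirs_def)
    obtain e' where e': "e' \<in> E" "\<theta> ` half_axis r (0, 1) \<subseteq> e'"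
      using half_axis_edge_exists[OF ch, of "(0, 1)"] by (auto simp: axis_dirs_def)
    show ?thesis
      using half_edges_alternate[OF ch a(3) _ e1(1) _ e'] half_edges_alternate[OF ch a(4) _ e2(1) _ e'] e1(2) e2(2) a(1,2)
      by simp
  next
    assume "fst d1 = 0 \<and> fst d2 = 0"
    then obtain a1 a2 where a: "d1 = (0, a1)" "d2 = (0, a2)" "a1 \<in> {1, - 1}" "a2 \<in> {1, - 1}"
      using d by (auto simp: axis_dirs_def)
    obtain e' where e': "e' \<in> E" "\<theta> ` half_axis r (1, 0) \<subseteq> e'"
      using half_axis_edge_exists[OF ch, of "(1, 0)"] by (auto simp: axis_dirs_def)
    have "tail e' = v \<longleftrightarrow> head e1 = v" "tail e' = v \<longleftrightarrow> head e2 = v"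
      using half_edges_alternate[OF ch _ a(3) e' e1(1)] half_edges_alternate[OF ch _ a(4) e' e2(1)] e1(2) e2(2) a(1,2)
      by simp_all
    moreover have "tail e \<noteq> head e" if "e \<in> E" for e
      using arc_distinct_ends[OF edge_arc[OF that]] by simp
    ultimately show ?thesis
      using half_axis_end[OF ch d(1) e1] half_axis_end[OF ch d(2) e2] e1(1) e2(1) by metis
  qed
  show ?thesis
  proof (cases "tail e1 = v")
    case True
    then show ?thesis using iff by simp
  next
    case False
    then have h: "head e1 = v" "head e2 = v"
      using iff half_axis_end[OF ch d(1) e1] half_axis_end[OF ch d(2) e2] by auto
    have "k dvd (f v - f (tail e2) - 1) - (f v - f (tail e1) - 1)"
      using f[OF e1(1)] f[OF e2(1)] unfolding h by (rule dvd_diff[rotated])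
    then show ?thesis by simp
  qed
qed

text \<open>The head of an edge with label \<open>c\<close> has potential \<open>c + 1\<close>, and it is the tail of some other
  edge.\<close>

lemma all_labels_occur:
  assumes ch: "\<And>v. v \<in> X \<Longrightarrow> \<exists>V r h \<theta>. crossing_chart G X v V r h \<theta>" and ne: "X \<noteq> {}"
    and k: "0 < k" and f: "\<And>e. e \<in> E \<Longrightarrow> k dvd f (head e) - f (tail e) - (1::int)"
  shows "\<exists>e\<in>E. k dvd f (tail e) - n"
proof -
  obtain v0 where v0: "v0 \<in> X" using ne by blast
  have "\<exists>e\<in>E. k dvd f (tail e) - (f v0 + int m)" for m
  proof (induction m)
    case 0
    obtain e where "e \<in> E" "tail e = v0" using out_edge_exists ch[OF v0] by blast
    then show ?case by (intro bexI[of _ e]) auto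
  next
    case (Suc m)
    then obtain e where e: "e \<in> E" "k dvd f (tail e) - (f v0 + int m)" by blast
    obtain e' where e': "e' \<in> E" "tail e' = head e"
      using out_edge_exists ch[OF edge_ends(2)[OF e(1)]] by blast
    have "k dvd (f (head e) - f (tail e) - 1) + (f (tail e) - (f v0 + int m))"
      using f[OF e(1)] e(2) by (rule dvd_add)
    then show ?case using e' by (intro bexI[of _ e']) (auto simp: algebra_simps)
  qed
  from this[of "nat ((n - f v0) mod k)"] obtain e where e: "e \<in> E" "k dvd f (tail e) - (f v0 + (n - f v0) mod k)"
    using k by auto
  have "k dvd (f v0 + (n - f v0) mod k) - n"
  proof -
    have "(f v0 + (n - f v0) mod k) - n = - (k * ((n - f v0) div k))"
      using mult_div_mod_eq[of k "n - f v0"] by linarith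
    then show ?thesis by simp
  qed
  then have "k dvd (f (tail e) - (f v0 + (n - f v0) mod k)) + ((f v0 + (n - f v0) mod k) - n)"
    using e(2) by (intro dvd_add)
  then show ?thesis using e(1) by auto
qed

end

context planar_link
begin

text \<open>Off the crossings a point of the link is labelled by the label of the edge below it.  This is locally
  constant, even across a crossing by \<open>strand_label\<close>, hence constant on each component.  As all residues
  modulo \<open>k\<close> occur as labels, they are taken on \<open>k\<close> different components.\<close>

theorem components_ge:
  assumes k: "0 < k"
    and dvd: "\<And>F. F \<in> components (- G) \<Longrightarrow> k dvd int (card {e \<in> E. e \<subseteq> frontier F})"
  shows "k \<le> int (card (components L))"
proof -
  obtain \<gamma> Fb Fw where ef: "\<And>e. e \<in> E \<Longrightarrow>
      arc (\<gamma> e) \<and> path_image (\<gamma> e) \<subseteq> G \<and> e = path_image (\<gamma> e) - {pathstart (\<gamma> e), pathfinish (\<gamma> e)} \<and>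
      pathstart (\<gamma> e) \<in> X \<and> pathfinish (\<gamma> e) \<in> X \<and> Fb e \<in> components (- G) \<and> Fw e \<in> components (- G) \<and>
      dark (Fb e) \<and> \<not> dark (Fw e) \<and> e \<subseteq> frontier (Fb e) \<and> e \<subseteq> frontier (Fw e) \<and>
      (\<forall>F\<in>components (- G). F \<noteq> Fb e \<longrightarrow> F \<noteq> Fw e \<longrightarrow> closure F \<inter> e = {}) \<and>
      (\<forall>x\<in>e. jump (winding_number (\<gamma> e)) (Fb e) (Fw e) x 1)"
    using edge_faces by metis
  interpret A: alternating_graph G X E \<gamma> Fb Fw dark
  proof
    show "finite X" using finX by (simp add: X_def)
    show "finite E" by (rule finite_E)
    fix e assume e: "e \<in> E"
    show "arc (\<gamma> e)" using ef[OF e] by (elim conjE)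
    show "path_image (\<gamma> e) \<subseteq> G" using ef[OF e] by (elim conjE)
    show "e = path_image (\<gamma> e) - {pathstart (\<gamma> e), pathfinish (\<gamma> e)}" using ef[OF e] by (elim conjE)
    show "pathstart (\<gamma> e) \<in> X" using ef[OF e] by (elim conjE)
    show "pathfinish (\<gamma> e) \<in> X" using ef[OF e] by (elim conjE)
    show "Fb e \<in> components (- G)" using ef[OF e] by (elim conjE)
    show "Fw e \<in> components (- G)" using ef[OF e] by (elim conjE)
    show "dark (Fb e)" using ef[OF e] by (elim conjE)
    show "\<not> dark (Fw e)" using ef[OF e] by (elim conjE)
    show "e \<subseteq> frontier (Fb e)" using ef[OF e] by (elim conjE)
    show "e \<subseteq> frontier (Fw e)" using ef[OF e] by (elim conjE)
    show "closure F \<inter> e = {}" if "F \<in> components (- G)" "F \<noteq> Fb e" "F \<noteq> Fw e" for F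
      using ef[OF e] that by (elim conjE) blast
    show "jump (winding_number (\<gamma> e)) (Fb e) (Fw e) x 1" if "x \<in> e" for x
      using ef[OF e] that by (elim conjE) blast
  qed (rule refl)
  obtain f :: "complex \<Rightarrow> int" where f: "\<And>e. e \<in> E \<Longrightarrow> k dvd f (A.head e) - f (A.tail e) - 1"
    using A.potential_exists[OF dvd] by blast
  have charts: "\<exists>V r h \<theta>. crossing_chart G X v V r h \<theta>" if "v \<in> X" for v
    by (rule chart[OF that]) blast
  have "X \<noteq> {}" using X_ne by (simp add: X_def)
  then have every: "\<exists>e\<in>E. k dvd f (A.tail e) - n" for n
    using A.all_labels_occur[OF charts _ k f] by blast

  define edge where "edge z = connected_component_set (G - X) (\<pi> z)" for z
  define label where "label z = f (A.tail (edge z)) mod k" for z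
  have edge: "edge z = e" if "e \<in> E" "\<pi> z \<in> e" for z e
    using that unfolding edge_def by (metis (lifting) componentsE connected_component_eq)
  \<comment> \<open>at a crossing the value \<open>c\<close> is that of the edges of the strand through \<open>z\<close>\<close>
  have local: "\<exists>c. (\<pi> z \<notin> X \<longrightarrow> label z = c) \<and> (\<forall>\<^sub>F y in at z within L. \<pi> y \<notin> X \<and> label y = c)"
    if z: "z \<in> L" for z
  proof (cases "\<pi> z \<in> X")
    case False
    then have "\<pi> z \<in> G - X" using z by (simp add: G_def)
    then obtain e where e: "e \<in> E" "\<pi> z \<in> e" using Union_components[of "G - X"] by blast
    have "closed (G - e)" by (rule edge_parameter[OF e(1)])
    then have "openin (top_of_set L) (L \<inter> \<pi> -` (- (G - e)))"
      by (intro continuous_openin_preimage_gen[OF cont]) (rule open_Compl)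
    then obtain U where U: "open U" "L \<inter> \<pi> -` (- (G - e)) = L \<inter> U" by (auto simp: openin_open)
    have "\<pi> y \<in> e" if "y \<in> L" "y \<in> U" for y
      using U(2) that by (auto simp: G_def)
    moreover have "z \<in> U" using U(2) z e(2) by auto
    moreover have "e \<inter> X = {}" using in_components_subset[OF e(1)] by blast
    ultimately have "\<forall>\<^sub>F y in at z within L. \<pi> y \<notin> X \<and> label y = label z"
      unfolding eventually_at_topological label_def using U(1) edge[OF e(1)] e(2)
      by (intro exI[of _ U]) auto
    then show ?thesis by blast
  next
    case True
    define v where "v = \<pi> z"
    have vX: "v \<in> X" using True v_def by simp
    show ?thesis
    proof (rule chart[OF vX])
      fix V r and h :: "complex \<Rightarrow> real \<times> real" and \<theta> A B
      assume ch: "crossing_chart G X v V r h \<theta>"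
        and AB: "openin (top_of_set L) A" "openin (top_of_set L) B" "A \<union> B = {z \<in> L. \<pi> z \<in> V}"
        and inj: "inj_on (h \<circ> \<pi>) A" "inj_on (h \<circ> \<pi>) B"
        and on: "\<And>z. z \<in> A \<Longrightarrow> snd (h (\<pi> z)) = 0" "\<And>z. z \<in> B \<Longrightarrow> fst (h (\<pi> z)) = 0"
        and hv: "h v = (0, 0)"
      have XV: "X \<inter> V = {v}" using ch unfolding crossing_chart_def by blast
      \<comment> \<open>the coordinate that vanishes on the axis to which the strand \<open>S\<close> through \<open>z\<close> projects\<close>
      define coord where "coord = (if z \<in> A then snd else fst :: real \<times> real \<Rightarrow> real)"
      obtain S where S: "openin (top_of_set L) S" "z \<in> S" "inj_on (h \<circ> \<pi>) S" "S \<subseteq> {z \<in> L. \<pi> z \<in> V}"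
          "\<And>y. y \<in> S \<Longrightarrow> coord (h (\<pi> y)) = 0"
      proof (cases "z \<in> A")
        case True
        have "A \<subseteq> {z \<in> L. \<pi> z \<in> V}" unfolding AB(3)[symmetric] by blast
        moreover have "coord (h (\<pi> y)) = 0" if "y \<in> A" for y using on(1)[OF that] True by (simp add: coord_def)
        ultimately show ?thesis by (rule that[OF AB(1) True inj(1)])
      next
        case False
        have "z \<in> A \<union> B" unfolding AB(3) using z XV v_def by blast
        then have "z \<in> B" using False by blast
        moreover have "B \<subseteq> {z \<in> L. \<pi> z \<in> V}" unfolding AB(3)[symmetric] by blast
        moreover have "coord (h (\<pi> y)) = 0" if "y \<in> B" for y using on(2)[OF that] False by (simp add: coord_def)
        ultimately show ?thesis by (rule that[OF AB(2) _ inj(2)])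
      qed
      have strand: "\<exists>d e. \<pi> y \<notin> X \<and> d \<in> axis_dirs \<and> coord d = 0 \<and> e \<in> E \<and> \<theta> ` half_axis r d \<subseteq> e \<and> label y = f (A.tail e) mod k"
        if y: "y \<in> S" "y \<noteq> z" for y
      proof -
        have "(h \<circ> \<pi>) y \<noteq> (h \<circ> \<pi>) z" using S(2,3) y by (metis inj_on_eq_iff)
        then have "\<pi> y \<noteq> v" by (auto simp: v_def)
        moreover have yV: "\<pi> y \<in> V" "y \<in> L" using S(4) y(1) by auto
        ultimately have nX: "\<pi> y \<notin> X" using XV by blast
        then have "\<pi> y \<in> G - X" using yV(2) by (simp add: G_def)
        then obtain e where e: "e \<in> E" "\<pi> y \<in> e" using Union_components[of "G - X"] by blast
        obtain d where d: "d \<in> axis_dirs" "\<theta> ` half_axis r d \<subseteq> e"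
            "snd (h (\<pi> y)) = 0 \<longrightarrow> snd d = 0" "fst (h (\<pi> y)) = 0 \<longrightarrow> fst d = 0"
          using chart_point_on_half_axis[OF ch e yV(1)] by blast
        have "coord d = 0" using S(5)[OF y(1)] d(3,4) by (auto simp: coord_def split: if_splits)
        moreover have "label y = f (A.tail e) mod k" using edge[OF e] by (simp add: label_def)
        ultimately show ?thesis using nX d(1,2) e(1) by blast
      qed
      \<comment> \<open>one of the two half-axes of this strand, to serve as reference for the label\<close>
      define d0 where "d0 = (if z \<in> A then (1, 0) else (0, 1) :: real \<times> real)"
      have d0: "d0 \<in> axis_dirs" "coord d0 = 0" by (simp_all add: d0_def axis_dirs_def coord_def)
      obtain e0 where e0: "e0 \<in> E" "\<theta> ` half_axis r d0 \<subseteq> e0"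
        using A.half_axis_edge_exists[OF ch d0(1)] by blast
      have lab: "\<pi> y \<notin> X \<and> label y = f (A.tail e0) mod k" if y: "y \<in> S" "y \<noteq> z" for y
      proof -
        obtain d e where d: "\<pi> y \<notin> X" "d \<in> axis_dirs" "coord d = 0" "e \<in> E" "\<theta> ` half_axis r d \<subseteq> e"
            "label y = f (A.tail e) mod k"
          using strand[OF y] by blast
        have "fst d = 0 \<and> fst d0 = 0 \<or> snd d = 0 \<and> snd d0 = 0"
          using d(3) d0(2) by (auto simp: coord_def split: if_splits)
        then have "k dvd f (A.tail e) - f (A.tail e0)"
          by (rule A.strand_label[OF ch d(2) d0(1) _ d(4,5) e0 f])
        then show ?thesis using d(1,6) by (simp add: mod_eq_dvd_iff)
      qed
      obtain U where U: "open U" "S = L \<inter> U" using S(1) by (auto simp: openin_open)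
      have "\<forall>\<^sub>F y in at z within L. \<pi> y \<notin> X \<and> label y = f (A.tail e0) mod k"
        unfolding eventually_at_topological using U S(2) lab by (intro exI[of _ U]) auto
      then show ?thesis using True by blast
    qed
  qed
  then obtain c where c: "\<And>z. z \<in> L \<Longrightarrow> \<pi> z \<notin> X \<Longrightarrow> label z = c z"
      "\<And>z. z \<in> L \<Longrightarrow> \<forall>\<^sub>F y in at z within L. \<pi> y \<notin> X \<and> label y = c z"
    by metis
  have const: "label z = label w"
    if C: "C \<in> components L" and zw: "z \<in> C" "w \<in> C" "\<pi> z \<notin> X" "\<pi> w \<notin> X" for C z w
  proof -
    have CL: "C \<subseteq> L" by (rule component_facts(2)[OF C])
    have "c z = c w"
    proof (rule connected_local_const[OF component_facts(3)[OF C] zw(1,2)], intro ballI)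
      fix a assume a: "a \<in> C"
      then have "a \<in> L" using CL by blast
      have "\<forall>\<^sub>F y in at a within C. \<pi> y \<notin> X \<and> label y = c a"
        using c(2)[OF \<open>a \<in> L\<close>] at_le[OF CL, of a] by (rule filter_leD[rotated])
      moreover have "\<forall>\<^sub>F y in at a within C. y \<in> C" by (auto simp: eventually_at_topological)
      ultimately show "\<forall>\<^sub>F y in at a within C. c a = c y"
        by eventually_elim (use c(1) CL in auto)
    qed
    moreover have "z \<in> L" "w \<in> L" using zw(1,2) CL by blast+
    ultimately show ?thesis using c(1)[of z] c(1)[of w] zw(3,4) by simp
  qed
  have "\<exists>C. C \<in> components L \<and> (\<exists>z\<in>C. \<pi> z \<notin> X \<and> label z = n)" if n: "n \<in> {0..<k}" for n
  proof -
    obtain e where e: "e \<in> E" "k dvd f (A.tail e) - n" using every by blast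
    obtain y where y: "y \<in> e" using in_components_nonempty[OF e(1)] by blast
    then have "y \<in> G - X" using in_components_subset[OF e(1)] by blast
    then obtain z where z: "z \<in> L" "y = \<pi> z" "\<pi> z \<notin> X" by (auto simp: G_def)
    obtain C where C: "C \<in> components L" "z \<in> C" using z(1) Union_components[of L] by blast
    have "f (A.tail e) mod k = n mod k" using e(2) by (simp add: mod_eq_dvd_iff)
    then have "label z = n" using edge[OF e(1), of z] y z(2) n by (simp add: label_def)
    then show ?thesis using C z(3) by blast
  qed
  then obtain comp where comp: "\<And>n. n \<in> {0..<k} \<Longrightarrow> comp n \<in> components L \<and> (\<exists>z\<in>comp n. \<pi> z \<notin> X \<and> label z = n)"
    by metis
  have "inj_on comp {0..<k}"
  proof (rule inj_onI)
    fix m n assume mn: "m \<in> {0..<k}" "n \<in> {0..<k}" "comp m = comp n"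
    obtain z where z: "z \<in> comp m" "\<pi> z \<notin> X" "label z = m" using comp[OF mn(1)] by blast
    obtain w where w: "w \<in> comp n" "\<pi> w \<notin> X" "label w = n" using comp[OF mn(2)] by blast
    have "label z = label w"
      using const[of "comp m" z w] comp[OF mn(1)] z w mn(3) by simp
    then show "m = n" using z w by simp
  qed
  then have "card {0..<k} \<le> card (components L)"
    by (rule card_inj_on_le[OF _ _ finC]) (use comp in blast)
  then show ?thesis using k by simp
qed

end

section \<open>From the sphere to the plane\<close>

lemma homeomorphism_component:
  assumes hom: "homeomorphism S T f g" and C: "C \<in> components S"
  shows "f ` C \<in> components T"
proof -
  obtain x where x: "x \<in> C" using in_components_nonempty[OF C] by blast
  have CS: "C \<subseteq> S" by (rule in_components_subset[OF C])
  then have fxT: "f x \<in> T" using homeomorphism_image1[OF hom] x by blast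
  define D where "D = connected_component_set T (f x)"
  have D: "D \<in> components T" unfolding D_def using fxT by (rule componentsI)
  have fx: "f x \<in> D" unfolding D_def using fxT by simp
  have DT: "D \<subseteq> T" by (rule in_components_subset[OF D])
  have "f ` C \<subseteq> D"
  proof (rule components_maximal[OF D])
    show "connected (f ` C)"
      by (rule connected_continuous_image[OF continuous_on_subset[OF homeomorphism_cont1[OF hom] CS] in_components_connected[OF C]])
    show "f ` C \<subseteq> T" using CS homeomorphism_image1[OF hom] by blast
    show "D \<inter> f ` C \<noteq> {}" using x fx by blast
  qed
  moreover have "g ` D \<subseteq> C"
  proof (rule components_maximal[OF C])
    show "connected (g ` D)"
      by (rule connected_continuous_image[OF continuous_on_subset[OF homeomorphism_cont2[OF hom] DT] in_components_connected[OF D]])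
    show "g ` D \<subseteq> S" using DT homeomorphism_image2[OF hom] by blast
    have "g (f x) = x" using homeomorphism_apply1[OF hom] x CS by blast
    then show "C \<inter> g ` D \<noteq> {}" using x fx by (metis disjoint_iff imageI)
  qed
  then have "f ` g ` D \<subseteq> f ` C" by blast
  moreover have "f ` g ` D = D"
    unfolding image_image using homeomorphism_apply2[OF hom] DT by force
  ultimately have "f ` C = D" by simp
  then show ?thesis using D by simp
qed

lemma components_homeomorphism:
  assumes hom: "homeomorphism S T f g"
  shows "components T = (`) f ` components S"
proof
  show "(`) f ` components S \<subseteq> components T"
    using homeomorphism_component[OF hom] by blast
  show "components T \<subseteq> (`) f ` components S"
  proof
    fix D assume D: "D \<in> components T"
    have "f ` g ` D = D"
      unfolding image_image using homeomorphism_apply2[OF hom] in_components_subset[OF D] by force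
    moreover have "g ` D \<in> components S"
      by (rule homeomorphism_component[OF homeomorphism_symD[OF hom] D])
    ultimately show "D \<in> (`) f ` components S" by (metis imageI)
  qed
qed

lemma inj_on_image_components:
  assumes "inj_on f S"
  shows "inj_on ((`) f) (components S)"
  using assms by (intro inj_on_image) simp

lemma closure_continuous_image:
  assumes "continuous_on S f" "x \<in> S" "A \<subseteq> S" "x \<in> closure A"
  shows "f x \<in> closure (f ` A)"
proof (rule ccontr)
  assume "f x \<notin> closure (f ` A)"
  then have "openin (top_of_set S) (S \<inter> f -` (- closure (f ` A)))" "x \<in> S \<inter> f -` (- closure (f ` A))"
    using assms(1,2) by (auto intro!: continuous_openin_preimage_gen open_Compl)
  then obtain U where U: "open U" "x \<in> U" "S \<inter> U = S \<inter> f -` (- closure (f ` A))"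
    by (auto simp: openin_open)
  obtain y where y: "y \<in> A" "y \<in> U"
    using U(1,2) assms(4) by (metis disjoint_iff open_Int_closure_eq_empty)
  then have "y \<in> S \<inter> f -` (- closure (f ` A))" using U(3) assms(3) by blast
  then show False using y(1) closure_subset[of "f ` A"] by blast
qed

lemma punctured_sphere_plane:
  assumes "p \<in> S2"
  obtains \<sigma> :: "real^3 \<Rightarrow> complex" and \<tau> where "homeomorphism (S2 - {p}) UNIV \<sigma> \<tau>"
proof -
  have "(sphere (0::real^3) 1 - {p}) homeomorphic (UNIV :: complex set)"
    using assms by (intro homeomorphic_punctured_sphere_affine) (auto simp: S2_def)
  then show thesis using that unfolding homeomorphic_def S2_def by blast
qed

text \<open>Projecting the sphere to the plane from a point outside \<open>F\<close> reduces this to the corresponding fact for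
  open sets in the plane.\<close>

lemma connected_sphere_delete_point:
  assumes F: "connected F" "openin (top_of_set S2) F" "F \<noteq> S2"
  shows "connected (F - {p})"
proof -
  have "F \<subseteq> S2" using openin_imp_subset[OF F(2)] .
  then obtain q where q: "q \<in> S2" "q \<notin> F" using F(3) by blast
  obtain \<sigma> :: "real^3 \<Rightarrow> complex" and \<tau> where hom: "homeomorphism (S2 - {q}) UNIV \<sigma> \<tau>"
    by (rule punctured_sphere_plane[OF q(1)])
  have Fq: "F \<subseteq> S2 - {q}" using q \<open>F \<subseteq> S2\<close> by blast
  have "openin (top_of_set (S2 - {q})) F"
    by (rule openin_subset_trans[OF F(2) Fq]) blast
  then have "open (\<sigma> ` F)"
    using homeomorphism_imp_open_map[OF hom] by simp
  moreover have "connected (\<sigma> ` F)"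
    by (rule connected_continuous_image[OF continuous_on_subset[OF homeomorphism_cont1[OF hom] Fq] F(1)])
  ultimately have "connected (\<sigma> ` F - {\<sigma> p})"
    by (intro connected_open_delete) auto
  then have "connected (\<tau> ` (\<sigma> ` F - {\<sigma> p}))"
    by (intro connected_continuous_image continuous_on_subset[OF homeomorphism_cont2[OF hom]]) auto
  moreover have "\<tau> ` (\<sigma> ` F - {\<sigma> p}) = F - {p}" if "p \<in> F"
  proof -
    have inv: "\<tau> (\<sigma> x) = x" if "x \<in> F" for x using homeomorphism_apply1[OF hom] that Fq by blast
    have "inj_on \<sigma> F" using inv by (rule inj_on_inverseI)
    then have "\<sigma> ` F - {\<sigma> p} = \<sigma> ` (F - {p})"
      using inj_on_image_set_diff[of \<sigma> F F "{p}"] \<open>p \<in> F\<close> by simp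
    then show ?thesis using inv by (force simp: image_image)
  qed
  ultimately show ?thesis using F(1) by (cases "p \<in> F") auto
qed

lemma bij_betw_restrict_preimage:
  assumes "bij_betw f A B"
  shows "bij_betw f {x \<in> A. f x \<in> C} (B \<inter> C)"
proof (rule bij_betw_subset[OF assms])
  show "f ` {x \<in> A. f x \<in> C} = B \<inter> C"
    using bij_betw_imp_surj_on[OF assms] by blast
qed blast

lemma ambient_isotopic_homeomorphism:
  assumes "ambient_isotopic K L" "K \<subseteq> S3"
  obtains f g where "homeomorphism K L f g"
proof -
  obtain H :: "real \<Rightarrow> (real^3) \<times> real \<Rightarrow> (real^3) \<times> real" where
    H: "\<forall>t\<in>{0..1}. \<exists>G. homeomorphism S3 S3 (H t) G" "H 1 ` K = L"
    using assms(1) unfolding ambient_isotopic_def by blast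
  have "(1::real) \<in> {0..1}" by simp
  then obtain G where G: "homeomorphism S3 S3 (H 1) G" using H(1) by blast
  have "L \<subseteq> S3" using H(2) assms(2) homeomorphism_image1[OF G] by blast
  then have "homeomorphism K L (H 1) G"
    by (rule homeomorphism_of_subsets[OF G assms(2) _ H(2)])
  then show thesis by (rule that)
qed

lemma link_homeomorphic_image:
  assumes K: "link K" and hom: "homeomorphism K L f g"
  shows "compact L" "finite (components L)" "card (components L) = card (components K)"
    "\<And>C. C \<in> components L \<Longrightarrow> C homeomorphic sphere (0::complex) 1"
proof -
  have cL: "components L = (`) f ` components K" by (rule components_homeomorphism[OF hom])
  have circ: "C homeomorphic sphere (0::complex) 1" if "C \<in> components K" for C
    using K that by (simp add: link_def)
  have fin: "finite (components K)" using K by (simp add: link_def)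
  have "compact C" if "C \<in> components K" for C
    using homeomorphic_compactness[OF circ[OF that]] by simp
  then have "compact (\<Union>(components K))" using fin by (intro compact_Union) auto
  then have "compact K" by simp
  then show "compact L"
    using compact_continuous_image[OF homeomorphism_cont1[OF hom]] homeomorphism_image1[OF hom] by simp
  show "finite (components L)" using fin by (simp add: cL)
  have "inj_on f K" using homeomorphism_apply1[OF hom] by (rule inj_on_inverseI)
  then show "card (components L) = card (components K)"
    unfolding cL by (intro card_image inj_on_image_components)
  show "C homeomorphic sphere (0::complex) 1" if C: "C \<in> components L" for C
  proof -
    obtain D where D: "D \<in> components K" "C = f ` D" using C cL by blast
    have "homeomorphism D C f g"
      using in_components_subset[OF D(1)] in_components_subset[OF C]
      by (intro homeomorphism_of_subsets[OF hom _ _ D(2)[symmetric]])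
    then have "D homeomorphic C" unfolding homeomorphic_def by blast
    then show ?thesis using circ[OF D(1)] homeomorphic_sym homeomorphic_trans by blast
  qed
qed

lemma transverse_double_pointE:
  assumes "transverse_double_point L p"
  obtains U A B and h :: "real^3 \<Rightarrow> real \<times> real" and g where
    "openin (top_of_set S2) U" "p \<in> U" "homeomorphism U UNIV h g" "h p = (0, 0)"
    "openin (top_of_set L) A" "openin (top_of_set L) B" "A \<inter> B = {}" "A \<union> B = {z \<in> L. proj z \<in> U}"
    "bij_betw (h \<circ> proj) A (UNIV \<times> {0})" "bij_betw (h \<circ> proj) B ({0} \<times> UNIV)"
  using assms unfolding transverse_double_point_def by (elim exE conjE) (rule that; assumption)

lemma proj_in_S2: "fst z \<noteq> 0 \<Longrightarrow> proj z \<in> S2"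
  by (simp add: proj_def S2_def norm_sgn)

text \<open>In a chart at \<open>p\<close> the shadow lies in the two axes, so it misses the point with coordinates \<open>(1, 1)\<close>.\<close>

lemma shadow_misses_point:
  assumes "transverse_double_point L p"
  obtains q where "q \<in> S2" "q \<notin> shadow L"
proof (rule transverse_double_pointE[OF assms])
  fix U A B and h :: "real^3 \<Rightarrow> real \<times> real" and g
  assume U: "openin (top_of_set S2) U" "homeomorphism U UNIV h g"
    and AB: "A \<union> B = {z \<in> L. proj z \<in> U}"
      "bij_betw (h \<circ> proj) A (UNIV \<times> {0})" "bij_betw (h \<circ> proj) B ({0} \<times> UNIV)"
  have gU: "g (1, 1) \<in> U" "h (g (1, 1)) = (1, 1)"
    using homeomorphism_image2[OF U(2)] homeomorphism_apply2[OF U(2)] by auto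
  have "g (1, 1) \<notin> shadow L"
  proof
    assume "g (1, 1) \<in> shadow L"
    then obtain z where z: "z \<in> L" "proj z = g (1, 1)" by (auto simp: shadow_def)
    then have "z \<in> A \<union> B" unfolding AB(1) using gU by simp
    then have "(h \<circ> proj) z \<in> UNIV \<times> {0} \<union> {0} \<times> UNIV"
      using bij_betwE[OF AB(2)] bij_betwE[OF AB(3)] by blast
    then show False using z(2) gU(2) by simp
  qed
  then show thesis using that[of "g (1, 1)"] gU(1) openin_imp_subset[OF U(1)] by blast
qed

text \<open>The sphere is projected to the plane from a point \<open>q\<close> off the shadow.  Edges are carried to edges, and faces to
  faces, except that the face of \<open>q\<close> loses that point; it stays connected and has the same edges on its
  frontier.\<close>

lemma diagram_components_ge:
  assumes K: "link K" and dia: "is_diagram_of L K" and con: "connected_reduced L"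
    and k: "0 < k" and dvd: "\<And>F. F \<in> faces L \<Longrightarrow> k dvd int (card (boundary_edges L F))"
  shows "k \<le> int (card (components K))"
proof -
  have "K \<subseteq> S3" using K by (simp add: link_def)
  then obtain \<phi> \<psi> where "homeomorphism K L \<phi> \<psi>"
    using ambient_isotopic_homeomorphism dia unfolding is_diagram_of_def by metis
  note L = link_homeomorphic_image[OF K this]
  have reg: "\<And>z. z \<in> L \<Longrightarrow> fst z \<noteq> 0" "finite (crossings L)"
      "\<And>p. p \<in> crossings L \<Longrightarrow> transverse_double_point L p"
    using dia by (auto simp: is_diagram_of_def regular_projection_def)
  have red: "crossings L \<noteq> {}" "connected (shadow L)" "\<And>v. v \<in> crossings L \<Longrightarrow> connected (shadow L - {v})"
    using con by (auto simp: connected_reduced_def)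
  have sS2: "shadow L \<subseteq> S2" using reg(1) proj_in_S2 by (auto simp: shadow_def)
  obtain p0 where "p0 \<in> crossings L" using red(1) by blast
  then obtain q where q: "q \<in> S2" "q \<notin> shadow L"
    using shadow_misses_point[OF reg(3)] by blast
  obtain \<sigma> :: "real^3 \<Rightarrow> complex" and \<tau> where hom: "homeomorphism (S2 - {q}) UNIV \<sigma> \<tau>"
    by (rule punctured_sphere_plane[OF q(1)])
  have inv: "\<tau> (\<sigma> x) = x" if "x \<in> S2 - {q}" for x by (rule homeomorphism_apply1[OF hom that])
  have inv': "\<sigma> (\<tau> x) = x" for x using homeomorphism_apply2[OF hom] by simp
  have \<tau>im: "\<tau> x \<in> S2 - {q}" for x using homeomorphism_image2[OF hom] by blast
  have inj: "inj_on \<sigma> (S2 - {q})" using inv by (rule inj_on_inverseI)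
  have sq: "shadow L \<subseteq> S2 - {q}" using sS2 q(2) by blast
  have cs: "crossings L \<subseteq> shadow L" by (auto simp: crossings_def shadow_def)
  define \<pi> where "\<pi> = \<sigma> \<circ> proj"
  have projL: "proj z \<in> S2 - {q}" if "z \<in> L" for z using that sq by (auto simp: shadow_def)
  have "continuous_on L proj"
    unfolding proj_def using reg(1) by (intro continuous_intros) auto
  then have cont: "continuous_on L \<pi>"
    unfolding \<pi>_def using projL
    by (intro continuous_on_compose continuous_on_subset[OF homeomorphism_cont1[OF hom]]) auto
  have \<pi>L: "\<pi> ` L = \<sigma> ` shadow L" by (simp add: \<pi>_def shadow_def image_comp)
  have \<pi>eq: "\<pi> z = \<pi> w \<longleftrightarrow> proj z = proj w" if "z \<in> L" "w \<in> L" for z w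
    using inj_onD[OF inj _ projL[OF that(1)] projL[OF that(2)]] by (auto simp: \<pi>_def)
  have dp: "double_points \<pi> L = \<sigma> ` crossings L"
  proof (intro equalityI subsetI)
    fix p assume "p \<in> double_points \<pi> L"
    then obtain z w where zw: "z \<in> L" "w \<in> L" "z \<noteq> w" "\<pi> z = p" "\<pi> w = p" unfolding double_points_def by blast
    then have "proj z \<in> crossings L" using \<pi>eq[of z w] unfolding crossings_def by auto
    then show "p \<in> \<sigma> ` crossings L" using zw(4) unfolding \<pi>_def by auto
  next
    fix p assume "p \<in> \<sigma> ` crossings L"
    then obtain z w where "z \<in> L" "w \<in> L" "z \<noteq> w" "p = \<sigma> (proj z)" "proj w = proj z" unfolding crossings_def by blast
    moreover from this have "\<pi> z = p" "\<pi> w = p" by (simp_all add: \<pi>_def)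
    ultimately show "p \<in> double_points \<pi> L" unfolding double_points_def by blast
  qed
  have img_diff: "\<sigma> ` (M - N) = \<sigma> ` M - \<sigma> ` N" if "M \<subseteq> S2 - {q}" "N \<subseteq> S2 - {q}" for M N
    by (rule inj_on_image_set_diff[OF inj]) (use that in blast)+
  have sub_cont: "continuous_on M \<sigma>" if "M \<subseteq> S2 - {q}" for M
    using continuous_on_subset[OF homeomorphism_cont1[OF hom] that] .

  interpret P: planar_link L \<pi>
  proof
    show "compact L" "finite (components L)" by (rule L)+
    show "C homeomorphic sphere (0::complex) 1" if "C \<in> components L" for C by (rule L(4)[OF that])
    show "continuous_on L \<pi>" by (rule cont)
    show "finite (double_points \<pi> L)" "double_points \<pi> L \<noteq> {}" using reg(2) red(1) by (simp_all add: dp)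
    show "connected (\<pi> ` L)"
      unfolding \<pi>L by (rule connected_continuous_image[OF sub_cont[OF sq] red(2)])
    fix v assume "v \<in> double_points \<pi> L"
    then obtain p where p: "p \<in> crossings L" "v = \<sigma> p" using dp by blast
    have pq: "p \<in> S2 - {q}" using p(1) cs sq by blast
    have "\<pi> ` L - {v} = \<sigma> ` (shadow L - {p})"
      unfolding \<pi>L p(2) using img_diff[OF sq, of "{p}"] pq by simp
    also have "connected \<dots>"
      using sq by (intro connected_continuous_image[OF sub_cont red(3)[OF p(1)]]) blast
    finally show "connected (\<pi> ` L - {v})" .
    show "\<exists>V r h \<theta> A B. open V \<and> v \<in> V \<and> 0 < r \<and> homeomorphism V (ball 0 r) h \<theta> \<and> h v = (0::real, 0::real) \<and>
        openin (top_of_set L) A \<and> openin (top_of_set L) B \<and> A \<inter> B = {} \<and> A \<union> B = {z \<in> L. \<pi> z \<in> V} \<and>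
        bij_betw (h \<circ> \<pi>) A ((UNIV \<times> {0}) \<inter> ball 0 r) \<and> bij_betw (h \<circ> \<pi>) B (({0} \<times> UNIV) \<inter> ball 0 r)"
    proof (rule transverse_double_pointE[OF reg(3)[OF p(1)]])
      fix U A B and h :: "real^3 \<Rightarrow> real \<times> real" and g
      assume U: "openin (top_of_set S2) U" "p \<in> U" "homeomorphism U UNIV h g" "h p = (0, 0)"
        and AB: "openin (top_of_set L) A" "openin (top_of_set L) B" "A \<inter> B = {}" "A \<union> B = {z \<in> L. proj z \<in> U}"
          "bij_betw (h \<circ> proj) A (UNIV \<times> {0})" "bij_betw (h \<circ> proj) B ({0} \<times> UNIV)"
      \<comment> \<open>a radius for which the shrunken chart avoids \<open>q\<close>\<close>
      define r where "r = (if q \<in> U then norm (h q) else 1)"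
      have "h q \<noteq> (0, 0)" if "q \<in> U"
        using homeomorphism_apply1[OF U(3) that] homeomorphism_apply1[OF U(3,2)] U(4) pq by auto
      then have r: "0 < r" by (auto simp: r_def zero_prod_def)
      define U' where "U' = g ` ball 0 r"
      have gU: "g z \<in> U" "h (g z) = z" for z
        using homeomorphism_image2[OF U(3)] homeomorphism_apply2[OF U(3)] by auto
      have U'_iff: "x \<in> U' \<longleftrightarrow> x \<in> U \<and> h x \<in> ball 0 r" for x
      proof
        show "x \<in> U \<and> h x \<in> ball 0 r" if "x \<in> U'" using that gU unfolding U'_def by auto
        show "x \<in> U'" if "x \<in> U \<and> h x \<in> ball 0 r"
          using that homeomorphism_apply1[OF U(3), of x] unfolding U'_def by (metis imageI)
      qed
      have qU': "q \<notin> U'" by (auto simp: U'_iff r_def)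
      have U'S: "U' \<subseteq> S2 - {q}" using U'_iff openin_imp_subset[OF U(1)] qU' by blast
      have "openin (top_of_set U) U'"
        unfolding U'_def by (rule homeomorphism_imp_open_map[OF homeomorphism_symD[OF U(3)]]) simp
      then have "openin (top_of_set S2) U'" using U(1) by (rule openin_trans)
      then have "openin (top_of_set (S2 - {q})) U'"
        by (rule openin_subset_trans[OF _ U'S]) blast
      then have openV: "open (\<sigma> ` U')" using homeomorphism_imp_open_map[OF hom] by simp
      have homU': "homeomorphism U' (ball 0 r) h g"
      proof (rule homeomorphism_of_subsets[OF U(3)])
        show "h ` U' = ball 0 r" unfolding U'_def image_image gU by simp
      qed (auto simp: U'_iff)
      have "homeomorphism U' (\<sigma> ` U') \<sigma> \<tau>"
        by (rule homeomorphism_of_subsets[OF hom U'S _ refl]) simp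
      then have homV: "homeomorphism (\<sigma> ` U') (ball 0 r) (h \<circ> \<tau>) (\<sigma> \<circ> g)"
        by (rule homeomorphism_compose[OF homeomorphism_symD homU'])
      have inV: "\<pi> z \<in> \<sigma> ` U' \<longleftrightarrow> proj z \<in> U' " if "z \<in> L" for z
      proof
        assume "\<pi> z \<in> \<sigma> ` U'"
        then obtain u where "u \<in> U'" "\<sigma> (proj z) = \<sigma> u" by (auto simp: \<pi>_def)
        then show "proj z \<in> U'" using inj_onD[OF inj _ projL[OF that]] U'S by blast
      qed (simp add: \<pi>_def)
      \<comment> \<open>the part of the link over the shrunken chart, to which the two strands are cut down\<close>
      define R where "R = L \<inter> \<pi> -` (\<sigma> ` U')"
      have R: "openin (top_of_set L) R"
        unfolding R_def by (rule continuous_openin_preimage_gen[OF cont openV])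
      have hp: "(h \<circ> \<tau> \<circ> \<pi>) z = (h \<circ> proj) z" if "z \<in> L" for z
        using inv[OF projL[OF that]] by (simp add: \<pi>_def)
      have ABL: "A \<subseteq> L" "B \<subseteq> L" using openin_imp_subset AB(1,2) by blast+
      have AR: "M \<inter> R = {z \<in> M. (h \<circ> proj) z \<in> ball 0 r}" if "M \<subseteq> A \<union> B" "M \<subseteq> L" for M
      proof (intro equalityI subsetI)
        show "z \<in> {z \<in> M. (h \<circ> proj) z \<in> ball 0 r}" if "z \<in> M \<inter> R" for z
          using that inV[of z] U'_iff[of "proj z"] \<open>M \<subseteq> L\<close> by (auto simp: R_def)
        show "z \<in> M \<inter> R" if "z \<in> {z \<in> M. (h \<circ> proj) z \<in> ball 0 r}" for z
        proof -
          have zM: "z \<in> M" "h (proj z) \<in> ball 0 r" using that by auto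
          then have "z \<in> L" "proj z \<in> U" using \<open>M \<subseteq> A \<union> B\<close> AB(4) by blast+
          then show ?thesis using zM inV[of z] U'_iff[of "proj z"] by (simp add: R_def)
        qed
      qed
      have bij: "bij_betw (h \<circ> \<tau> \<circ> \<pi>) (M \<inter> R) (Z \<inter> ball 0 r)"
        if "bij_betw (h \<circ> proj) M Z" "M \<subseteq> A \<union> B" "M \<subseteq> L" for M Z
      proof -
        have "bij_betw (h \<circ> proj) (M \<inter> R) (Z \<inter> ball 0 r)"
          unfolding AR[OF that(2,3)] by (rule bij_betw_restrict_preimage[OF that(1)])
        moreover have "bij_betw (h \<circ> \<tau> \<circ> \<pi>) (M \<inter> R) (Z \<inter> ball 0 r) = bij_betw (h \<circ> proj) (M \<inter> R) (Z \<inter> ball 0 r)"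
          by (rule bij_betw_cong) (use hp that(3) in blast)
        ultimately show ?thesis by blast
      qed
      show ?thesis
      proof (intro exI conjI)
        show "open (\<sigma> ` U')" by (rule openV)
        show "v \<in> \<sigma> ` U'" using U(2,4) r by (auto simp: p(2) U'_iff zero_prod_def)
        show "0 < r" by (rule r)
        show "homeomorphism (\<sigma> ` U') (ball 0 r) (h \<circ> \<tau>) (\<sigma> \<circ> g)" by (rule homV)
        show "(h \<circ> \<tau>) v = (0, 0)" using inv[OF pq] U(4) by (simp add: p(2))
        show "openin (top_of_set L) (A \<inter> R)" "openin (top_of_set L) (B \<inter> R)"
          using AB(1,2) R by (simp_all add: openin_Int)
        show "(A \<inter> R) \<inter> (B \<inter> R) = {}" using AB(3) by blast
        show "(A \<inter> R) \<union> (B \<inter> R) = {z \<in> L. \<pi> z \<in> \<sigma> ` U'}"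
        proof -
          have "R \<subseteq> A \<union> B" unfolding AB(4) R_def using inV U'_iff by blast
          then have "(A \<inter> R) \<union> (B \<inter> R) = R" by blast
          then show ?thesis by (auto simp: R_def)
        qed
        show "bij_betw (h \<circ> \<tau> \<circ> \<pi>) (A \<inter> R) (UNIV \<times> {0} \<inter> ball 0 r)"
          by (rule bij[OF AB(5) _ ABL(1)]) blast
        show "bij_betw (h \<circ> \<tau> \<circ> \<pi>) (B \<inter> R) ({0} \<times> UNIV \<inter> ball 0 r)"
          by (rule bij[OF AB(6) _ ABL(2)]) blast
      qed
    qed
  qed

  have XG: "P.X = \<sigma> ` crossings L" "P.G = \<sigma> ` shadow L"
    by (simp_all add: P.X_def P.G_def dp \<pi>L)
  have E: "P.E = (`) \<sigma> ` edges L"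
  proof -
    have "P.G - P.X = \<sigma> ` (shadow L - crossings L)"
      unfolding XG using img_diff[OF sq] cs sq by blast
    moreover have "homeomorphism (shadow L - crossings L) (\<sigma> ` (shadow L - crossings L)) \<sigma> \<tau>"
      using sq by (intro homeomorphism_of_subsets[OF hom _ _ refl]) blast+
    ultimately show ?thesis unfolding edges_def using components_homeomorphism by metis
  qed
  have injE: "inj_on ((`) \<sigma>) (edges L)"
    unfolding edges_def using sq by (intro inj_on_image_components inj_on_subset[OF inj]) blast
  have closedS2: "closed (shadow L)"
    unfolding shadow_def by (intro compact_imp_closed compact_continuous_image \<open>continuous_on L proj\<close> L(1))

  have "k dvd int (card {e \<in> P.E. e \<subseteq> frontier F'})" if F': "F' \<in> components (- P.G)" for F'
  proof -
    have "- P.G = \<sigma> ` (S2 - {q} - shadow L)"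
      unfolding XG using img_diff[OF order_refl sq] homeomorphism_image1[OF hom] by (simp add: Compl_eq_Diff_UNIV)
    moreover have "homeomorphism (S2 - {q} - shadow L) (\<sigma> ` (S2 - {q} - shadow L)) \<sigma> \<tau>"
      by (intro homeomorphism_of_subsets[OF hom _ _ refl]) blast+
    ultimately obtain F0 where F0: "F0 \<in> components (S2 - {q} - shadow L)" "F' = \<sigma> ` F0"
      using components_homeomorphism F' by (metis (no_types, lifting) imageE)
    have F0s: "F0 \<subseteq> S2 - {q} - shadow L" by (rule in_components_subset[OF F0(1)])
    obtain F where F: "F \<in> faces L" "F0 \<subseteq> F"
      using exists_component_superset[of F0 "S2 - shadow L"] F0s q in_components_connected[OF F0(1)]
      unfolding faces_def by blast
    have Fs: "F \<subseteq> S2 - shadow L" "connected F"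
      using F(1) in_components_subset in_components_connected unfolding faces_def by blast+
    have openF: "openin (top_of_set S2) F"
    proof -
      have "openin (top_of_set S2) (S2 - shadow L)"
        using closedS2 by (simp add: openin_diff closed_subset sS2)
      moreover have "locally connected S2"
        unfolding S2_def by (rule ANR_imp_locally_connected[OF ANR_sphere])
      ultimately show ?thesis
        using F(1) unfolding faces_def
        by (meson openin_components_locally_connected openin_trans locally_open_subset)
    qed
    have "F \<noteq> S2" using Fs(1) sS2 \<open>p0 \<in> crossings L\<close> cs by blast
    then have "connected (F - {q})" by (rule connected_sphere_delete_point[OF Fs(2) openF])
    then have "F - {q} \<subseteq> F0"
      using F(2) F0s in_components_nonempty[OF F0(1)] Fs(1)
      by (intro components_maximal[OF F0(1)]) blast+
    then have FF0: "F \<subseteq> insert q F0" "F0 \<subseteq> F" using F(2) by blast+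
    have cl: "x \<in> closure F \<longleftrightarrow> \<sigma> x \<in> closure F'" if x: "x \<in> shadow L" for x
    proof -
      have xq: "x \<in> S2 - {q}" using x sq by blast
      have "x \<in> closure F \<longleftrightarrow> x \<in> closure F0"
        using closure_mono[OF FF0(1)] closure_mono[OF FF0(2)] xq by (auto simp: closure_insert)
      also have "\<dots> \<longleftrightarrow> \<sigma> x \<in> closure F'"
      proof
        assume "x \<in> closure F0"
        then show "\<sigma> x \<in> closure F'"
          unfolding F0(2) using F0s xq by (intro closure_continuous_image[OF homeomorphism_cont1[OF hom]]) blast+
      next
        assume "\<sigma> x \<in> closure F'"
        then have "\<tau> (\<sigma> x) \<in> closure (\<tau> ` F')"
          by (intro closure_continuous_image[OF homeomorphism_cont2[OF hom]]) auto
        moreover have "\<tau> ` F' = F0" unfolding F0(2) image_image using inv F0s by force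
        ultimately show "x \<in> closure F0" using inv[OF xq] by simp
      qed
      finally show ?thesis .
    qed
    have fr: "e \<subseteq> (top_of_set S2) frontier_of F \<longleftrightarrow> \<sigma> ` e \<subseteq> frontier F'" if e: "e \<in> edges L" for e
    proof -
      have es: "e \<subseteq> shadow L" using in_components_subset e unfolding edges_def by blast
      have "x \<in> (top_of_set S2) frontier_of F \<longleftrightarrow> \<sigma> x \<in> frontier F'" if "x \<in> e" for x
      proof -
        have x: "x \<in> shadow L" "x \<in> S2" "x \<notin> F" using that es sS2 Fs(1) by blast+
        have "\<sigma> x \<in> P.G" unfolding XG using x(1) by blast
        then have "\<sigma> x \<notin> F'" using in_components_subset[OF F'] by blast
        then have "\<sigma> x \<in> frontier F' \<longleftrightarrow> \<sigma> x \<in> closure F'"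
          using interior_subset[of F'] by (auto simp: frontier_def)
        moreover have "x \<in> (top_of_set S2) frontier_of F \<longleftrightarrow> x \<in> closure F"
        proof -
          have "S2 \<inter> F = F" using Fs(1) by blast
          then have "(top_of_set S2) closure_of F = S2 \<inter> closure F"
            by (simp add: closure_of_subtopology)
          moreover have "x \<notin> (top_of_set S2) interior_of F"
            using x(3) interior_of_subset[of "top_of_set S2" F] by blast
          ultimately show ?thesis using x(2) by (auto simp: frontier_of_def)
        qed
        ultimately show ?thesis using cl[OF x(1)] by blast
      qed
      then show ?thesis by (auto simp: image_subset_iff subset_iff)
    qed
    have "{e \<in> P.E. e \<subseteq> frontier F'} = (`) \<sigma> ` boundary_edges L F"
      unfolding E boundary_edges_def using fr by blast
    moreover have "inj_on ((`) \<sigma>) (boundary_edges L F)"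
      by (rule inj_on_subset[OF injE]) (auto simp: boundary_edges_def)
    ultimately have "card {e \<in> P.E. e \<subseteq> frontier F'} = card (boundary_edges L F)"
      by (simp add: card_image)
    then show ?thesis using dvd[OF F(1)] by simp
  qed
  then have "k \<le> int (card (components L))" by (rule P.components_ge[OF k])
  then show ?thesis using L(3) by simp
qed

theorem theorem2p3:
  fixes a :: "nat \<Rightarrow> int" and N :: enat and k :: int
    and K :: "((real^3) \<times> real) set"
  assumes "N \<ge> 1"
    and "strict_mono_on (seq_index N) a"
    and "a 1 \<ge> 2"
    and "k > 1"
    and "\<forall>i \<in> seq_index N. k dvd a i"
    and "tame_link K"
    and "realized_by N a K"
  shows "int (card (components K)) \<ge> k"
proof -
  obtain L where L: "is_diagram_of L K" "connected_reduced L"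
      "\<forall>F\<in>faces L. \<exists>i\<in>seq_index N. int (card (boundary_edges L F)) = a i"
    using assms(7) unfolding realized_by_def by blast
  have "link K" using assms(6) by (simp add: tame_link_def)
  moreover have "k dvd int (card (boundary_edges L F))" if "F \<in> faces L" for F
    using L(3) that assms(5) by metis
  moreover have "0 < k" using assms(4) by simp
  ultimately show ?thesis
    by (intro diagram_components_ge[OF _ L(1,2)])
qed

end
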